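(* Consider the system, measurements and energy merit $H_{\mathrm e}\colon\mathcal{H}\to\overline{\mathbb{R}}$ of the context, $$H_{\mathrm e}(\phi)=-\tfrac12\int_0^T\|\dot\phi(t)-f(t,\phi(t))\|_Q^2\,dt+\ln\nu(\phi(0))+\sum_{t\in\mathcal{T}_{\mathrm m}}\ln\psi_t(y_t\mid\phi(t)).$$ The state paths associated with the MAP noise paths are the curves $\phi\in\mathcal{H}$ that maximize $H_{\mathrm e}$ over $\mathcal{H}$ (the minimum energy state paths). That is, a pair $(\eta,x_0)$, with $\eta\colon\mathcal{T}\to\mathbb{R}^n$ continuous, $\eta(0)=0$ and $x_0\in\mathbb{R}^n$, is a MAP estimate of $(W,X_0)$ given the measurements if and only if $\eta\in\mathcal{H}$ and the state path $\phi$ associated with $(\eta,x_0)$ maximizes $H_{\mathrm e}$ over $\mathcal{H}$.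
   Context: System. Let $T>0$, $\mathcal{T}=[0,T]$, $\overline{\mathbb{R}}=\mathbb{R}\cup\{-\infty,\infty\}$, $\ln0=-\infty$, $\|\cdot\|$ the Euclidean norm. On a probability space $(\Omega,\mathcal{E},P)$, $X$ is an $\mathbb{R}^n$-valued process with $dX_t=f(t,X_t)\,dt+G\,dW_t$, i.e. $X_t=X_0+\int_0^tf(s,X_s)\,ds+GW_t$ for $t\in\mathcal{T}$, where $W$ is an $n$-dimensional Wiener process. Assumptions: $f\colon\mathbb{R}\times\mathbb{R}^n\to\mathbb{R}^n$ is jointly continuous and of class $C^2_b$ in its second argument $x$ uniformly over its first argument $t$ ($f$ and its first and second $x$-derivatives are continuous in $x$ and bounded uniformly in $t$); $G\in\mathbb{R}^{n\times n}$ has full rank; $X_0$ is independent of $W$; $X_0$ admits a bounded continuous density $\nu$. Set $Q=(GG^{\top})^{-1}$, $\|x\|_Q=\sqrt{x^{\top}Qx}$. Measurements. $\mathcal{T}_{\mathrm m}\subset\mathcal{T}$ is finite and, for $t\in\mathcal{T}_{\mathrm m}$, $Y_t$ is an $\mathbb{R}^{m_t}$-valued random variable. Each $Y_t$ is conditionally independent, given $X_t$, of all states $X_\tau$ and measurements $Y_\tau$ with $\tau\ne t$; $Y_t$ admits a conditional density $\psi_t(y\mid x)$ given $X_t=x$, bounded and continuous in $x$; the measured values $y_t$ satisfy $\mathrm{E}[\psi_t(y_t\mid X_t)]>0$ for each $t\in\mathcal{T}_{\mathrm m}$. $\mathcal{Y}$ denotes the event $\{Y_t=y_t\ \forall t\in\mathcal{T}_{\mathrm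 m}\}$, and for $\mathcal{A}$ in the $\sigma$-algebra generated by $X$ the posterior probability is given by Bayes' rule: $P(\mathcal{A}\mid\mathcal{Y})=\mathrm{E}\big[1_{\mathcal{A}}\prod_{t\in\mathcal{T}_{\mathrm m}}\psi_t(y_t\mid X_t)\big]/\mathrm{E}\big[\prod_{t\in\mathcal{T}_{\mathrm m}}\psi_t(y_t\mid X_t)\big]$. Cameron–Martin space. $\mathcal{H}$ is the space of absolutely continuous $\phi\colon\mathcal{T}\to\mathbb{R}^n$ with $\dot\phi\in L^2(\mathcal{T})$. Associated paths. For $\eta\in\mathcal{H}$ with $\eta(0)=0$ and $x_0\in\mathbb{R}^n$, the state path associated with $(\eta,x_0)$ is the $\phi\in\mathcal{H}$ with $\phi(0)=x_0$ and $\dot\phi(t)=f(t,\phi(t))+G\dot\eta(t)$ for almost every $t\in\mathcal{T}$. MAP noise paths. For continuous $\eta$ with $\eta(0)=0$ and $x_0\in\mathbb{R}^n$ put $\mathcal{C}^\epsilon_{\eta,x_0}=\{\omega:\sup_{t\in\mathcal{T}}\|W_t(\omega)-\eta(t)\|\le\epsilon,\ \|X_0(\omega)-x_0\|\le\epsilon\}$. The pair $(\hat\eta,\hat x_0)$ is a MAP estimate (posterior mode) of $(W,X_0)$ if $P(\mathcal{C}^\epsilon_{\hat\eta,\hat x_0}\mid\mathcal{Y})>0$ for all $\epsilon>0$ and, for all such pairs $(\eta,x_0)$, $$\limsup_{\epsilon\downarrow0}\frac{P(\mathcal{C}^\epsilon_{\eta,x_0}\mid\mathcal{Y})}{P(\mathcal{C}^\epsilon_{\hat\eta,\hat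 x_0}\mid\mathcal{Y})}\le1.$$ Standing assumption on tubes outside the Cameron–Martin space: if $\gamma$ is continuous with $\gamma(0)=0$, $\gamma\notin\mathcal{H}$, $z_0\in\mathbb{R}^n$, and $\eta\in\mathcal{H}$ with $\eta(0)=0$, $\nu(x_0)>0$, then $\lim_{\epsilon\downarrow0}P(\mathcal{C}^\epsilon_{\gamma,z_0})/P(\mathcal{C}^\epsilon_{\eta,x_0})=0$. *)

theory Defs
  imports "HOL-Probability.Probability"
begin

text \<open>The usual \<open>\<epsilon>\<close>-\<open>\<delta>\<close> notion on \<open>[a, b]\<close>; a finite family of non-overlapping
  subintervals \<open>[u, v]\<close> is given as a set of pairs \<open>(u, v)\<close>.\<close>

definition absolutely_continuous_path ::
    "real \<Rightarrow> real \<Rightarrow> (real \<Rightarrow> 'a::real_normed_vector) \<Rightarrow> bool" where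
  "absolutely_continuous_path a b \<phi> \<longleftrightarrow>
     (\<forall>e>0. \<exists>d>0. \<forall>D :: (real \<times> real) set.
        finite D \<longrightarrow>
        (\<forall>(u, v)\<in>D. a \<le> u \<and> u \<le> v \<and> v \<le> b) \<longrightarrow>
        pairwise (\<lambda>I J. {fst I<..<snd I} \<inter> {fst J<..<snd J} = {}) D \<longrightarrow>
        (\<Sum>(u, v)\<in>D. v - u) < d \<longrightarrow>
        (\<Sum>(u, v)\<in>D. norm (\<phi> v - \<phi> u)) < e)"

text \<open>Taken within \<open>[0, T]\<close>, so that it depends only on the path on \<open>[0, T]\<close>. Where the
  path is not differentiable the value is arbitrary; for absolutely continuous paths this
  is a Lebesgue null set.\<close>

definition path_deriv :: "real \<Rightarrow> (real \<Rightarrow> 'a::real_normed_vector) \<Rightarrow> real \<Rightarrow> 'a" where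
  "path_deriv T \<phi> t = vector_derivative \<phi> (at t within {0..T})"

definition square_integrable_on :: "real set \<Rightarrow> (real \<Rightarrow> 'a::euclidean_space) \<Rightarrow> bool" where
  "square_integrable_on S g \<longleftrightarrow>
     set_borel_measurable lebesgue S g \<and> set_integrable lebesgue S (\<lambda>t. (norm (g t))\<^sup>2)"

definition cameron_martin :: "real \<Rightarrow> (real \<Rightarrow> 'a::euclidean_space) set" where
  "cameron_martin T =
     {\<phi>. absolutely_continuous_path 0 T \<phi> \<and> square_integrable_on {0..T} (path_deriv T \<phi>)}"

definition C2b_uniformly :: "(real \<Rightarrow> 'a::euclidean_space \<Rightarrow> 'a) \<Rightarrow> bool" where
  "C2b_uniformly f \<longleftrightarrow>
     (\<exists>(Df :: real \<Rightarrow> 'a \<Rightarrow> 'a \<Rightarrow>\<^sub>L 'a) (D2f :: real \<Rightarrow> 'a \<Rightarrow> 'a \<Rightarrow>\<^sub>L 'a \<Rightarrow>\<^sub>L 'a).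
        (\<forall>t x. (f t has_derivative blinfun_apply (Df t x)) (at x)) \<and>
        (\<forall>t x. (Df t has_derivative blinfun_apply (D2f t x)) (at x)) \<and>
        (\<forall>t. continuous_on UNIV (f t) \<and> continuous_on UNIV (Df t) \<and>
             continuous_on UNIV (D2f t)) \<and>
        (\<exists>B. \<forall>t x. norm (f t x) \<le> B \<and> norm (Df t x) \<le> B \<and> norm (D2f t x) \<le> B))"

text \<open>Standard Wiener process on \<open>[0, T]\<close>, as a process all of whose paths are
  continuous; the increment over \<open>[s, t]\<close> has the law \<open>N(0, (t - s) I)\<close>.\<close>

definition wiener_process ::
    "'w measure \<Rightarrow> real \<Rightarrow> (real \<Rightarrow> 'w \<Rightarrow> real ^ 'n) \<Rightarrow> bool" where
  "wiener_process M T W \<longleftrightarrow>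
     (\<forall>t\<in>{0..T}. W t \<in> borel_measurable M) \<and>
     (\<forall>\<omega>\<in>space M. continuous_on {0..T} (\<lambda>t. W t \<omega>)) \<and>
     (AE \<omega> in M. W 0 \<omega> = 0) \<and>
     (\<forall>s t. 0 \<le> s \<longrightarrow> s < t \<longrightarrow> t \<le> T \<longrightarrow>
        distributed M lborel (\<lambda>\<omega>. W t \<omega> - W s \<omega>)
          (\<lambda>x. ennreal (\<Prod>i\<in>UNIV. normal_density 0 (sqrt (t - s)) (x $ i)))) \<and>
     (\<forall>(k :: nat) (\<tau> :: nat \<Rightarrow> real).
        (\<forall>i\<le>k. \<tau> i \<in> {0..T}) \<longrightarrow> (\<forall>i<k. \<tau> i \<le> \<tau> (Suc i)) \<longrightarrow>
        prob_space.indep_vars M (\<lambda>_. borel) (\<lambda>i \<omega>. W (\<tau> (Suc i)) \<omega> - W (\<tau> i) \<omega>) {..<k})"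

text \<open>The process is regarded as one random element of \<open>(\<real>\<^sup>n)\<^bsup>[0, T]\<^esup>\<close>
  with the product \<open>\<sigma>\<close>-algebra.\<close>

definition indep_of_process ::
    "'w measure \<Rightarrow> real \<Rightarrow> ('w \<Rightarrow> 'a::topological_space) \<Rightarrow>
     (real \<Rightarrow> 'w \<Rightarrow> 'b::topological_space) \<Rightarrow> bool" where
  "indep_of_process M T Z W \<longleftrightarrow>
     prob_space.indep_set M
       (sets (vimage_algebra (space M) Z borel))
       (sets (vimage_algebra (space M) (\<lambda>\<omega>. \<lambda>t\<in>{0..T}. W t \<omega>) (\<Pi>\<^sub>M t\<in>{0..T}. borel)))"

definition solves_sde ::
    "'w measure \<Rightarrow> real \<Rightarrow> (real \<Rightarrow> real ^ 'n \<Rightarrow> real ^ 'n) \<Rightarrow> real ^ 'n ^ 'n \<Rightarrow>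
     (real \<Rightarrow> 'w \<Rightarrow> real ^ 'n) \<Rightarrow> (real \<Rightarrow> 'w \<Rightarrow> real ^ 'n) \<Rightarrow> bool" where
  "solves_sde M T f G W X \<longleftrightarrow>
     (\<forall>t\<in>{0..T}. X t \<in> borel_measurable M) \<and>
     (AE \<omega> in M. set_integrable lebesgue {0..T} (\<lambda>s. f s (X s \<omega>)) \<and>
        (\<forall>t\<in>{0..T}. X t \<omega> = X 0 \<omega> + (LINT s:{0..t}|lebesgue. f s (X s \<omega>)) + G *v W t \<omega>))"

text \<open>\<open>\<real>\<^sup>k\<close> with Lebesgue measure; its points are the functions on \<open>{..<k}\<close>. The
  dimension is a term because it varies with the measurement time.\<close>

abbreviation lborel_power :: "nat \<Rightarrow> (nat \<Rightarrow> real) measure" where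
  "lborel_power k \<equiv> (\<Pi>\<^sub>M i\<in>{..<k}. lborel)"

definition cond_indep_set :: "'w measure \<Rightarrow> 'w measure \<Rightarrow> 'w set set \<Rightarrow> 'w set set \<Rightarrow> bool" where
  "cond_indep_set M F \<A> \<B> \<longleftrightarrow>
     (\<forall>A\<in>\<A>. \<forall>B\<in>\<B>. AE \<omega> in M.
        real_cond_exp M F (indicator (A \<inter> B)) \<omega> =
        real_cond_exp M F (indicator A) \<omega> * real_cond_exp M F (indicator B) \<omega>)"

definition other_events ::
    "'w measure \<Rightarrow> real \<Rightarrow> real set \<Rightarrow> (real \<Rightarrow> nat) \<Rightarrow> (real \<Rightarrow> 'w \<Rightarrow> real ^ 'n) \<Rightarrow>
     (real \<Rightarrow> 'w \<Rightarrow> nat \<Rightarrow> real) \<Rightarrow> real \<Rightarrow> 'w set set" where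
  "other_events M T Tm m X Y t =
     sigma_sets (space M)
       ((\<Union>\<tau>\<in>{0..T} - {t}. sets (vimage_algebra (space M) (X \<tau>) borel)) \<union>
        (\<Union>\<tau>\<in>Tm - {t}. sets (vimage_algebra (space M) (Y \<tau>) (lborel_power (m \<tau>)))))"

text \<open>\<open>\<psi> u x\<close> stands for \<open>\<psi>(u | x)\<close>, a density of \<open>Y\<close> with respect to \<open>N\<close> given \<open>X = x\<close>.\<close>

definition conditional_density ::
    "'w measure \<Rightarrow> 'b measure \<Rightarrow> ('w \<Rightarrow> 'b) \<Rightarrow> ('w \<Rightarrow> 'a::topological_space) \<Rightarrow>
     ('b \<Rightarrow> 'a \<Rightarrow> real) \<Rightarrow> bool" where
  "conditional_density M N Y X \<psi> \<longleftrightarrow>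
     (\<lambda>(u, x). \<psi> u x) \<in> borel_measurable (N \<Otimes>\<^sub>M borel) \<and>
     (\<forall>u\<in>space N. \<forall>x. 0 \<le> \<psi> u x) \<and>
     (\<forall>B\<in>sets N. AE \<omega> in M.
        real_cond_exp M (vimage_algebra (space M) X borel) (indicator (Y -` B \<inter> space M)) \<omega> =
        (LINT u:B|N. \<psi> u (X \<omega>)))"

definition posterior ::
    "'w measure \<Rightarrow> real set \<Rightarrow> (real \<Rightarrow> (nat \<Rightarrow> real) \<Rightarrow> real ^ 'n \<Rightarrow> real) \<Rightarrow>
     (real \<Rightarrow> nat \<Rightarrow> real) \<Rightarrow> (real \<Rightarrow> 'w \<Rightarrow> real ^ 'n) \<Rightarrow> 'w set \<Rightarrow> real" where
  "posterior M Tm \<psi> y X A =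
     (LINT \<omega>|M. indicator A \<omega> * (\<Prod>t\<in>Tm. \<psi> t (y t) (X t \<omega>))) /
     (LINT \<omega>|M. (\<Prod>t\<in>Tm. \<psi> t (y t) (X t \<omega>)))"

definition tube ::
    "'w measure \<Rightarrow> real \<Rightarrow> (real \<Rightarrow> 'w \<Rightarrow> real ^ 'n) \<Rightarrow> ('w \<Rightarrow> real ^ 'n) \<Rightarrow>
     (real \<Rightarrow> real ^ 'n) \<Rightarrow> real ^ 'n \<Rightarrow> real \<Rightarrow> 'w set" where
  "tube M T W X0 \<eta> x0 \<epsilon> =
     {\<omega>\<in>space M. (SUP t\<in>{0..T}. norm (W t \<omega> - \<eta> t)) \<le> \<epsilon> \<and> norm (X0 \<omega> - x0) \<le> \<epsilon>}"

definition admissible_noise :: "real \<Rightarrow> (real \<Rightarrow> real ^ 'n) \<Rightarrow> bool" where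
  "admissible_noise T \<eta> \<longleftrightarrow> continuous_on {0..T} \<eta> \<and> \<eta> 0 = 0"

text \<open>\<open>P\<close> is the (posterior) probability with respect to which modes are taken.\<close>

definition MAP_estimate ::
    "'w measure \<Rightarrow> real \<Rightarrow> ('w set \<Rightarrow> real) \<Rightarrow> (real \<Rightarrow> 'w \<Rightarrow> real ^ 'n) \<Rightarrow>
     ('w \<Rightarrow> real ^ 'n) \<Rightarrow> (real \<Rightarrow> real ^ 'n) \<Rightarrow> real ^ 'n \<Rightarrow> bool" where
  "MAP_estimate M T P W X0 \<eta>' x0' \<longleftrightarrow>
     admissible_noise T \<eta>' \<and>
     (\<forall>\<epsilon>>0. P (tube M T W X0 \<eta>' x0' \<epsilon>) > 0) \<and>
     (\<forall>\<eta> x0. admissible_noise T \<eta> \<longrightarrow>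
        Limsup (at_right 0)
          (\<lambda>\<epsilon>. ereal (P (tube M T W X0 \<eta> x0 \<epsilon>) / P (tube M T W X0 \<eta>' x0' \<epsilon>))) \<le> 1)"

definition associated_state_path ::
    "real \<Rightarrow> (real \<Rightarrow> real ^ 'n \<Rightarrow> real ^ 'n) \<Rightarrow> real ^ 'n ^ 'n \<Rightarrow>
     (real \<Rightarrow> real ^ 'n) \<Rightarrow> real ^ 'n \<Rightarrow> (real \<Rightarrow> real ^ 'n) \<Rightarrow> bool" where
  "associated_state_path T f G \<eta> x0 \<phi> \<longleftrightarrow>
     \<phi> \<in> cameron_martin T \<and> \<phi> 0 = x0 \<and>
     (AE t in lebesgue_on {0..T}. path_deriv T \<phi> t = f t (\<phi> t) + G *v path_deriv T \<eta> t)"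

text \<open>Logarithm of a nonnegative number with the convention \<open>ln 0 = -\<infinity>\<close>.\<close>

definition ereal_ln :: "real \<Rightarrow> ereal" where
  "ereal_ln x = (if x = 0 then -\<infinity> else ereal (ln x))"

definition weighted_norm :: "real ^ 'n ^ 'n \<Rightarrow> real ^ 'n \<Rightarrow> real" where
  "weighted_norm Q x = sqrt (x \<bullet> (Q *v x))"

definition energy_merit ::
    "real \<Rightarrow> (real \<Rightarrow> real ^ 'n \<Rightarrow> real ^ 'n) \<Rightarrow> real ^ 'n ^ 'n \<Rightarrow> (real ^ 'n \<Rightarrow> real) \<Rightarrow>
     real set \<Rightarrow> (real \<Rightarrow> (nat \<Rightarrow> real) \<Rightarrow> real ^ 'n \<Rightarrow> real) \<Rightarrow> (real \<Rightarrow> nat \<Rightarrow> real) \<Rightarrow>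
     (real \<Rightarrow> real ^ 'n) \<Rightarrow> ereal" where
  "energy_merit T f G \<nu> Tm \<psi> y \<phi> =
     (let Q = matrix_inv (G ** transpose G) in
      ereal (- (1 / 2) *
        (LINT t:{0..T}|lebesgue. (weighted_norm Q (path_deriv T \<phi> t - f t (\<phi> t)))\<^sup>2)) +
      ereal_ln (\<nu> (\<phi> 0)) + (\<Sum>t\<in>Tm. ereal_ln (\<psi> t (y t) (\<phi> t))))"

definition maximizes_over :: "('a \<Rightarrow> 'b::linorder) \<Rightarrow> 'a set \<Rightarrow> 'a \<Rightarrow> bool" where
  "maximizes_over H S \<phi> \<longleftrightarrow> \<phi> \<in> S \<and> (\<forall>\<xi>\<in>S. H \<xi> \<le> H \<phi>)"

end

theory Submission
  imports Defs
begin

text \<open>For \<open>\<eta>\<close> in the Cameron--Martin space the Onsager--Machlup limit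
  \<open>P(\<parallel>W - \<eta>\<parallel> \<le> \<epsilon>) / P(\<parallel>W\<parallel> \<le> \<epsilon>) \<longlongrightarrow> exp (- E / 2)\<close>, with \<open>E\<close> the integral of the squared norm of
  the derivative of \<open>\<eta>\<close>, is obtained on dyadic grids, where \<open>W\<close> is a Gaussian random walk. Shifting
  the walk by \<open>\<eta>\<close> and using the symmetry of the centered tube gives the lower bound. Shifting only
  by the interpolant of \<open>\<eta>\<close> on a coarse grid makes the density nearly constant on the tube, and
  Anderson's inequality (from Prekopa--Leindler) removes the remaining shift; this gives the upper
  bound with the energy of the interpolant, which tends to \<open>E\<close> by Fatou's lemma because absolutely
  continuous paths are differentiable almost everywhere.

  By independence and continuity of \<open>\<nu>\<close> the probability of a tube around \<open>(\<eta>, x0)\<close>, divided by a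
  normalisation depending on \<open>\<epsilon>\<close> only, tends to \<open>exp (- E / 2) * \<nu> x0\<close>. On such a tube the sample
  paths of \<open>X\<close> are close to the state path \<open>\<phi>\<close> (Gronwall), so the likelihood weights are nearly
  constant, and the normalised posterior probability tends to a multiple of the exponential of the
  energy merit of \<open>\<phi>\<close>. Outside the Cameron--Martin space this limit is \<open>0\<close>. As some path has positive
  likelihood, MAP estimates are exactly the pairs that maximise the limit.\<close>

section \<open>The Prekopa--Leindler inequality\<close>

text \<open>In continuous time the density of a shifted Wiener process contains the stochastic
  integral of the derivative of \<open>\<eta>\<close>, which in general is not continuous in the
  uniform norm and so cannot be bounded on a small tube. This is why the two bounds are proved
  differently: symmetry removes the linear term from the lower bound at no cost, whereas the upper
  bound may only shift by a path for which this term is a finite combination of values of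
  \<open>W\<close>. Working at finitely many grid times, only densities of finite-dimensional
  Gaussian vectors occur. Tubes are taken in the noise and the initial state, not in the state. The
  drift therefore enters only through the continuous dependence of the state path on
  \<open>(\<eta>, x0)\<close>, and no divergence of \<open>f\<close> appears in the limit. The
  limiting value of a pair may be \<open>0\<close>, where no quotient of limits is available; a pair
  of positive value is needed for comparison. Such a pair is not given: positivity of each single
  expected likelihood has to be turned into one path that is likely at all measurement times at
  once.\<close>

lemma emeasure_lborel_midpoint_left:
  fixes A :: "real set"
  assumes [measurable]: "A \<in> sets borel"
  shows "emeasure lborel A = 2 * emeasure lborel {x. 2 * x - b \<in> A}"
proof -
  have "emeasure lborel A = (\<integral>\<^sup>+x. indicator A x \<partial>lborel)" by simp
  also have "\<dots> = 2 * (\<integral>\<^sup>+x. indicator A (- b + 2 * x) \<partial>lborel)"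
    by (subst nn_integral_real_affine[where c = 2 and t = "-b"]) auto
  also have "(\<integral>\<^sup>+x. indicator A (- b + 2 * x) \<partial>lborel) = (\<integral>\<^sup>+x. indicator {x. 2 * x - b \<in> A} x \<partial>lborel)"
    by (intro nn_integral_cong) (auto simp: indicator_def)
  also have "\<dots> = emeasure lborel {x. 2 * x - b \<in> A}"
    by (intro nn_integral_indicator) measurable
  finally show ?thesis .
qed

text \<open>Midpoints of \<open>A\<close> with one fixed point of \<open>B\<close>, and of one fixed
  point of \<open>A\<close> with \<open>B\<close>, already fill enough of \<open>H\<close>: each
  such image has half the measure, and if the fixed points are the right end of \<open>A\<close> and
  the left end of \<open>B\<close>, the images do not overlap. \<open>Sup A\<close> and
  \<open>Inf B\<close> need not be attained, so points within \<open>e'\<close> of them are used and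
  the rest is cut off.\<close>

lemma brunn_minkowski_real:
  fixes A B H :: "real set"
  assumes [measurable]: "A \<in> sets borel" "B \<in> sets borel" "H \<in> sets borel"
    and "bounded A" "bounded B" "A \<noteq> {}" "B \<noteq> {}"
    and mid: "\<And>a b. a \<in> A \<Longrightarrow> b \<in> B \<Longrightarrow> (a + b) / 2 \<in> H"
  shows "emeasure lborel A + emeasure lborel B \<le> 2 * emeasure lborel H"
proof (rule ennreal_le_epsilon)
  fix e :: real assume "e > 0"
  define e' where "e' = e / 2"
  have "e' > 0" using \<open>e > 0\<close> by (simp add: e'_def)
  have bA: "bdd_above A" and bB: "bdd_below B"
    using assms by (auto intro: bounded_imp_bdd_above bounded_imp_bdd_below)
  obtain a where a: "a \<in> A" "Sup A - e' < a"
    using less_cSupD[OF \<open>A \<noteq> {}\<close>, of "Sup A - e'"] \<open>e' > 0\<close> by auto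
  obtain b where b: "b \<in> B" "b < Inf B + e'"
    using cInf_lessD[OF \<open>B \<noteq> {}\<close>, of "Inf B + e'"] \<open>e' > 0\<close> by auto
  \<comment> \<open>Midpoints of \<open>A'\<close> with \<open>b\<close> lie at or left of
    \<open>(a + b) / 2\<close>, those of \<open>B'\<close> with \<open>a\<close> strictly to the
    right of it; the strict cut in \<open>B'\<close> makes the images disjoint.\<close>
  define A' where "A' = A \<inter> {..a}"
  define B' where "B' = B \<inter> {b<..}"
  have [measurable]: "A' \<in> sets borel" "B' \<in> sets borel"
    unfolding A'_def B'_def by measurable
  let ?A = "{x. 2 * x - b \<in> A'}" and ?B = "{x. 2 * x - a \<in> B'}"
  have sub: "A \<subseteq> A' \<union> {Sup A - e'..Sup A}" "B \<subseteq> B' \<union> {Inf B..Inf B + e'}"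
    using a b bA bB by (auto simp: A'_def B'_def intro: cSup_upper cInf_lower)
  have "emeasure lborel A \<le> emeasure lborel (A' \<union> {Sup A - e'..Sup A})"
    by (intro emeasure_mono sub) measurable
  also have "\<dots> \<le> emeasure lborel A' + emeasure lborel {Sup A - e'..Sup A}"
    by (intro emeasure_subadditive) auto
  finally have 1: "emeasure lborel A \<le> emeasure lborel A' + ennreal e'"
    using \<open>e' > 0\<close> by simp
  have "emeasure lborel B \<le> emeasure lborel (B' \<union> {Inf B..Inf B + e'})"
    by (intro emeasure_mono sub) measurable
  also have "\<dots> \<le> emeasure lborel B' + emeasure lborel {Inf B..Inf B + e'}"
    by (intro emeasure_subadditive) auto
  finally have 2: "emeasure lborel B \<le> emeasure lborel B' + ennreal e'"
    using \<open>e' > 0\<close> by simp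
  have "emeasure lborel A' + emeasure lborel B' = 2 * (emeasure lborel ?A + emeasure lborel ?B)"
    by (subst emeasure_lborel_midpoint_left[of A' b], simp, subst emeasure_lborel_midpoint_left[of B' a])
       (auto simp: distrib_left)
  also have "emeasure lborel ?A + emeasure lborel ?B = emeasure lborel (?A \<union> ?B)"
  proof (rule plus_emeasure)
    show "?A \<in> sets lborel" "?B \<in> sets lborel" by measurable
    show "?A \<inter> ?B = {}" by (auto simp: A'_def B'_def)
  qed
  also have "\<dots> \<le> emeasure lborel H"
  proof (intro emeasure_mono subsetI)
    fix x assume "x \<in> ?A \<union> ?B"
    then show "x \<in> H"
      using mid[of "2 * x - b" b] mid[of a "2 * x - a"] a b by (auto simp: A'_def B'_def)
  qed measurable
  finally have 3: "emeasure lborel A' + emeasure lborel B' \<le> 2 * emeasure lborel H"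
    by (simp add: mult_left_mono)
  have "emeasure lborel A + emeasure lborel B \<le> (emeasure lborel A' + emeasure lborel B') + (ennreal e' + ennreal e')"
    using add_mono[OF 1 2] by (simp add: ac_simps)
  also have "ennreal e' + ennreal e' = ennreal e"
    using \<open>e' > 0\<close> by (subst ennreal_plus[symmetric]) (auto simp: e'_def)
  finally show "emeasure lborel A + emeasure lborel B \<le> 2 * emeasure lborel H + ennreal e"
    using 3 by (meson add_right_mono order_trans)
qed

lemma nn_integral_layer_cake_le_one:
  fixes f :: "real \<Rightarrow> ennreal"
  assumes [measurable]: "f \<in> borel_measurable borel" and "\<And>x. f x \<le> 1"
  shows "(\<integral>\<^sup>+x. f x \<partial>lborel) = (\<integral>\<^sup>+t. emeasure lborel {x. ennreal t < f x} * indicator {0..<1} t \<partial>lborel)"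
proof -
  have "f x = (\<integral>\<^sup>+t. indicator {x. ennreal t < f x} x * indicator {0..<1} t \<partial>lborel)" for x
  proof -
    obtain r where r: "f x = ennreal r" "0 \<le> r" "r \<le> 1"
      using assms(2)[of x] by (cases "f x") (auto simp: top_unique)
    have "(\<integral>\<^sup>+t. indicator {x. ennreal t < f x} x * indicator {0..<1} t \<partial>lborel) =
      (\<integral>\<^sup>+t. indicator {0..<r} t \<partial>lborel)"
      using r by (intro nn_integral_cong) (auto simp: indicator_def ennreal_less_iff)
    then show ?thesis using r by simp
  qed
  then have "(\<integral>\<^sup>+x. f x \<partial>lborel) = (\<integral>\<^sup>+x. \<integral>\<^sup>+t. indicator {x. ennreal t < f x} x * indicator {0..<1} t \<partial>lborel \<partial>lborel)"
    by (rule nn_integral_cong)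
  also have "\<dots> = (\<integral>\<^sup>+t. \<integral>\<^sup>+x. indicator {x. ennreal t < f x} x * indicator {0..<1} t \<partial>lborel \<partial>lborel)"
    by (intro lborel_pair.Fubini') measurable
  also have "\<dots> = (\<integral>\<^sup>+t. emeasure lborel {x. ennreal t < f x} * indicator {0..<1} t \<partial>lborel)"
    by (intro nn_integral_cong) (simp add: nn_integral_multc)
  finally show ?thesis .
qed

text \<open>Both suprema equal \<open>1\<close>, so at each level \<open>t < 1\<close> both
  superlevel sets are nonempty and the Brunn--Minkowski inequality applies level by level.
  Integrating over the levels gives an additive form, which under this normalisation is stronger
  than the multiplicative one.\<close>

lemma prekopa_leindler_normalized:
  fixes f g h :: "real \<Rightarrow> ennreal"
  assumes [measurable]: "f \<in> borel_measurable borel" "g \<in> borel_measurable borel" "h \<in> borel_measurable borel"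
    and le: "\<And>x. f x \<le> 1" "\<And>x. g x \<le> 1"
    and sup: "\<And>t. t < 1 \<Longrightarrow> \<exists>x. t < f x" "\<And>t. t < 1 \<Longrightarrow> \<exists>x. t < g x"
    and supp: "bounded {x. f x \<noteq> 0}" "bounded {x. g x \<noteq> 0}"
    and mid: "\<And>x y. f x * g y \<le> (h ((x + y) / 2))\<^sup>2"
  shows "(\<integral>\<^sup>+x. f x \<partial>lborel) + (\<integral>\<^sup>+x. g x \<partial>lborel) \<le> 2 * (\<integral>\<^sup>+x. h x \<partial>lborel)"
proof -
  \<comment> \<open>Capping \<open>h\<close> at \<open>1\<close> loses nothing, since only levels
    below \<open>1\<close> occur, and makes the layer cake formula applicable.\<close>
  define k where "k x = min (h x) 1" for x
  have [measurable]: "k \<in> borel_measurable borel" unfolding k_def by measurable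
  have *: "emeasure lborel {x. ennreal t < f x} + emeasure lborel {x. ennreal t < g x} \<le>
      2 * emeasure lborel {x. ennreal t < k x}" if t: "0 \<le> t" "t < 1" for t
  proof (rule brunn_minkowski_real)
    have "ennreal t < 1" using t by (simp add: ennreal_less_iff)
    then show "{x. ennreal t < f x} \<noteq> {}" "{x. ennreal t < g x} \<noteq> {}" using sup by auto
    show "bounded {x. ennreal t < f x}" "bounded {x. ennreal t < g x}"
      by (rule bounded_subset[OF supp(1)], auto) (rule bounded_subset[OF supp(2)], auto)
    fix a b assume "a \<in> {x. ennreal t < f x}" "b \<in> {x. ennreal t < g x}"
    moreover obtain p q where "f a = ennreal p" "g b = ennreal q" "0 \<le> p" "0 \<le> q"
      using le[of a] le[of b] by (cases "f a"; cases "g b") (auto simp: top_unique)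
    ultimately have "ennreal t * ennreal t < f a * g b"
      using t by (simp add: ennreal_less_iff ennreal_mult[symmetric] mult_strict_mono')
    also have "\<dots> \<le> (h ((a + b) / 2))\<^sup>2" by (rule mid)
    finally have "ennreal t < h ((a + b) / 2)"
      by (metis leD mult_mono not_le_imp_less power2_eq_square zero_le)
    then show "(a + b) / 2 \<in> {x. ennreal t < k x}" using \<open>ennreal t < 1\<close> by (simp add: k_def)
  qed measurable
  have "(\<integral>\<^sup>+x. f x \<partial>lborel) + (\<integral>\<^sup>+x. g x \<partial>lborel) =
    (\<integral>\<^sup>+t. emeasure lborel {x. ennreal t < f x} * indicator {0..<1} t +
       emeasure lborel {x. ennreal t < g x} * indicator {0..<1} t \<partial>lborel)"
    by (subst (1 2) nn_integral_layer_cake_le_one) (auto simp: le nn_integral_add)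
  also have "\<dots> \<le> (\<integral>\<^sup>+t. 2 * (emeasure lborel {x. ennreal t < k x} * indicator {0..<1} t) \<partial>lborel)"
    using * by (intro nn_integral_mono) (auto simp: indicator_def)
  also have "\<dots> = 2 * (\<integral>\<^sup>+x. k x \<partial>lborel)"
    by (subst nn_integral_layer_cake_le_one) (auto simp: k_def nn_integral_cmult)
  also have "\<dots> \<le> 2 * (\<integral>\<^sup>+x. h x \<partial>lborel)"
    by (intro mult_left_mono nn_integral_mono) (auto simp: k_def)
  finally show ?thesis .
qed

text \<open>Dividing \<open>f\<close> and \<open>g\<close> by their suprema \<open>a\<close> and
  \<open>b\<close>, and \<open>h\<close> by \<open>sqrt (a * b)\<close>, preserves the midpoint
  hypothesis and reaches the normalised case. There \<open>4 * p * q \<le> (p + q)\<^sup>2\<close>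
  turns the sum into a product, and the scale factors cancel.\<close>

lemma prekopa_leindler_bounded:
  fixes f g h :: "real \<Rightarrow> ennreal"
  assumes [measurable]: "f \<in> borel_measurable borel" "g \<in> borel_measurable borel" "h \<in> borel_measurable borel"
    and le: "\<And>x. f x \<le> ennreal c" "\<And>x. g x \<le> ennreal c"
    and supp: "\<And>x. x \<notin> {-r..r} \<Longrightarrow> f x = 0" "\<And>x. x \<notin> {-r..r} \<Longrightarrow> g x = 0"
    and mid: "\<And>x y. f x * g y \<le> (h ((x + y) / 2))\<^sup>2"
  shows "(\<integral>\<^sup>+x. f x \<partial>lborel) * (\<integral>\<^sup>+x. g x \<partial>lborel) \<le> (\<integral>\<^sup>+x. h x \<partial>lborel)\<^sup>2"
proof -
  have fin: "\<exists>I\<ge>0. (\<integral>\<^sup>+x. u x \<partial>lborel) = ennreal I"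
    if "\<And>x. u x \<le> ennreal c" "\<And>x. x \<notin> {-r..r} \<Longrightarrow> u x = 0" for u :: "real \<Rightarrow> ennreal"
  proof -
    have "(\<integral>\<^sup>+x. u x \<partial>lborel) \<le> (\<integral>\<^sup>+x. ennreal c * indicator {-r..r} x \<partial>lborel)"
      using that by (intro nn_integral_mono) (auto simp: indicator_def)
    also have "\<dots> < \<infinity>" by (auto simp: nn_integral_cmult_indicator ennreal_mult_less_top emeasure_lborel_Icc_eq)
    finally show ?thesis by (cases "\<integral>\<^sup>+x. u x \<partial>lborel") auto
  qed
  obtain F where F: "(\<integral>\<^sup>+x. f x \<partial>lborel) = ennreal F" "F \<ge> 0" using fin[of f] le supp by auto
  obtain G where G: "(\<integral>\<^sup>+x. g x \<partial>lborel) = ennreal G" "G \<ge> 0" using fin[of g] le supp by auto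
  have scale: "\<exists>a. 0 < a \<and> (\<forall>x. u x / ennreal a \<le> 1) \<and> (\<forall>t<1. \<exists>x. t < u x / ennreal a)"
    if u: "\<And>x. u x \<le> ennreal c" "u x0 \<noteq> 0" for u :: "real \<Rightarrow> ennreal" and x0
  proof -
    have "(SUP x. u x) \<le> ennreal c" using u by (simp add: SUP_least)
    then obtain a where a: "(SUP x. u x) = ennreal a" "0 \<le> a"
      by (cases "SUP x. u x") (auto simp: top_unique)
    have "0 < u x0" using u by (simp add: zero_less_iff_neq_zero)
    also have "u x0 \<le> ennreal a" unfolding a(1)[symmetric] by (simp add: SUP_upper)
    finally have "a > 0" by (metis ennreal_less_zero_iff)
    have "u x / ennreal a \<le> 1" for x
    proof -
      have "u x \<le> ennreal a" unfolding a(1)[symmetric] by (simp add: SUP_upper)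
      then have "u x / ennreal a \<le> ennreal a / ennreal a" by (rule divide_right_mono_ennreal)
      then show ?thesis using \<open>a > 0\<close> by (simp add: ennreal_divide_self)
    qed
    moreover have "\<exists>x. t < u x / ennreal a" if "t < 1" for t
    proof -
      have "t * ennreal a < 1 * ennreal a"
        using \<open>a > 0\<close> that by (intro ennreal_mult_strict_right_mono) auto
      then have "t * ennreal a < (SUP x. u x)" by (simp add: a)
      then obtain x where "t * ennreal a < u x" by (auto simp: less_SUP_iff)
      moreover have "u x / ennreal a * ennreal a = u x"
        using \<open>a > 0\<close> by (simp add: ennreal_divide_times ennreal_divide_self)
      ultimately have "t < u x / ennreal a"
        by (metis mult_right_mono not_le zero_le)
      then show ?thesis by blast
    qed
    ultimately show ?thesis using \<open>a > 0\<close> by blast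
  qed
  show ?thesis
  proof (cases "(\<forall>x. f x = 0) \<or> (\<forall>x. g x = 0) \<or> (\<integral>\<^sup>+x. h x \<partial>lborel) = \<infinity>")
    case True then show ?thesis by (auto simp: power2_eq_square ennreal_top_mult)
  next
    case False
    then obtain H where H: "(\<integral>\<^sup>+x. h x \<partial>lborel) = ennreal H" "H \<ge> 0"
      by (cases "\<integral>\<^sup>+x. h x \<partial>lborel") auto
    obtain a where a: "0 < a" "\<And>x. f x / ennreal a \<le> 1" "\<And>t. t < 1 \<Longrightarrow> \<exists>x. t < f x / ennreal a"
      using False le scale[of f] by blast
    obtain b where b: "0 < b" "\<And>x. g x / ennreal b \<le> 1" "\<And>t. t < 1 \<Longrightarrow> \<exists>x. t < g x / ennreal b"
      using False le scale[of g] by blast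
    define d where "d = sqrt (a * b)"
    have d: "d > 0" "d * d = a * b" using a b by (auto simp: d_def)
    have "(\<integral>\<^sup>+x. f x / ennreal a \<partial>lborel) + (\<integral>\<^sup>+x. g x / ennreal b \<partial>lborel) \<le> 2 * (\<integral>\<^sup>+x. h x / ennreal d \<partial>lborel)"
    proof (rule prekopa_leindler_normalized)
      have "{x. f x / ennreal a \<noteq> 0} \<subseteq> {-r..r}" "{x. g x / ennreal b \<noteq> 0} \<subseteq> {-r..r}"
        using supp by (auto simp: ennreal_zero_divide) (metis ennreal_zero_divide)+
      then show "bounded {x. f x / ennreal a \<noteq> 0}" "bounded {x. g x / ennreal b \<noteq> 0}"
        using bounded_closed_interval bounded_subset by blast+
      fix x y
      have "f x / ennreal a * (g y / ennreal b) = (f x * g y) * (inverse (ennreal a) * inverse (ennreal b))"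
        by (simp add: divide_ennreal_def ac_simps)
      also have "inverse (ennreal a) * inverse (ennreal b) = inverse (ennreal d) * inverse (ennreal d)"
        using a b d by (simp add: inverse_ennreal ennreal_mult[symmetric] inverse_mult_distrib[symmetric] del: inverse_mult_distrib)
      also have "(f x * g y) * \<dots> \<le> (h ((x + y) / 2))\<^sup>2 * (inverse (ennreal d) * inverse (ennreal d))"
        by (intro mult_right_mono mid) auto
      also have "\<dots> = (h ((x + y) / 2) / ennreal d)\<^sup>2"
        by (simp add: divide_ennreal_def power2_eq_square ac_simps)
      finally show "f x / ennreal a * (g y / ennreal b) \<le> (h ((x + y) / 2) / ennreal d)\<^sup>2" .
    qed (use a b in auto)
    then have "ennreal F / ennreal a + ennreal G / ennreal b \<le> 2 * (ennreal H / ennreal d)"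
      by (simp add: nn_integral_divide F G H)
    then have "ennreal (F / a + G / b) \<le> ennreal (2 * (H / d))"
      using a b d F G H by (simp add: divide_ennreal ennreal_plus ennreal_mult flip: times_divide_eq_right)
    then have "F / a + G / b \<le> 2 * (H / d)"
      using H d by (subst (asm) ennreal_le_iff) auto
    moreover have "0 \<le> F / a + G / b" using F G a b by simp
    ultimately have "(F / a + G / b)\<^sup>2 \<le> (2 * (H / d))\<^sup>2" by (intro power_mono)
    moreover have "4 * p * q \<le> (p + q)\<^sup>2" for p q :: real
      using sum_squares_bound[of p q] by (simp add: power2_sum)
    from this[of "F / a" "G / b"] have "4 * (F / a) * (G / b) \<le> (F / a + G / b)\<^sup>2" .
    ultimately have "(F / a) * (G / b) \<le> (H / d)\<^sup>2" by (simp add: power_mult_distrib power_divide)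
    then have "F * G / (a * b) \<le> H\<^sup>2 / (a * b)"
      by (simp add: power2_eq_square d(2))
    then have "F * G \<le> H\<^sup>2" using a b by (simp add: divide_le_cancel)
    then show ?thesis using F G H by (simp add: ennreal_mult[symmetric] ennreal_power)
  qed
qed

section \<open>Stability of the Prekopa--Leindler inequality under limits, products, images and
  densities\<close>

text \<open>The squared form with weights 1/2 avoids square roots in \<open>ennreal\<close>. Measure
  and midpoint operation are parameters: the property then passes to products, to images under
  midpoint-preserving maps and to log-concave densities, which together reach Gaussian
  walks.\<close>

definition prekopa_leindler :: "('a \<Rightarrow> 'a \<Rightarrow> 'a) \<Rightarrow> 'a measure \<Rightarrow> bool" where
  "prekopa_leindler mid M \<longleftrightarrow> (\<forall>f g h. f \<in> borel_measurable M \<longrightarrow> g \<in> borel_measurable M \<longrightarrow>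
     h \<in> borel_measurable M \<longrightarrow>
     (\<forall>x\<in>space M. \<forall>y\<in>space M. f x * g y \<le> (h (mid x y) :: ennreal)\<^sup>2) \<longrightarrow>
     (\<integral>\<^sup>+x. f x \<partial>M) * (\<integral>\<^sup>+x. g x \<partial>M) \<le> (\<integral>\<^sup>+x. h x \<partial>M)\<^sup>2)"

lemma prekopa_leindlerD:
  assumes "prekopa_leindler mid M" "f \<in> borel_measurable M" "g \<in> borel_measurable M" "h \<in> borel_measurable M"
    "\<And>x y. x \<in> space M \<Longrightarrow> y \<in> space M \<Longrightarrow> f x * g y \<le> (h (mid x y) :: ennreal)\<^sup>2"
  shows "(\<integral>\<^sup>+x. f x \<partial>M) * (\<integral>\<^sup>+x. g x \<partial>M) \<le> (\<integral>\<^sup>+x. h x \<partial>M)\<^sup>2"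
  using assms unfolding prekopa_leindler_def by blast

lemma prekopa_leindler_lborel_real: "prekopa_leindler (\<lambda>x y. (x + y) / 2) (lborel :: real measure)"
  unfolding prekopa_leindler_def
proof (intro allI impI)
  fix f g h :: "real \<Rightarrow> ennreal"
  assume "f \<in> borel_measurable lborel" "g \<in> borel_measurable lborel" "h \<in> borel_measurable lborel"
  then have [measurable]: "f \<in> borel_measurable borel" "g \<in> borel_measurable borel" "h \<in> borel_measurable borel"
    by simp_all
  assume mid: "\<forall>x\<in>space lborel. \<forall>y\<in>space lborel. f x * g y \<le> (h ((x + y) / 2))\<^sup>2"
  define tr where "tr u n x = min (u x) (ennreal (real n)) * indicator {- real n..real n} x"
    for u :: "real \<Rightarrow> ennreal" and n x
  have mono: "tr u n x \<le> tr u m x" if "n \<le> m" for u n m x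
    using that by (auto simp: tr_def indicator_def intro: min.coboundedI2 ennreal_leI)
  have sup: "(\<integral>\<^sup>+x. u x \<partial>lborel) = (SUP n. \<integral>\<^sup>+x. tr u n x \<partial>lborel)"
    if [measurable]: "u \<in> borel_measurable borel" for u
  proof -
    have "u x = (SUP n. tr u n x)" for x
    proof (rule antisym)
      show "(SUP n. tr u n x) \<le> u x" by (intro SUP_least) (auto simp: tr_def indicator_def)
      show "u x \<le> (SUP n. tr u n x)"
      proof (cases "u x")
        case (real r)
        obtain n where n: "\<bar>x\<bar> \<le> real n" "r \<le> real n"
          using real_arch_simple[of "max \<bar>x\<bar> r"] by auto
        then have "u x \<le> tr u n x" using real by (auto simp: tr_def indicator_def)
        then show ?thesis by (meson SUP_upper2 UNIV_I)
      next
        case top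
        obtain n0 where n0: "\<bar>x\<bar> \<le> real n0" using real_arch_simple by blast
        have "ennreal (real n) \<le> (SUP n. tr u n x)" for n
        proof -
          have "ennreal (real n) \<le> tr u (max n n0) x" using n0 top by (auto simp: tr_def indicator_def)
          then show ?thesis by (meson SUP_upper2 UNIV_I)
        qed
        then have "(SUP n. of_nat n :: ennreal) \<le> (SUP n. tr u n x)"
          by (intro SUP_least) (simp add: ennreal_of_nat_eq_real_of_nat)
        then have "(SUP n. tr u n x) = top" by (simp add: ennreal_SUP_of_nat_eq_top top_unique)
        then show ?thesis by (rule ssubst) simp
      qed
    qed
    then have "(\<integral>\<^sup>+x. u x \<partial>lborel) = (\<integral>\<^sup>+x. (SUP n. tr u n x) \<partial>lborel)" by simp
    also have "\<dots> = (SUP n. \<integral>\<^sup>+x. tr u n x \<partial>lborel)"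
      by (intro nn_integral_monotone_convergence_SUP)
         (auto simp: incseq_def le_fun_def tr_def intro!: mono[unfolded tr_def])
    finally show ?thesis .
  qed
  let ?H = "(\<integral>\<^sup>+x. h x \<partial>lborel)\<^sup>2"
  have diag: "(\<integral>\<^sup>+x. tr f n x \<partial>lborel) * (\<integral>\<^sup>+x. tr g n x \<partial>lborel) \<le> ?H" for n
  proof (rule prekopa_leindler_bounded[where c = n and r = n])
    fix x y :: real
    have "tr f n x * tr g n y \<le> f x * g y"
      by (intro mult_mono) (auto simp: tr_def indicator_def)
    then show "tr f n x * tr g n y \<le> (h ((x + y) / 2))\<^sup>2" using mid by (auto intro: order_trans)
  qed (auto simp: tr_def indicator_def)
  \<comment> \<open>The product of two suprema over truncations carries two indices; monotonicity
    bounds it by the diagonal case at \<open>max n m\<close>.\<close>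
  have "(\<integral>\<^sup>+x. tr f n x \<partial>lborel) * (\<integral>\<^sup>+x. tr g m x \<partial>lborel) \<le> ?H" for n m
  proof -
    have "(\<integral>\<^sup>+x. tr f n x \<partial>lborel) * (\<integral>\<^sup>+x. tr g m x \<partial>lborel) \<le>
      (\<integral>\<^sup>+x. tr f (max n m) x \<partial>lborel) * (\<integral>\<^sup>+x. tr g (max n m) x \<partial>lborel)"
      by (intro mult_mono nn_integral_mono mono) auto
    then show ?thesis using diag order_trans by blast
  qed
  then show "(\<integral>\<^sup>+x. f x \<partial>lborel) * (\<integral>\<^sup>+x. g x \<partial>lborel) \<le> ?H"
    by (subst (1 2) sup) (auto simp: SUP_mult_left_ennreal SUP_mult_right_ennreal intro!: SUP_least)
qed

text \<open>Induction on the number of factors: the inequality for \<open>M i\<close> in the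
  coordinate that is integrated out is exactly the midpoint hypothesis needed for the marginals in
  the remaining coordinates.\<close>

lemma prekopa_leindler_PiM:
  assumes sf: "\<And>i. sigma_finite_measure (M i)" and "finite I"
    and pl: "\<And>i. i \<in> I \<Longrightarrow> prekopa_leindler mid (M i)"
    and mid[measurable]: "\<And>i. i \<in> I \<Longrightarrow> (\<lambda>(x, y). mid x y) \<in> measurable (M i \<Otimes>\<^sub>M M i) (M i)"
  shows "prekopa_leindler (\<lambda>x y. \<lambda>i\<in>I. mid (x i) (y i)) (PiM I M)"
  using \<open>finite I\<close> pl mid
proof (induction I)
  case empty
  interpret product_sigma_finite M by (rule product_sigma_finite.intro) (rule sf)
  show ?case
    unfolding prekopa_leindler_def by (auto simp: nn_integral_empty space_PiM)
next
  case (insert i I)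
  interpret product_sigma_finite M by (rule product_sigma_finite.intro) (rule sf)
  let ?m = "\<lambda>I x y. \<lambda>i\<in>I. mid (x i) (y i)"
  have IH: "prekopa_leindler (?m I) (PiM I M)" by (intro insert.IH insert.prems insertI2)
  have pli: "prekopa_leindler mid (M i)" using insert by auto
  show ?case unfolding prekopa_leindler_def
  proof (intro allI impI)
    fix f g h :: "('a \<Rightarrow> 'b) \<Rightarrow> ennreal"
    assume fm: "f \<in> borel_measurable (PiM (insert i I) M)" and gm: "g \<in> borel_measurable (PiM (insert i I) M)"
      and hm: "h \<in> borel_measurable (PiM (insert i I) M)"
    assume fgh: "\<forall>x\<in>space (PiM (insert i I) M). \<forall>y\<in>space (PiM (insert i I) M).
      f x * g y \<le> (h (?m (insert i I) x y))\<^sup>2"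
    have meas2: "(\<lambda>(x, y). u (x(i := y))) \<in> borel_measurable (PiM I M \<Otimes>\<^sub>M M i)"
      if "u \<in> borel_measurable (PiM (insert i I) M)" for u :: "('a \<Rightarrow> 'b) \<Rightarrow> ennreal"
      using measurable_compose[OF measurable_add_dim that] by (simp add: case_prod_beta)
    have meas: "(\<lambda>x. \<integral>\<^sup>+y. u (x(i := y)) \<partial>M i) \<in> borel_measurable (PiM I M)"
      if "u \<in> borel_measurable (PiM (insert i I) M)" for u :: "('a \<Rightarrow> 'b) \<Rightarrow> ennreal"
      using sigma_finite_measure.borel_measurable_nn_integral_fst[OF sf meas2[OF that]] by simp
    have meas1: "(\<lambda>y. u (x(i := y))) \<in> borel_measurable (M i)"
      if "u \<in> borel_measurable (PiM (insert i I) M)" "x \<in> space (PiM I M)"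
      for u :: "('a \<Rightarrow> 'b) \<Rightarrow> ennreal" and x
      using measurable_Pair2[OF meas2[OF that(1)] that(2)] by simp
    have "(\<integral>\<^sup>+x. (\<integral>\<^sup>+y. f (x(i := y)) \<partial>M i) \<partial>PiM I M) * (\<integral>\<^sup>+x. (\<integral>\<^sup>+y. g (x(i := y)) \<partial>M i) \<partial>PiM I M)
       \<le> (\<integral>\<^sup>+x. (\<integral>\<^sup>+y. h (x(i := y)) \<partial>M i) \<partial>PiM I M)\<^sup>2"
    proof (rule prekopa_leindlerD[OF IH])
      fix x y assume x: "x \<in> space (PiM I M)" and y: "y \<in> space (PiM I M)"
      have mm: "?m I x y \<in> space (PiM I M)"
        using x y measurable_space[OF insert.prems(2)]
        by (auto simp: space_PiM PiE_iff space_pair_measure)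
      show "(\<integral>\<^sup>+a. f (x(i := a)) \<partial>M i) * (\<integral>\<^sup>+b. g (y(i := b)) \<partial>M i)
        \<le> (\<integral>\<^sup>+c. h ((?m I x y)(i := c)) \<partial>M i)\<^sup>2"
      proof (rule prekopa_leindlerD[OF pli])
        fix a b assume ab: "a \<in> space (M i)" "b \<in> space (M i)"
        have "?m (insert i I) (x(i := a)) (y(i := b)) = (?m I x y)(i := mid a b)"
          using \<open>i \<notin> I\<close> by (auto simp: fun_eq_iff)
        moreover have "x(i := a) \<in> space (PiM (insert i I) M)" "y(i := b) \<in> space (PiM (insert i I) M)"
          using x y ab by (auto simp: space_PiM PiE_iff extensional_def)
        ultimately show "f (x(i := a)) * g (y(i := b)) \<le> (h ((?m I x y)(i := mid a b)))\<^sup>2"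
          using fgh by metis
      qed (fact meas1[OF fm x] meas1[OF gm y] meas1[OF hm mm])+
    qed (fact meas[OF fm] meas[OF gm] meas[OF hm])+
    then show "(\<integral>\<^sup>+x. f x \<partial>PiM (insert i I) M) * (\<integral>\<^sup>+x. g x \<partial>PiM (insert i I) M) \<le>
       (\<integral>\<^sup>+x. h x \<partial>PiM (insert i I) M)\<^sup>2"
      unfolding product_nn_integral_insert[OF insert.hyps fm] product_nn_integral_insert[OF insert.hyps gm]
        product_nn_integral_insert[OF insert.hyps hm] .
  qed
qed

lemma prekopa_leindler_distr:
  assumes pl: "prekopa_leindler mid M" and [measurable]: "T \<in> measurable M N"
    and hom: "\<And>x y. x \<in> space M \<Longrightarrow> y \<in> space M \<Longrightarrow> T (mid x y) = mid' (T x) (T y)"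
  shows "prekopa_leindler mid' (distr M N T)"
  unfolding prekopa_leindler_def
proof (intro allI impI)
  fix f g h :: "'b \<Rightarrow> ennreal"
  assume "f \<in> borel_measurable (distr M N T)" "g \<in> borel_measurable (distr M N T)" "h \<in> borel_measurable (distr M N T)"
  then have [measurable]: "f \<in> borel_measurable N" "g \<in> borel_measurable N" "h \<in> borel_measurable N"
    by simp_all
  assume *: "\<forall>x\<in>space (distr M N T). \<forall>y\<in>space (distr M N T). f x * g y \<le> (h (mid' x y))\<^sup>2"
  have sp: "T x \<in> space N" if "x \<in> space M" for x using that assms(2) by (rule measurable_space[rotated])
  have "(\<integral>\<^sup>+x. f (T x) \<partial>M) * (\<integral>\<^sup>+x. g (T x) \<partial>M) \<le> (\<integral>\<^sup>+x. h (T x) \<partial>M)\<^sup>2"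
    using * sp by (intro prekopa_leindlerD[OF pl]) (auto simp: hom)
  then show "(\<integral>\<^sup>+x. f x \<partial>distr M N T) * (\<integral>\<^sup>+x. g x \<partial>distr M N T) \<le> (\<integral>\<^sup>+x. h x \<partial>distr M N T)\<^sup>2"
    by (simp add: nn_integral_distr)
qed

text \<open>Multiplying each function by \<open>p\<close> keeps the midpoint hypothesis because
  \<open>p\<close> is log-concave along midpoints.\<close>

lemma prekopa_leindler_density:
  assumes pl: "prekopa_leindler mid M" and [measurable]: "p \<in> borel_measurable M"
    and lc: "\<And>x y. x \<in> space M \<Longrightarrow> y \<in> space M \<Longrightarrow> p x * p y \<le> (p (mid x y))\<^sup>2"
  shows "prekopa_leindler mid (density M p)"
  unfolding prekopa_leindler_def
proof (intro allI impI)
  fix f g h :: "'a \<Rightarrow> ennreal"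
  assume "f \<in> borel_measurable (density M p)" "g \<in> borel_measurable (density M p)" "h \<in> borel_measurable (density M p)"
  then have [measurable]: "f \<in> borel_measurable M" "g \<in> borel_measurable M" "h \<in> borel_measurable M"
    by simp_all
  assume *: "\<forall>x\<in>space (density M p). \<forall>y\<in>space (density M p). f x * g y \<le> (h (mid x y))\<^sup>2"
  have "(\<integral>\<^sup>+x. p x * f x \<partial>M) * (\<integral>\<^sup>+x. p x * g x \<partial>M) \<le> (\<integral>\<^sup>+x. p x * h x \<partial>M)\<^sup>2"
  proof (rule prekopa_leindlerD[OF pl])
    fix x y assume xy: "x \<in> space M" "y \<in> space M"
    have "p x * f x * (p y * g y) = (p x * p y) * (f x * g y)" by (simp add: ac_simps)
    also have "\<dots> \<le> (p (mid x y))\<^sup>2 * (h (mid x y))\<^sup>2"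
      using xy lc * by (intro mult_mono) auto
    finally show "p x * f x * (p y * g y) \<le> (p (mid x y) * h (mid x y))\<^sup>2"
      by (simp add: power_mult_distrib)
  qed measurable
  then show "(\<integral>\<^sup>+x. f x \<partial>density M p) * (\<integral>\<^sup>+x. g x \<partial>density M p) \<le> (\<integral>\<^sup>+x. h x \<partial>density M p)\<^sup>2"
    by (simp add: nn_integral_density)
qed

lemma prekopa_leindler_lborel:
  "prekopa_leindler (\<lambda>x y. (1 / 2) *\<^sub>R (x + y)) (lborel :: 'a::euclidean_space measure)"
proof -
  have "(\<lambda>(x, y). (x + y) / 2 :: real) \<in> borel \<Otimes>\<^sub>M borel \<rightarrow>\<^sub>M borel" by measurable
  then have "(\<lambda>(x, y). (x + y) / 2 :: real) \<in> lborel \<Otimes>\<^sub>M lborel \<rightarrow>\<^sub>M lborel"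
    by (simp add: measurable_cong_sets[OF sets_pair_measure_cong[OF sets_lborel sets_lborel] sets_lborel])
  then have "prekopa_leindler (\<lambda>x y. \<lambda>b\<in>Basis. (x b + y b) / 2) (\<Pi>\<^sub>M b\<in>(Basis :: 'a set). (lborel :: real measure))"
    by (intro prekopa_leindler_PiM prekopa_leindler_lborel_real lborel.sigma_finite_measure_axioms) auto
  then have "prekopa_leindler (\<lambda>x y. (1 / 2) *\<^sub>R (x + y))
      (distr (\<Pi>\<^sub>M b\<in>(Basis :: 'a set). lborel) borel (\<lambda>x. \<Sum>b\<in>Basis. x b *\<^sub>R b))"
  proof (rule prekopa_leindler_distr)
    fix x y :: "'a \<Rightarrow> real"
    show "(\<Sum>b\<in>Basis. (\<lambda>b\<in>Basis. (x b + y b) / 2) b *\<^sub>R b) =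
        (1 / 2) *\<^sub>R ((\<Sum>b\<in>Basis. x b *\<^sub>R b) + (\<Sum>b\<in>Basis. y b *\<^sub>R (b :: 'a)))"
      unfolding scaleR_sum_right sum.distrib[symmetric]
      by (intro sum.cong) (auto simp: algebra_simps add_divide_distrib)
  qed measurable
  then show ?thesis unfolding lborel_eq[symmetric] .
qed

section \<open>Gaussian random walks\<close>

text \<open>Coordinatewise substitutions multiply their densities. Stated for general maps so that
  one induction covers both the shift of a walk (exponential density) and its reflection (density
  \<open>1\<close>).\<close>

lemma nn_integral_PiM_transform:
  assumes sf: "\<And>i. sigma_finite_measure (M i)" and "finite I"
    and T: "\<And>i. i \<in> I \<Longrightarrow> T i \<in> measurable (M i) (M i)"
    and \<rho>: "\<And>i. i \<in> I \<Longrightarrow> \<rho> i \<in> borel_measurable (M i)"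
    and eq: "\<And>i v. i \<in> I \<Longrightarrow> v \<in> borel_measurable (M i) \<Longrightarrow>
      (\<integral>\<^sup>+x. v x \<partial>M i) = (\<integral>\<^sup>+x. v (T i x) * \<rho> i x \<partial>M i)"
    and u: "u \<in> borel_measurable (PiM I M)"
  shows "(\<integral>\<^sup>+x. u x \<partial>PiM I M) = (\<integral>\<^sup>+x. u (\<lambda>i\<in>I. T i (x i)) * (\<Prod>i\<in>I. \<rho> i (x i)) \<partial>PiM I M)"
  using \<open>finite I\<close> T \<rho> eq u
proof (induction I arbitrary: u)
  case empty
  interpret product_sigma_finite M by (rule product_sigma_finite.intro) (rule sf)
  show ?case by (subst (1 2) nn_integral_empty) (auto simp: restrict_def)
next
  case (insert i I)
  interpret product_sigma_finite M by (rule product_sigma_finite.intro) (rule sf)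
  note um[measurable] = insert.prems(4)
  have Ti[measurable]: "T i \<in> measurable (M i) (M i)" and ri[measurable]: "\<rho> i \<in> borel_measurable (M i)"
    using insert.prems by auto
  have Tj[measurable]: "T j \<in> measurable (M j) (M j)" and rj[measurable]: "\<rho> j \<in> borel_measurable (M j)" if "j \<in> I" for j
    using insert.prems that by auto
  let ?TI = "\<lambda>x. \<lambda>j\<in>I. T j (x j)"
  have TI[measurable]: "?TI \<in> measurable (PiM I M) (PiM I M)"
    using Tj by (intro measurable_restrict) (auto intro: measurable_compose[OF measurable_component_singleton])
  have meas2: "(\<lambda>(x, y). u (x(i := y))) \<in> borel_measurable (PiM I M \<Otimes>\<^sub>M M i)"
    using measurable_compose[OF measurable_add_dim um] by (simp add: case_prod_beta)
  have meas2T: "(\<lambda>(x, y). u (x(i := T i y)) * \<rho> i y) \<in> borel_measurable (PiM I M \<Otimes>\<^sub>M M i)"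
  proof -
    have "(\<lambda>(x, y). (x, T i y)) \<in> PiM I M \<Otimes>\<^sub>M M i \<rightarrow>\<^sub>M PiM I M \<Otimes>\<^sub>M M i" by measurable
    from measurable_compose[OF this meas2]
    have "(\<lambda>z. u ((fst z)(i := T i (snd z)))) \<in> borel_measurable (PiM I M \<Otimes>\<^sub>M M i)"
      by (simp add: case_prod_beta)
    then show ?thesis by (simp add: case_prod_beta)
  qed
  define U where "U x = (\<integral>\<^sup>+y. u (x(i := T i y)) * \<rho> i y \<partial>M i)" for x
  have Um[measurable]: "U \<in> borel_measurable (PiM I M)"
    unfolding U_def using sigma_finite_measure.borel_measurable_nn_integral_fst[OF sf meas2T] by simp
  have prod_m: "(\<lambda>x. \<Prod>j\<in>I. \<rho> j (x j)) \<in> borel_measurable (PiM I M)"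
    using rj by (intro borel_measurable_prod_ennreal) (auto intro: measurable_compose[OF measurable_component_singleton])
  have "(\<integral>\<^sup>+x. u x \<partial>PiM (insert i I) M) = (\<integral>\<^sup>+x. (\<integral>\<^sup>+y. u (x(i := y)) \<partial>M i) \<partial>PiM I M)"
    by (rule product_nn_integral_insert[OF insert.hyps um])
  also have "\<dots> = (\<integral>\<^sup>+x. U x \<partial>PiM I M)"
  proof (rule nn_integral_cong)
    fix x assume "x \<in> space (PiM I M)"
    then have "(\<lambda>y. u (x(i := y))) \<in> borel_measurable (M i)" using measurable_Pair2[OF meas2] by simp
    then show "(\<integral>\<^sup>+y. u (x(i := y)) \<partial>M i) = U x" unfolding U_def by (rule insert.prems(3)[OF insertI1])
  qed
  also have "\<dots> = (\<integral>\<^sup>+x. U (?TI x) * (\<Prod>j\<in>I. \<rho> j (x j)) \<partial>PiM I M)"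
    by (rule insert.IH[OF insert.prems(1) insert.prems(2) insert.prems(3) Um]) simp_all
  also have "\<dots> = (\<integral>\<^sup>+x. (\<integral>\<^sup>+y. u (\<lambda>j\<in>insert i I. T j ((x(i := y)) j)) * (\<Prod>j\<in>insert i I. \<rho> j ((x(i := y)) j)) \<partial>M i) \<partial>PiM I M)"
  proof (rule nn_integral_cong)
    fix x assume x: "x \<in> space (PiM I M)"
    have 1: "(\<lambda>j\<in>insert i I. T j ((x(i := y)) j)) = (?TI x)(i := T i y)" for y
      using insert.hyps by (auto simp: fun_eq_iff)
    have 2: "(\<Prod>j\<in>insert i I. \<rho> j ((x(i := y)) j)) = \<rho> i y * (\<Prod>j\<in>I. \<rho> j (x j))" for y
    proof -
      have "(\<Prod>j\<in>I. \<rho> j ((x(i := y)) j)) = (\<Prod>j\<in>I. \<rho> j (x j))"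
        using insert.hyps by (intro prod.cong) auto
      then show ?thesis using insert.hyps by simp
    qed
    have "?TI x \<in> space (PiM I M)" using x TI by (rule measurable_space[rotated])
    then have "(\<lambda>y. u ((?TI x)(i := T i y)) * \<rho> i y) \<in> borel_measurable (M i)"
      using measurable_Pair2[OF meas2T] by auto
    then show "U (?TI x) * (\<Prod>j\<in>I. \<rho> j (x j)) =
       (\<integral>\<^sup>+y. u (\<lambda>j\<in>insert i I. T j ((x(i := y)) j)) * (\<Prod>j\<in>insert i I. \<rho> j ((x(i := y)) j)) \<partial>M i)"
      unfolding U_def 1 2 by (subst nn_integral_multc[symmetric]) (simp_all add: mult.assoc)
  qed
  also have "\<dots> = (\<integral>\<^sup>+x. u (\<lambda>j\<in>insert i I. T j (x j)) * (\<Prod>j\<in>insert i I. \<rho> j (x j)) \<partial>PiM (insert i I) M)"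
  proof (rule product_nn_integral_insert[OF insert.hyps, symmetric])
    have "(\<lambda>x. \<lambda>j\<in>insert i I. T j (x j)) \<in> measurable (PiM (insert i I) M) (PiM (insert i I) M)"
      using insert.prems(1) by (intro measurable_restrict) (auto intro: measurable_compose[OF measurable_component_singleton])
    then have "(\<lambda>x. u (\<lambda>j\<in>insert i I. T j (x j))) \<in> borel_measurable (PiM (insert i I) M)"
      using um by (rule measurable_compose)
    moreover have "(\<lambda>x. \<Prod>j\<in>insert i I. \<rho> j (x j)) \<in> borel_measurable (PiM (insert i I) M)"
      using insert.prems(2)
      by (intro borel_measurable_prod_ennreal) (auto intro: measurable_compose[OF measurable_component_singleton])
    ultimately show "(\<lambda>x. u (\<lambda>j\<in>insert i I. T j (x j)) * (\<Prod>j\<in>insert i I. \<rho> j (x j)))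
        \<in> borel_measurable (PiM (insert i I) M)" by (rule borel_measurable_times_ennreal)
  qed
  finally show ?case .
qed

text \<open>\<open>d\<close> is the variance of each coordinate. The product form is the one in
  \<open>wiener_process\<close>, so the law of an increment is recognised by unfolding.\<close>

definition gaussian_density :: "real \<Rightarrow> real ^ 'n \<Rightarrow> real" where
  "gaussian_density d x = (\<Prod>i\<in>UNIV. normal_density 0 (sqrt d) (x $ i))"

definition gaussian :: "real \<Rightarrow> (real ^ 'n) measure" where
  "gaussian d = density lborel (\<lambda>x. ennreal (gaussian_density d x))"

lemma gaussian_density_nonneg: "0 \<le> gaussian_density d x"
  unfolding gaussian_density_def by (intro prod_nonneg) (simp add: normal_density_nonneg)

lemma borel_measurable_gaussian_density[measurable]:
  "gaussian_density d \<in> borel_measurable borel"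
  unfolding gaussian_density_def by measurable

lemma sets_gaussian[simp, measurable_cong]: "sets (gaussian d) = sets borel"
  by (simp add: gaussian_def)

lemma space_gaussian[simp]: "space (gaussian d) = UNIV"
  by (simp add: gaussian_def)

lemma gaussian_density_eq:
  fixes x :: "real ^ 'n"
  assumes "d > 0"
  shows "gaussian_density d x = (1 / sqrt (2 * pi * d)) ^ CARD('n) * exp (- (norm x)\<^sup>2 / (2 * d))"
proof -
  have "(norm x)\<^sup>2 = (\<Sum>i\<in>UNIV. (x $ i)\<^sup>2)"
    unfolding norm_eq_sqrt_inner inner_vec_def by (simp add: sum_nonneg power2_eq_square)
  then show ?thesis
    using assms
    by (simp add: gaussian_density_def normal_density_def prod_dividef exp_sum power_divide
        sum_divide_distrib flip: sum_negf)
qed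

lemma gaussian_density_shift:
  fixes x c :: "real ^ 'n"
  assumes "d > 0"
  shows "gaussian_density d (x + c) = gaussian_density d x * exp (- (c \<bullet> x) / d - (norm c)\<^sup>2 / (2 * d))"
proof -
  have "(norm (x + c))\<^sup>2 = (norm x)\<^sup>2 + 2 * (c \<bullet> x) + (norm c)\<^sup>2"
    by (simp add: power2_norm_eq_inner inner_add inner_commute algebra_simps)
  then show ?thesis
    using assms by (simp add: gaussian_density_eq mult_exp_exp diff_divide_distrib add_divide_distrib)
qed

lemma gaussian_density_uminus: "gaussian_density d (- x) = gaussian_density d x"
  by (simp add: gaussian_density_def normal_density_def)

text \<open>Parallelogram law for the half sum and the half difference: the squared norm is midpoint
  convex, hence the density is midpoint log-concave.\<close>

lemma gaussian_density_midpoint: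
  assumes "d > 0"
  shows "gaussian_density d x * gaussian_density d y \<le> (gaussian_density d ((1 / 2) *\<^sub>R (x + y)))\<^sup>2"
proof -
  have scale: "- p / (2 * d) + - q / (2 * d) \<le> 2 * (- r / (2 * d))" if "2 * r \<le> p + q" for p q r :: real
    using mult_left_mono[OF that, of d] assms by (simp add: field_simps)
  have mid: "a + b = c / 2 \<Longrightarrow> 0 \<le> b \<Longrightarrow> 2 * a \<le> c" for a b c :: real by simp
  have "(norm ((1 / 2) *\<^sub>R (x + y)))\<^sup>2 + (norm ((1 / 2) *\<^sub>R (x - y)))\<^sup>2 = ((norm x)\<^sup>2 + (norm y)\<^sup>2) / 2"
    by (simp add: power2_norm_eq_inner inner_add inner_diff inner_commute algebra_simps)
  then have "2 * (norm ((1 / 2) *\<^sub>R (x + y)))\<^sup>2 \<le> (norm x)\<^sup>2 + (norm y)\<^sup>2"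
    using mid[OF _ zero_le_power2] by blast
  then have "- (norm x)\<^sup>2 / (2 * d) + - (norm y)\<^sup>2 / (2 * d) \<le> 2 * (- (norm ((1 / 2) *\<^sub>R (x + y)))\<^sup>2 / (2 * d))"
    by (rule scale)
  then have "exp (- (norm x)\<^sup>2 / (2 * d)) * exp (- (norm y)\<^sup>2 / (2 * d))
      \<le> (exp (- (norm ((1 / 2) *\<^sub>R (x + y)))\<^sup>2 / (2 * d)))\<^sup>2"
    unfolding mult_exp_exp exp_double[symmetric] by simp
  from mult_left_mono[OF this, of "((1 / sqrt (2 * pi * d)) ^ CARD('a))\<^sup>2"]
  show ?thesis using assms
    by (simp add: gaussian_density_eq power_mult_distrib power2_eq_square ac_simps)
qed

lemma prekopa_leindler_gaussian:
  assumes "d > 0"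
  shows "prekopa_leindler (\<lambda>x y. (1 / 2) *\<^sub>R (x + y)) (gaussian d)"
  unfolding gaussian_def
proof (rule prekopa_leindler_density[OF prekopa_leindler_lborel])
  fix x y :: "real ^ 'a"
  show "ennreal (gaussian_density d x) * ennreal (gaussian_density d y)
      \<le> (ennreal (gaussian_density d ((1 / 2) *\<^sub>R (x + y))))\<^sup>2"
    using gaussian_density_midpoint[OF assms, of x y]
    by (simp add: gaussian_density_nonneg ennreal_mult[symmetric] ennreal_power ennreal_leI)
qed measurable

lemma nn_integral_gaussian_shift:
  fixes v :: "real ^ 'n \<Rightarrow> ennreal"
  assumes "d > 0" and [measurable]: "v \<in> borel_measurable borel"
  shows "(\<integral>\<^sup>+x. v x \<partial>gaussian d) =
    (\<integral>\<^sup>+x. v (x + c) * ennreal (exp (- (c \<bullet> x) / d - (norm c)\<^sup>2 / (2 * d))) \<partial>gaussian d)"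
proof -
  have "(\<integral>\<^sup>+x. v x \<partial>gaussian d) = (\<integral>\<^sup>+x. ennreal (gaussian_density d x) * v x \<partial>lborel)"
    by (simp add: gaussian_def nn_integral_density)
  also have "\<dots> = (\<integral>\<^sup>+x. ennreal (gaussian_density d x) * v x \<partial>(distr lborel borel ((+) c)))"
    by (simp only: lborel_distr_plus)
  also have "\<dots> = (\<integral>\<^sup>+x. ennreal (gaussian_density d (x + c)) * v (x + c) \<partial>lborel)"
    by (subst nn_integral_distr) (auto simp: add.commute)
  also have "\<dots> = (\<integral>\<^sup>+x. ennreal (gaussian_density d x) * (v (x + c) * ennreal (exp (- (c \<bullet> x) / d - (norm c)\<^sup>2 / (2 * d)))) \<partial>lborel)"
    by (simp add: gaussian_density_shift[OF \<open>d > 0\<close>] gaussian_density_nonneg ennreal_mult ac_simps)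
  also have "\<dots> = (\<integral>\<^sup>+x. v (x + c) * ennreal (exp (- (c \<bullet> x) / d - (norm c)\<^sup>2 / (2 * d))) \<partial>gaussian d)"
    by (simp add: gaussian_def nn_integral_density)
  finally show ?thesis .
qed

lemma nn_integral_gaussian_uminus:
  fixes v :: "real ^ 'n \<Rightarrow> ennreal"
  assumes [measurable]: "v \<in> borel_measurable borel"
  shows "(\<integral>\<^sup>+x. v x \<partial>gaussian d) = (\<integral>\<^sup>+x. v (- x) \<partial>gaussian d)"
proof -
  have "(\<integral>\<^sup>+x. v x \<partial>gaussian d) = (\<integral>\<^sup>+x. ennreal (gaussian_density d x) * v x \<partial>lborel)"
    by (simp add: gaussian_def nn_integral_density)
  also have "\<dots> = (\<integral>\<^sup>+x. ennreal (gaussian_density d x) * v x \<partial>(distr lborel borel uminus))"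
    using lborel_affine[of "-1" "0 :: real ^ 'n"] by (simp add: density_1)
  also have "\<dots> = (\<integral>\<^sup>+x. ennreal (gaussian_density d x) * v (- x) \<partial>lborel)"
    by (subst nn_integral_distr) (auto simp: gaussian_density_uminus)
  also have "\<dots> = (\<integral>\<^sup>+x. v (- x) \<partial>gaussian d)"
    by (simp add: gaussian_def nn_integral_density)
  finally show ?thesis .
qed

text \<open>The measure lives on the increments; the walk itself is the sequence of their partial sums,
  which starts at \<open>0\<close>.\<close>

definition gaussian_walk :: "nat \<Rightarrow> real \<Rightarrow> (nat \<Rightarrow> real ^ 'n) measure" where
  "gaussian_walk k d = (\<Pi>\<^sub>M i\<in>{..<k}. gaussian d)"

definition walk_tube :: "nat \<Rightarrow> (nat \<Rightarrow> real ^ 'n) \<Rightarrow> real \<Rightarrow> (nat \<Rightarrow> real ^ 'n) set" where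
  "walk_tube k h \<epsilon> = {x \<in> space (\<Pi>\<^sub>M i\<in>{..<k}. borel). \<forall>j\<le>k. norm ((\<Sum>i<j. x i) - h j) \<le> \<epsilon>}"

lemma sets_gaussian_walk[measurable_cong]: "sets (gaussian_walk k d) = sets (\<Pi>\<^sub>M i\<in>{..<k}. borel)"
  unfolding gaussian_walk_def by (intro sets_PiM_cong) auto

lemma space_gaussian_walk: "space (gaussian_walk k d) = space (\<Pi>\<^sub>M i\<in>{..<k}. borel)"
  by (rule sets_eq_imp_space_eq[OF sets_gaussian_walk])

lemma walk_tube_measurable[measurable]:
  fixes h :: "nat \<Rightarrow> real ^ 'n"
  shows "walk_tube k h \<epsilon> \<in> sets (\<Pi>\<^sub>M i\<in>{..<k}. borel)"
proof -
  have [measurable]: "(\<lambda>x. \<Sum>i<j. x i :: real ^ 'n) \<in> borel_measurable (\<Pi>\<^sub>M i\<in>{..<k}. borel)" if "j \<le> k" for j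
    by measurable (use that in auto)
  show ?thesis unfolding walk_tube_def by measurable
qed

lemma sigma_finite_gaussian: "sigma_finite_measure (gaussian d :: (real ^ 'n) measure)"
  unfolding gaussian_def
  by (subst sigma_finite_measure.sigma_finite_iff_density_finite[OF lborel.sigma_finite_measure_axioms]) auto

text \<open>Discrete Cameron--Martin formula: the exponents of the one-step densities add up to a
  linear functional of the increments and the negative energy of the shift.\<close>

lemma nn_integral_gaussian_walk_shift:
  fixes u :: "(nat \<Rightarrow> real ^ 'n) \<Rightarrow> ennreal"
  assumes "d > 0" and "u \<in> borel_measurable (\<Pi>\<^sub>M i\<in>{..<k}. borel)"
  shows "(\<integral>\<^sup>+x. u x \<partial>gaussian_walk k d) = (\<integral>\<^sup>+x. u (\<lambda>i\<in>{..<k}. x i + c i) *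
     ennreal (exp (- (\<Sum>i<k. c i \<bullet> x i) / d - (\<Sum>i<k. (norm (c i))\<^sup>2) / (2 * d))) \<partial>gaussian_walk k d)"
proof -
  have "(\<integral>\<^sup>+x. u x \<partial>gaussian_walk k d) = (\<integral>\<^sup>+x. u (\<lambda>i\<in>{..<k}. x i + c i) *
     (\<Prod>i\<in>{..<k}. ennreal (exp (- (c i \<bullet> x i) / d - (norm (c i))\<^sup>2 / (2 * d)))) \<partial>gaussian_walk k d)"
    unfolding gaussian_walk_def
  proof (rule nn_integral_PiM_transform[OF sigma_finite_gaussian])
    show "u \<in> borel_measurable (\<Pi>\<^sub>M i\<in>{..<k}. gaussian d)"
      using assms sets_gaussian_walk unfolding gaussian_walk_def by (metis measurable_cong_sets)
    fix i and v :: "real ^ 'n \<Rightarrow> ennreal" assume "v \<in> borel_measurable (gaussian d)"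
    then have "v \<in> borel_measurable borel" by (simp add: measurable_cong_sets[OF sets_gaussian refl])
    then show "(\<integral>\<^sup>+x. v x \<partial>gaussian d) =
       (\<integral>\<^sup>+x. v (x + c i) * ennreal (exp (- (c i \<bullet> x) / d - (norm (c i))\<^sup>2 / (2 * d))) \<partial>gaussian d)"
      by (rule nn_integral_gaussian_shift[OF \<open>d > 0\<close>])
  qed auto
  moreover have "(\<Prod>i\<in>{..<k}. ennreal (exp (- (c i \<bullet> x i) / d - (norm (c i))\<^sup>2 / (2 * d)))) =
     ennreal (exp (- (\<Sum>i<k. c i \<bullet> x i) / d - (\<Sum>i<k. (norm (c i))\<^sup>2) / (2 * d)))" for x
    by (simp add: prod_ennreal exp_sum[symmetric] sum_subtractf sum_divide_distrib sum_negf)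
  ultimately show ?thesis by simp
qed

lemma nn_integral_gaussian_walk_uminus:
  fixes u :: "(nat \<Rightarrow> real ^ 'n) \<Rightarrow> ennreal"
  assumes "u \<in> borel_measurable (\<Pi>\<^sub>M i\<in>{..<k}. borel)"
  shows "(\<integral>\<^sup>+x. u x \<partial>gaussian_walk k d) = (\<integral>\<^sup>+x. u (\<lambda>i\<in>{..<k}. - x i) \<partial>gaussian_walk k d)"
proof -
  have "(\<integral>\<^sup>+x. u x \<partial>gaussian_walk k d) = (\<integral>\<^sup>+x. u (\<lambda>i\<in>{..<k}. - x i) * (\<Prod>i\<in>{..<k}. 1) \<partial>gaussian_walk k d)"
    unfolding gaussian_walk_def
  proof (rule nn_integral_PiM_transform[OF sigma_finite_gaussian])
    show "u \<in> borel_measurable (\<Pi>\<^sub>M i\<in>{..<k}. gaussian d)"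
      using assms sets_gaussian_walk unfolding gaussian_walk_def by (metis measurable_cong_sets)
    fix i and v :: "real ^ 'n \<Rightarrow> ennreal" assume "v \<in> borel_measurable (gaussian d)"
    then have "v \<in> borel_measurable borel" by (simp add: measurable_cong_sets[OF sets_gaussian refl])
    then show "(\<integral>\<^sup>+x. v x \<partial>gaussian d) = (\<integral>\<^sup>+x. v (- x) * 1 \<partial>gaussian d)"
      using nn_integral_gaussian_uminus by simp
  qed auto
  then show ?thesis by simp
qed

lemma uminus_mem_walk_tube_iff:
  "(\<lambda>i\<in>{..<k}. - x i) \<in> walk_tube k h \<epsilon> \<longleftrightarrow> x \<in> walk_tube k (\<lambda>j. - h j) \<epsilon>"
  if "x \<in> space (\<Pi>\<^sub>M i\<in>{..<k}. borel)"
proof -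
  have "norm ((\<Sum>i<j. (\<lambda>i\<in>{..<k}. - x i) i) - h j) = norm ((\<Sum>i<j. x i) - - h j)" if "j \<le> k" for j
  proof -
    have "(\<Sum>i<j. (\<lambda>i\<in>{..<k}. - x i) i) = - (\<Sum>i<j. x i)"
      unfolding sum_negf[symmetric] using that by (intro sum.cong) auto
    then show ?thesis
      using norm_minus_cancel[of "(\<Sum>i<j. x i) - - h j"] by simp
  qed
  then show ?thesis using that by (auto simp: walk_tube_def space_PiM)
qed

lemma emeasure_walk_tube_uminus:
  "emeasure (gaussian_walk k d) (walk_tube k (\<lambda>j. - h j) \<epsilon>) = emeasure (gaussian_walk k d) (walk_tube k h \<epsilon>)"
proof -
  have "emeasure (gaussian_walk k d) (walk_tube k h \<epsilon>) = (\<integral>\<^sup>+x. indicator (walk_tube k h \<epsilon>) x \<partial>gaussian_walk k d)"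
    by (simp add: sets_gaussian_walk)
  also have "\<dots> = (\<integral>\<^sup>+x. indicator (walk_tube k h \<epsilon>) (\<lambda>i\<in>{..<k}. - x i) \<partial>gaussian_walk k d)"
    by (intro nn_integral_gaussian_walk_uminus borel_measurable_indicator) measurable
  also have "\<dots> = (\<integral>\<^sup>+x. indicator (walk_tube k (\<lambda>j. - h j) \<epsilon>) x \<partial>gaussian_walk k d)"
    by (intro nn_integral_cong) (simp add: space_gaussian_walk indicator_def uminus_mem_walk_tube_iff)
  also have "\<dots> = emeasure (gaussian_walk k d) (walk_tube k (\<lambda>j. - h j) \<epsilon>)"
    by (simp add: sets_gaussian_walk)
  finally show ?thesis by simp
qed

lemma mult_self_strict_mono_ennreal:
  fixes a b :: ennreal
  assumes "a < b"
  shows "a * a < b * b"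
proof -
  obtain r where r: "a = ennreal r" "0 \<le> r" using assms by (cases a) auto
  show ?thesis
  proof (cases b)
    case (real s)
    then show ?thesis
      using assms r by (simp add: ennreal_mult[symmetric] ennreal_less_iff mult_strict_mono')
  next
    case top
    then show ?thesis using r by (simp add: ennreal_mult[symmetric] ennreal_mult_top)
  qed
qed

text \<open>Prekopa--Leindler is applied to the indicators of the tubes around \<open>h\<close>, \<open>- h\<close> and \<open>0\<close>; the
  first two have the same measure by symmetry.\<close>

theorem anderson_gaussian_walk:
  fixes h :: "nat \<Rightarrow> real ^ 'n"
  assumes "d > 0"
  shows "emeasure (gaussian_walk k d) (walk_tube k h \<epsilon>) \<le> emeasure (gaussian_walk k d) (walk_tube k (\<lambda>_. 0 :: real ^ 'n) \<epsilon>)"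
proof -
  let ?P = "emeasure (gaussian_walk k d)"
  have "(\<lambda>(x, y). (1 / 2) *\<^sub>R (x + y)) \<in> gaussian d \<Otimes>\<^sub>M gaussian d \<rightarrow>\<^sub>M (gaussian d :: (real ^ 'n) measure)"
    by measurable
  then have "prekopa_leindler (\<lambda>x y. \<lambda>i\<in>{..<k}. (1 / 2) *\<^sub>R (x i + y i)) (gaussian_walk k d :: (nat \<Rightarrow> real ^ 'n) measure)"
    unfolding gaussian_walk_def
    by (intro prekopa_leindler_PiM sigma_finite_gaussian prekopa_leindler_gaussian \<open>d > 0\<close>) auto
  then have "(\<integral>\<^sup>+x. indicator (walk_tube k h \<epsilon>) x \<partial>gaussian_walk k d) *
      (\<integral>\<^sup>+x. indicator (walk_tube k (\<lambda>j. - h j) \<epsilon>) x \<partial>gaussian_walk k d) \<le>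
      (\<integral>\<^sup>+x. indicator (walk_tube k (\<lambda>_. 0 :: real ^ 'n) \<epsilon>) x \<partial>gaussian_walk k d)\<^sup>2"
  proof (rule prekopa_leindlerD)
    fix x y :: "nat \<Rightarrow> real ^ 'n"
    let ?z = "\<lambda>i\<in>{..<k}. (1 / 2) *\<^sub>R (x i + y i)"
    have "?z \<in> walk_tube k (\<lambda>_. 0 :: real ^ 'n) \<epsilon>" if xy: "x \<in> walk_tube k h \<epsilon>" "y \<in> walk_tube k (\<lambda>j. - h j) \<epsilon>"
    proof -
      have "norm ((\<Sum>i<j. ?z i) - 0) \<le> \<epsilon>" if "j \<le> k" for j
      proof -
        have "(\<Sum>i<j. ?z i) = (\<Sum>i<j. (1 / 2) *\<^sub>R (x i + y i))"
          using that by (intro sum.cong) auto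
        also have "\<dots> = (1 / 2) *\<^sub>R (((\<Sum>i<j. x i) - h j) + ((\<Sum>i<j. y i) - - h j))"
          by (simp add: scaleR_sum_right[symmetric] sum.distrib)
        also have "norm \<dots> \<le> (1 / 2) * (\<epsilon> + \<epsilon>)"
        proof -
          have "norm (((\<Sum>i<j. x i) - h j) + ((\<Sum>i<j. y i) - - h j)) \<le> \<epsilon> + \<epsilon>"
            using xy that unfolding walk_tube_def by (intro norm_triangle_le add_mono) auto
          then show ?thesis by simp
        qed
        finally show ?thesis by simp
      qed
      then show ?thesis by (simp add: walk_tube_def space_PiM)
    qed
    then show "indicator (walk_tube k h \<epsilon>) x * indicator (walk_tube k (\<lambda>j. - h j) \<epsilon>) y
       \<le> (indicator (walk_tube k (\<lambda>_. 0 :: real ^ 'n) \<epsilon>) ?z :: ennreal)\<^sup>2"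
      by (auto simp: indicator_def)
  qed (auto simp: sets_gaussian_walk intro!: borel_measurable_indicator)
  then have "?P (walk_tube k h \<epsilon>) * ?P (walk_tube k h \<epsilon>) \<le> ?P (walk_tube k (\<lambda>_. 0 :: real ^ 'n) \<epsilon>) * ?P (walk_tube k (\<lambda>_. 0 :: real ^ 'n) \<epsilon>)"
    by (simp add: sets_gaussian_walk emeasure_walk_tube_uminus power2_eq_square)
  moreover have "a \<le> b" if "a * a \<le> b * b" for a b :: ennreal
    using that
    by (metis not_le mult_self_strict_mono_ennreal)
  ultimately show ?thesis by blast
qed

text \<open>\<open>h\<close> is split into a path with increments \<open>c\<close>, which the shift
  removes, and a remainder \<open>r\<close>, which stays as the centre of the tube. The lower bound
  takes \<open>r = 0\<close>; in the upper bound \<open>r\<close> is what the coarse interpolant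
  leaves over.\<close>

lemma emeasure_walk_tube_shift:
  fixes h l r c :: "nat \<Rightarrow> real ^ 'n"
  assumes "d > 0" and h: "\<And>j. j \<le> k \<Longrightarrow> h j = (\<Sum>i<j. c i) + r j"
  shows "emeasure (gaussian_walk k d) (walk_tube k h \<epsilon>) =
    (\<integral>\<^sup>+x. indicator (walk_tube k r \<epsilon>) x *
       ennreal (exp (- (\<Sum>i<k. c i \<bullet> x i) / d - (\<Sum>i<k. (norm (c i))\<^sup>2) / (2 * d))) \<partial>gaussian_walk k d)"
proof -
  have "(\<lambda>i\<in>{..<k}. x i + c i) \<in> walk_tube k h \<epsilon> \<longleftrightarrow> x \<in> walk_tube k r \<epsilon>"
    if "x \<in> space (\<Pi>\<^sub>M i\<in>{..<k}. borel)" for x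
  proof -
    have "(\<Sum>i<j. (\<lambda>i\<in>{..<k}. x i + c i) i) - h j = (\<Sum>i<j. x i) - r j" if "j \<le> k" for j
    proof -
      have "(\<Sum>i<j. (\<lambda>i\<in>{..<k}. x i + c i) i) = (\<Sum>i<j. x i + c i)"
        using that by (intro sum.cong) auto
      then show ?thesis using h[OF that] by (simp add: sum.distrib)
    qed
    then show ?thesis using that by (auto simp: walk_tube_def space_PiM)
  qed
  then have "(\<integral>\<^sup>+x. indicator (walk_tube k h \<epsilon>) (\<lambda>i\<in>{..<k}. x i + c i) *
       ennreal (exp (- (\<Sum>i<k. c i \<bullet> x i) / d - (\<Sum>i<k. (norm (c i))\<^sup>2) / (2 * d))) \<partial>gaussian_walk k d) =
     (\<integral>\<^sup>+x. indicator (walk_tube k r \<epsilon>) x *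
       ennreal (exp (- (\<Sum>i<k. c i \<bullet> x i) / d - (\<Sum>i<k. (norm (c i))\<^sup>2) / (2 * d))) \<partial>gaussian_walk k d)"
    by (intro nn_integral_cong) (simp add: space_gaussian_walk indicator_def)
  moreover have "emeasure (gaussian_walk k d) (walk_tube k h \<epsilon>) =
      (\<integral>\<^sup>+x. indicator (walk_tube k h \<epsilon>) x \<partial>gaussian_walk k d)"
    by (simp add: sets_gaussian_walk)
  ultimately show ?thesis
    using nn_integral_gaussian_walk_shift[OF \<open>d > 0\<close>, of "indicator (walk_tube k h \<epsilon>)" k c]
    by (simp add: borel_measurable_indicator walk_tube_measurable)
qed

text \<open>On the symmetric tube around \<open>0\<close> the linear exponent can only increase the integral,
  because \<open>exp s + exp (- s) \<ge> 2\<close>.\<close>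

lemma emeasure_walk_tube_ge:
  fixes h :: "nat \<Rightarrow> real ^ 'n"
  assumes "d > 0" and "h 0 = 0"
  shows "ennreal (exp (- (\<Sum>i<k. (norm (h (Suc i) - h i))\<^sup>2) / (2 * d))) *
      emeasure (gaussian_walk k d) (walk_tube k (\<lambda>_. 0 :: real ^ 'n) \<epsilon>)
    \<le> emeasure (gaussian_walk k d) (walk_tube k h \<epsilon>)"
proof -
  let ?N = "gaussian_walk k d :: (nat \<Rightarrow> real ^ 'n) measure" and ?A = "walk_tube k (\<lambda>_. 0 :: real ^ 'n) \<epsilon>"
  define c where "c i = h (Suc i) - h i" for i
  define L where "L x = (\<Sum>i<k. c i \<bullet> x i) / d" for x
  have Lm: "(\<lambda>x. L x) \<in> borel_measurable (\<Pi>\<^sub>M i\<in>{..<k}. borel)"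
    unfolding L_def by measurable
  let ?I = "\<lambda>s. \<integral>\<^sup>+x. indicator ?A x * ennreal (exp (s * L x)) \<partial>?N"
  have int_m: "(\<lambda>x. indicator ?A x * ennreal (exp (s * L x))) \<in> borel_measurable (\<Pi>\<^sub>M i\<in>{..<k}. borel)" for s
    using Lm by measurable
  then have int_m': "(\<lambda>x. indicator ?A x * ennreal (exp (s * L x))) \<in> borel_measurable ?N" for s
    by (simp add: measurable_cong_sets[OF sets_gaussian_walk refl])
  have "?I 1 = (\<integral>\<^sup>+x. indicator ?A (\<lambda>i\<in>{..<k}. - x i) * ennreal (exp (1 * L (\<lambda>i\<in>{..<k}. - x i))) \<partial>?N)"
    by (rule nn_integral_gaussian_walk_uminus[OF int_m])
  also have "\<dots> = ?I (-1)"
  proof (rule nn_integral_cong)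
    fix x :: "nat \<Rightarrow> real ^ 'n" assume "x \<in> space ?N"
    then have "indicator ?A (\<lambda>i\<in>{..<k}. - x i) = (indicator ?A x :: ennreal)"
      using uminus_mem_walk_tube_iff[of x k "\<lambda>_. 0" \<epsilon>] by (simp add: space_gaussian_walk indicator_def)
    moreover have "L (\<lambda>i\<in>{..<k}. - x i) = - L x"
      unfolding L_def by (simp add: sum_negf)
    ultimately show "indicator ?A (\<lambda>i\<in>{..<k}. - x i) * ennreal (exp (1 * L (\<lambda>i\<in>{..<k}. - x i))) =
        indicator ?A x * ennreal (exp (-1 * L x))" by simp
  qed
  finally have sym: "?I 1 = ?I (-1)" .
  have "2 * emeasure ?N ?A = (\<integral>\<^sup>+x. 2 * indicator ?A x \<partial>?N)"
    by (simp add: nn_integral_cmult sets_gaussian_walk)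
  also have "\<dots> \<le> (\<integral>\<^sup>+x. indicator ?A x * ennreal (exp (1 * L x)) + indicator ?A x * ennreal (exp (-1 * L x)) \<partial>?N)"
  proof (intro nn_integral_mono)
    fix x
    have "2 \<le> exp (L x) + exp (- L x)"
      using cosh_real_ge_1[of "L x"] by (simp add: cosh_def)
    then have "ennreal 2 \<le> ennreal (exp (L x) + exp (- L x))" by (rule ennreal_leI)
    then have "2 \<le> ennreal (exp (L x)) + ennreal (exp (- L x))"
      unfolding ennreal_plus[OF exp_ge_zero exp_ge_zero] ennreal_numeral .
    then show "2 * indicator ?A x \<le> indicator ?A x * ennreal (exp (1 * L x)) + indicator ?A x * ennreal (exp (-1 * L x))"
      by (cases "x \<in> ?A") simp_all
  qed
  also have "\<dots> = ?I 1 + ?I (-1)"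
    by (rule nn_integral_add[OF int_m' int_m'])
  also have "\<dots> = 2 * ?I (-1)" by (simp only: sym mult_2)
  finally have "emeasure ?N ?A \<le> ?I (-1)"
    by (subst (asm) ennreal_mult_le_mult_iff) auto
  then have "ennreal (exp (- (\<Sum>i<k. (norm (c i))\<^sup>2) / (2 * d))) * emeasure ?N ?A
     \<le> ennreal (exp (- (\<Sum>i<k. (norm (c i))\<^sup>2) / (2 * d))) * ?I (-1)"
    by (rule mult_left_mono) simp
  also have "\<dots> = (\<integral>\<^sup>+x. ennreal (exp (- (\<Sum>i<k. (norm (c i))\<^sup>2) / (2 * d))) * (indicator ?A x * ennreal (exp (-1 * L x))) \<partial>?N)"
    by (rule nn_integral_cmult[OF int_m', symmetric])
  also have "\<dots> = (\<integral>\<^sup>+x. indicator ?A x * ennreal (exp (- (\<Sum>i<k. c i \<bullet> x i) / d - (\<Sum>i<k. (norm (c i))\<^sup>2) / (2 * d))) \<partial>?N)"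
  proof (rule nn_integral_cong)
    fix x :: "nat \<Rightarrow> real ^ 'n"
    have "exp (- (\<Sum>i<k. c i \<bullet> x i) / d - (\<Sum>i<k. (norm (c i))\<^sup>2) / (2 * d)) =
       exp (- (\<Sum>i<k. (norm (c i))\<^sup>2) / (2 * d)) * exp (-1 * L x)"
      unfolding L_def mult_exp_exp by simp
    then show "ennreal (exp (- (\<Sum>i<k. (norm (c i))\<^sup>2) / (2 * d))) * (indicator ?A x * ennreal (exp (-1 * L x))) =
      indicator ?A x * ennreal (exp (- (\<Sum>i<k. c i \<bullet> x i) / d - (\<Sum>i<k. (norm (c i))\<^sup>2) / (2 * d)))"
      by (simp add: ennreal_mult ac_simps)
  qed
  also have "\<dots> = emeasure ?N (walk_tube k h \<epsilon>)"
  proof (rule emeasure_walk_tube_shift[OF \<open>d > 0\<close>, symmetric])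
    show "h j = (\<Sum>i<j. c i) + 0" for j
      unfolding c_def by (subst sum_lessThan_telescope) (simp add: \<open>h 0 = 0\<close>)
  qed
  finally show ?thesis by (simp add: c_def)
qed

text \<open>The shift is the interpolant of \<open>h\<close> at the multiples of \<open>p\<close>. At these indices the walk
  stays \<open>\<epsilon>\<close>-close to \<open>0\<close>, which bounds the linear exponent independently of \<open>p\<close> (for fixed \<open>p d\<close>);
  Anderson's inequality then removes the remaining shift.\<close>

lemma emeasure_walk_tube_le:
  fixes h :: "nat \<Rightarrow> real ^ 'n"
  assumes "d > 0" and "h 0 = 0" and "p > 0"
  shows "emeasure (gaussian_walk (n * p) d) (walk_tube (n * p) h \<epsilon>) \<le>
    ennreal (exp (2 * \<epsilon> * (\<Sum>a<n. norm (h (Suc a * p) - h (a * p))) / (real p * d)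
        - (\<Sum>a<n. (norm (h (Suc a * p) - h (a * p)))\<^sup>2) / (2 * (real p * d)))) *
      emeasure (gaussian_walk (n * p) d) (walk_tube (n * p) (\<lambda>_. 0 :: real ^ 'n) \<epsilon>)"
proof -
  define D where "D a = h (Suc a * p) - h (a * p)" for a
  define c where "c i = (1 / real p) *\<^sub>R D (i div p)" for i
  define r where "r j = h j - (\<Sum>i<j. c i)" for j
  define E where "E = (\<Sum>a<n. (norm (D a))\<^sup>2) / (2 * (real p * d))"
  define C where "C = 2 * \<epsilon> * (\<Sum>a<n. norm (D a)) / (real p * d)"
  let ?N = "gaussian_walk (n * p) d :: (nat \<Rightarrow> real ^ 'n) measure"
  have block: "(\<Sum>i<m * p. g i) = (\<Sum>a<m. \<Sum>i\<in>{a * p..<a * p + p}. g i)" for g :: "nat \<Rightarrow> 'b::comm_monoid_add" and m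
    by (rule sum.nat_group[symmetric])
  have div: "i div p = a" if "i \<in> {a * p..<a * p + p}" for i a
    using that \<open>p > 0\<close> by (simp add: div_nat_eqI mult.commute)
  have cb: "c i = (1 / real p) *\<^sub>R D a" if "i \<in> {a * p..<a * p + p}" for i a
    using div[OF that] by (simp add: c_def)
  have "(\<Sum>i<a * p. c i) = h (a * p)" for a
  proof -
    have "(\<Sum>i<a * p. c i) = (\<Sum>b<a. \<Sum>i\<in>{b * p..<b * p + p}. (1 / real p) *\<^sub>R D b)"
      unfolding block by (intro sum.cong refl cb)
    also have "\<dots> = (\<Sum>b<a. h (Suc b * p) - h (b * p))"
    proof (intro sum.cong refl)
      fix b
      have "(\<Sum>i\<in>{b * p..<b * p + p}. (1 / real p) *\<^sub>R D b) = real p *\<^sub>R (1 / real p) *\<^sub>R D b"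
        unfolding sum_constant_scaleR by simp
      then show "(\<Sum>i\<in>{b * p..<b * p + p}. (1 / real p) *\<^sub>R D b) = h (Suc b * p) - h (b * p)"
        using \<open>p > 0\<close> by (simp add: D_def del: sum_constant)
    qed
    also have "\<dots> = h (a * p)"
      using sum_lessThan_telescope[of "\<lambda>b. h (b * p)" a] \<open>h 0 = 0\<close> by simp
    finally show ?thesis .
  qed
  then have r0: "r (a * p) = 0" for a by (simp add: r_def)
  have sq: "(\<Sum>i<n * p. (norm (c i))\<^sup>2) / (2 * d) = E"
  proof -
    have "(\<Sum>i<n * p. (norm (c i))\<^sup>2) = (\<Sum>b<n. \<Sum>i\<in>{b * p..<b * p + p}. (norm (D b) / real p)\<^sup>2)"
      unfolding block by (intro sum.cong refl) (simp add: cb)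
    also have "\<dots> = (\<Sum>b<n. (norm (D b))\<^sup>2) / real p"
      using \<open>p > 0\<close> by (simp add: power_divide sum_divide_distrib power2_eq_square)
    finally show ?thesis by (simp add: E_def)
  qed
  have lin: "- (\<Sum>i<n * p. c i \<bullet> x i) / d \<le> C" if x: "x \<in> walk_tube (n * p) r \<epsilon>" for x
  proof -
    define S where "S j = (\<Sum>i<j. x i)" for j
    have S: "norm (S (a * p)) \<le> \<epsilon>" if "a \<le> n" for a
      using x that unfolding walk_tube_def S_def by (auto simp: r0 dest!: spec[of _ "a * p"])
    have "(\<Sum>i<n * p. c i \<bullet> x i) = (\<Sum>a<n. \<Sum>i\<in>{a * p..<a * p + p}. ((1 / real p) *\<^sub>R D a) \<bullet> x i)"
      unfolding block by (intro sum.cong refl) (simp add: cb)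
    \<comment> \<open>Constancy of \<open>c\<close> on blocks reduces the linear functional to the
      walk at block ends. There \<open>r\<close> vanishes, so the tube gives
      \<open>norm (S (a * p)) \<le> \<epsilon>\<close>, and one block costs at most
      \<open>norm (D a) * (2 * \<epsilon>) / real p\<close>.\<close>
    also have "\<dots> = (\<Sum>a<n. (D a \<bullet> (S (Suc a * p) - S (a * p))) / real p)"
    proof (intro sum.cong refl)
      fix a
      have "S (Suc a * p) = S (a * p) + (\<Sum>i\<in>{a * p..<a * p + p}. x i)"
        unfolding S_def using sum.atLeastLessThan_concat[of 0 "a * p" "Suc a * p" x]
        by (simp add: atLeast0LessThan add.commute)
      then show "(\<Sum>i\<in>{a * p..<a * p + p}. ((1 / real p) *\<^sub>R D a) \<bullet> x i) = (D a \<bullet> (S (Suc a * p) - S (a * p))) / real p"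
        by (simp add: inner_sum_right sum_divide_distrib)
    qed
    finally have eq: "(\<Sum>i<n * p. c i \<bullet> x i) = (\<Sum>a<n. (D a \<bullet> (S (Suc a * p) - S (a * p))) / real p)" .
    have "- (\<Sum>i<n * p. c i \<bullet> x i) \<le> (\<Sum>a<n. norm (D a) * (2 * \<epsilon>) / real p)"
      unfolding eq sum_negf[symmetric]
    proof (intro sum_mono)
      fix a assume a: "a \<in> {..<n}"
      have "norm (S (Suc a * p) - S (a * p)) \<le> 2 * \<epsilon>"
        using norm_triangle_ineq4[of "S (Suc a * p)" "S (a * p)"] S[of a] S[of "Suc a"] a by simp
      then have "norm (D a) * norm (S (Suc a * p) - S (a * p)) \<le> norm (D a) * (2 * \<epsilon>)"
        by (rule mult_left_mono) simp
      moreover have "- (D a \<bullet> (S (Suc a * p) - S (a * p))) \<le> norm (D a) * norm (S (Suc a * p) - S (a * p))"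
        using Cauchy_Schwarz_ineq2[of "D a" "S (Suc a * p) - S (a * p)"] by (simp add: abs_le_iff)
      ultimately have "- (D a \<bullet> (S (Suc a * p) - S (a * p))) \<le> norm (D a) * (2 * \<epsilon>)"
        by (rule order_trans[rotated])
      from divide_right_mono[OF this of_nat_0_le_iff]
      show "- (D a \<bullet> (S (Suc a * p) - S (a * p)) / real p) \<le> norm (D a) * (2 * \<epsilon>) / real p"
        by (simp only: minus_divide_left)
    qed
    also have "\<dots> = C * d"
      using \<open>d > 0\<close> by (simp add: C_def sum_distrib_left sum_divide_distrib mult.commute)
    finally show ?thesis using \<open>d > 0\<close> by (simp only: pos_divide_le_eq)
  qed
  have "emeasure ?N (walk_tube (n * p) h \<epsilon>) =
    (\<integral>\<^sup>+x. indicator (walk_tube (n * p) r \<epsilon>) x *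
       ennreal (exp (- (\<Sum>i<n * p. c i \<bullet> x i) / d - (\<Sum>i<n * p. (norm (c i))\<^sup>2) / (2 * d))) \<partial>?N)"
    by (rule emeasure_walk_tube_shift[OF \<open>d > 0\<close>]) (simp add: r_def)
  also have "\<dots> \<le> (\<integral>\<^sup>+x. ennreal (exp (C - E)) * indicator (walk_tube (n * p) r \<epsilon>) x \<partial>?N)"
    using lin by (intro nn_integral_mono) (auto simp: indicator_def sq intro!: ennreal_leI)
  also have "\<dots> = ennreal (exp (C - E)) * emeasure ?N (walk_tube (n * p) r \<epsilon>)"
    by (simp add: nn_integral_cmult sets_gaussian_walk)
  also have "\<dots> \<le> ennreal (exp (C - E)) * emeasure ?N (walk_tube (n * p) (\<lambda>_. 0) \<epsilon>)"
    by (intro mult_left_mono anderson_gaussian_walk \<open>d > 0\<close>) simp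
  finally show ?thesis by (simp add: C_def E_def D_def)
qed

section \<open>Small balls of the Wiener process\<close>

text \<open>Energy of the polygonal interpolant of \<open>g\<close> on the dyadic grid of level
  \<open>K\<close>: squared increments over the mesh width.\<close>

definition dyadic_energy :: "real \<Rightarrow> nat \<Rightarrow> (real \<Rightarrow> 'a::real_normed_vector) \<Rightarrow> real" where
  "dyadic_energy T K g =
     (\<Sum>i<2 ^ K. (norm (g (T * real (Suc i) / 2 ^ K) - g (T * real i / 2 ^ K)))\<^sup>2) / (T / 2 ^ K)"

lemma dyadic_limit:
  fixes t T :: real
  assumes "T > 0" "t \<in> {0..T}"
  shows "\<exists>s. (\<forall>K. \<exists>j\<le>2 ^ K. s K = T * real j / 2 ^ K) \<and> s \<longlonglongrightarrow> t"
proof -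
  define j where "j K = nat \<lfloor>t / T * 2 ^ K\<rfloor>" for K :: nat
  define s where "s K = T * real (j K) / 2 ^ K" for K
  have pos: "0 \<le> t / T * 2 ^ K" and le: "t / T * 2 ^ K \<le> 2 ^ K" for K
    using assms by (auto simp: divide_le_eq)
  have j: "real (j K) \<le> t / T * 2 ^ K" "t / T * 2 ^ K < real (j K) + 1" for K
    using pos[of K] by (auto simp: j_def)
  have "j K \<le> 2 ^ K" for K
    using order_trans[OF j(1) le, of K] by simp
  moreover have "s \<longlonglongrightarrow> t"
  proof (rule tendsto_sandwich)
    have "t - T * (1 / 2) ^ K \<le> s K" for K
    proof -
      have "t * 2 ^ K < T * (real (j K) + 1)"
        using j(2)[of K] assms by (simp add: field_simps)
      then have "t \<le> T * (real (j K) + 1) / 2 ^ K" by (simp add: pos_le_divide_eq)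
      then show ?thesis
        by (simp add: s_def power_divide add_divide_distrib distrib_left)
    qed
    then show "\<forall>\<^sub>F K in sequentially. t - T * (1 / 2) ^ K \<le> s K" by simp
    have "s K \<le> t" for K
      using j(1)[of K] assms by (simp add: s_def field_simps)
    then show "\<forall>\<^sub>F K in sequentially. s K \<le> t" by simp
    have "(\<lambda>K. t - T * (1 / 2) ^ K) \<longlonglongrightarrow> t - T * 0"
      by (intro tendsto_intros LIMSEQ_realpow_zero) auto
    then show "(\<lambda>K. t - T * (1 / 2) ^ K) \<longlonglongrightarrow> t" by simp
  qed simp
  moreover have "s K = T * real (j K) / 2 ^ K" for K by (simp add: s_def)
  ultimately show ?thesis by (intro exI[of _ s]) auto
qed

lemma dyadic_le_imp_le:
  fixes u :: "real \<Rightarrow> real"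
  assumes "T > 0" "continuous_on {0..T} u"
    and le: "\<And>K j. j \<le> 2 ^ K \<Longrightarrow> u (T * real j / 2 ^ K) \<le> e" and t: "t \<in> {0..T}"
  shows "u t \<le> e"
proof -
  obtain s where s: "\<And>K. \<exists>j\<le>2 ^ K. s K = T * real j / 2 ^ K" "s \<longlonglongrightarrow> t"
    using dyadic_limit[OF \<open>T > 0\<close> t] by blast
  have "s K \<in> {0..T} \<and> u (s K) \<le> e" for K
  proof -
    obtain j where "j \<le> 2 ^ K" "s K = T * real j / 2 ^ K" using s(1) by blast
    moreover from this have "real j \<le> 2 ^ K" by (metis of_nat_le_iff of_nat_numeral of_nat_power)
    ultimately show ?thesis using le \<open>T > 0\<close> by (simp add: divide_le_eq)
  qed
  then have "(\<lambda>K. u (s K)) \<longlonglongrightarrow> u t"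
    using continuous_on_tendsto_compose[OF assms(2) s(2) t] by simp
  then show ?thesis using \<open>\<And>K. s K \<in> {0..T} \<and> u (s K) \<le> e\<close> by (intro LIMSEQ_le_const2) auto
qed

section \<open>Grid tubes and dyadic tubes\<close>

locale wiener = prob_space M for M :: "'w measure" +
  fixes T :: real and W :: "real \<Rightarrow> 'w \<Rightarrow> real ^ 'n"
  assumes T_pos: "T > 0" and wiener: "wiener_process M T W"
begin

lemma W_measurable: "t \<in> {0..T} \<Longrightarrow> W t \<in> borel_measurable M"
  using wiener by (auto simp: wiener_process_def)

lemma W_continuous: "\<omega> \<in> space M \<Longrightarrow> continuous_on {0..T} (\<lambda>t. W t \<omega>)"
  using wiener by (auto simp: wiener_process_def)

lemma W_0: "AE \<omega> in M. W 0 \<omega> = 0"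
  using wiener by (auto simp: wiener_process_def)

lemma W_indep:
  "(\<And>i. i \<le> k \<Longrightarrow> \<tau> i \<in> {0..T}) \<Longrightarrow> (\<And>i. i < k \<Longrightarrow> \<tau> i \<le> \<tau> (Suc i)) \<Longrightarrow>
    indep_vars (\<lambda>_. borel) (\<lambda>i \<omega>. W (\<tau> (Suc i)) \<omega> - W (\<tau> i) \<omega>) {..<k}"
  using wiener by (simp add: wiener_process_def)

lemma W_distributed:
  "0 \<le> s \<Longrightarrow> s < t \<Longrightarrow> t \<le> T \<Longrightarrow> distributed M lborel (\<lambda>\<omega>. W t \<omega> - W s \<omega>)
     (\<lambda>x. ennreal (\<Prod>i\<in>UNIV. normal_density 0 (sqrt (t - s)) (x $ i)))"
  using wiener by (simp add: wiener_process_def)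

lemma grid_mem: "k > 0 \<Longrightarrow> j \<le> k \<Longrightarrow> T * real j / real k \<in> {0..T}"
  using T_pos by (auto simp: field_simps)

lemma distr_increments:
  assumes "k > 0"
  shows "distr M (\<Pi>\<^sub>M i\<in>{..<k}. borel)
      (\<lambda>\<omega>. \<lambda>i\<in>{..<k}. W (T * real (Suc i) / real k) \<omega> - W (T * real i / real k) \<omega>) =
    gaussian_walk k (T / real k)"
proof -
  define X where "X i \<omega> = W (T * real (Suc i) / real k) \<omega> - W (T * real i / real k) \<omega>" for i \<omega>
  have Xm: "X i \<in> borel_measurable M" if "i \<in> {..<k}" for i
    unfolding X_def using that grid_mem[OF assms, of i] grid_mem[OF assms, of "Suc i"]
    by (intro borel_measurable_diff W_measurable) auto
  have "indep_vars (\<lambda>_. borel) X {..<k}"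
    unfolding X_def using grid_mem[OF assms] T_pos
    by (intro W_indep) (auto intro!: divide_right_mono mult_left_mono)
  then have "distr M (\<Pi>\<^sub>M i\<in>{..<k}. borel) (\<lambda>\<omega>. \<lambda>i\<in>{..<k}. X i \<omega>) = (\<Pi>\<^sub>M i\<in>{..<k}. distr M borel (X i))"
    using Xm assms by (subst (asm) indep_vars_iff_distr_eq_PiM') auto
  also have "\<dots> = gaussian_walk k (T / real k)"
    unfolding gaussian_walk_def
  proof (intro PiM_cong refl)
    fix i assume i: "i \<in> {..<k}"
    have "distributed M lborel (X i) (\<lambda>x. ennreal (\<Prod>j\<in>UNIV. normal_density 0 (sqrt (T * real (Suc i) / real k - T * real i / real k)) (x $ j)))"
      unfolding X_def
    proof (rule W_distributed)
      show "T * real i / real k < T * real (Suc i) / real k"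
        using T_pos assms by (intro divide_strict_right_mono mult_strict_left_mono) auto
    qed (use grid_mem[OF assms, of i] grid_mem[OF assms, of "Suc i"] i in auto)
    moreover have "T * real (Suc i) / real k - T * real i / real k = T / real k"
      by (simp add: algebra_simps add_divide_distrib)
    ultimately have "distr M lborel (X i) = gaussian (T / real k)"
      by (simp add: distributed_distr_eq_density gaussian_def gaussian_density_def)
    moreover have "distr M lborel (X i) = distr M borel (X i)" by (intro distr_cong) auto
    ultimately show "distr M borel (X i) = gaussian (T / real k)" by simp
  qed
  finally show ?thesis unfolding X_def .
qed

definition grid_tube :: "nat \<Rightarrow> (real \<Rightarrow> real ^ 'n) \<Rightarrow> real \<Rightarrow> 'w set" where
  "grid_tube k g \<epsilon> = {\<omega> \<in> space M. \<forall>j\<le>k. norm (W (T * real j / real k) \<omega> - g (T * real j / real k)) \<le> \<epsilon>}"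

text \<open>An intersection of decreasing measurable events, so its probability is the limit over
  the grids. It makes sense for arbitrary \<open>g\<close>, including the discontinuous step
  functions in \<open>prob_dyadic_tube_pos\<close>; for continuous \<open>g\<close> it is the
  uniform tube.\<close>

definition dyadic_tube :: "(real \<Rightarrow> real ^ 'n) \<Rightarrow> real \<Rightarrow> 'w set" where
  "dyadic_tube g \<epsilon> = (\<Inter>K. grid_tube (2 ^ K) g \<epsilon>)"

lemma grid_tube_sets: "k > 0 \<Longrightarrow> grid_tube k g \<epsilon> \<in> sets M"
proof -
  assume "k > 0"
  have [measurable]: "W (T * real j / real k) \<in> borel_measurable M" if "j \<le> k" for j
    using that grid_mem[OF \<open>k > 0\<close>] by (intro W_measurable) auto
  show ?thesis unfolding grid_tube_def by measurable
qed

lemma dyadic_tube_sets: "dyadic_tube g \<epsilon> \<in> sets M"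
  unfolding dyadic_tube_def by (intro sets.countable_INT) (auto intro!: grid_tube_sets)

lemma decseq_grid_tube: "decseq (\<lambda>K. grid_tube (2 ^ K) g \<epsilon>)"
proof (rule decseq_SucI, rule subsetI)
  fix K \<omega> assume \<omega>: "\<omega> \<in> grid_tube (2 ^ Suc K) g \<epsilon>"
  have "norm (W (T * real j / real (2 ^ K)) \<omega> - g (T * real j / real (2 ^ K))) \<le> \<epsilon>" if "j \<le> 2 ^ K" for j
  proof -
    have "T * real (2 * j) / real (2 ^ Suc K) = T * real j / real (2 ^ K)" by simp
    moreover have "2 * j \<le> 2 ^ Suc K" using that by simp
    ultimately show ?thesis using \<omega> unfolding grid_tube_def by (metis (mono_tags, lifting) mem_Collect_eq)
  qed
  then show "\<omega> \<in> grid_tube (2 ^ K) g \<epsilon>" using \<omega> by (simp add: grid_tube_def)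
qed

lemma dyadic_tube_LIMSEQ: "(\<lambda>K. prob (grid_tube (2 ^ K) g \<epsilon>)) \<longlonglongrightarrow> prob (dyadic_tube g \<epsilon>)"
  unfolding dyadic_tube_def
  by (intro finite_Lim_measure_decseq decseq_grid_tube) (auto intro!: grid_tube_sets)

lemma prob_dyadic_tube_le_grid: "prob (dyadic_tube g \<epsilon>) \<le> prob (grid_tube (2 ^ K) g \<epsilon>)"
  by (intro finite_measure_mono grid_tube_sets) (auto simp: dyadic_tube_def)

text \<open>Since \<open>W 0 = 0\<close> almost surely, the partial sums of the grid increments are
  the values of \<open>W\<close> at the grid times.\<close>

lemma emeasure_grid_tube:
  assumes "k > 0"
  shows "emeasure M (grid_tube k g \<epsilon>) =
    emeasure (gaussian_walk k (T / real k)) (walk_tube k (\<lambda>j. g (T * real j / real k)) \<epsilon>)"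
proof -
  let ?D = "\<lambda>\<omega>. \<lambda>i\<in>{..<k}. W (T * real (Suc i) / real k) \<omega> - W (T * real i / real k) \<omega>"
  let ?A = "walk_tube k (\<lambda>j. g (T * real j / real k)) \<epsilon>"
  have Dm: "?D \<in> measurable M (\<Pi>\<^sub>M i\<in>{..<k}. borel)"
    using grid_mem[OF assms]
    by (intro measurable_restrict borel_measurable_diff W_measurable) (auto intro!: grid_mem[OF assms] simp del: of_nat_Suc)
  have "emeasure (gaussian_walk k (T / real k)) ?A = emeasure M (?D -` ?A \<inter> space M)"
    unfolding distr_increments[OF assms, symmetric]
    by (rule emeasure_distr[OF Dm]) measurable
  also have "\<dots> = emeasure M (grid_tube k g \<epsilon>)"
  proof (rule emeasure_eq_AE)
    show "AE \<omega> in M. (\<omega> \<in> ?D -` ?A \<inter> space M) = (\<omega> \<in> grid_tube k g \<epsilon>)"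
      using W_0
    proof eventually_elim
      case (elim \<omega>)
      have "(\<Sum>i<j. ?D \<omega> i) = W (T * real j / real k) \<omega>" if "j \<le> k" for j
      proof -
        have "(\<Sum>i<j. ?D \<omega> i) = (\<Sum>i<j. W (T * real (Suc i) / real k) \<omega> - W (T * real i / real k) \<omega>)"
          using that by (intro sum.cong) auto
        also have "\<dots> = W (T * real j / real k) \<omega>"
          using sum_lessThan_telescope[of "\<lambda>i. W (T * real i / real k) \<omega>" j] elim by simp
        finally show ?thesis .
      qed
      moreover have "?D \<omega> \<in> space (\<Pi>\<^sub>M i\<in>{..<k}. borel)" by (simp add: space_PiM)
      ultimately show ?case by (auto simp: walk_tube_def grid_tube_def)
    qed
  qed (use Dm assms in \<open>auto intro!: measurable_sets grid_tube_sets walk_tube_measurable\<close>)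
  finally show ?thesis by simp
qed

lemma prob_dyadic_tube_le_0: "prob (dyadic_tube g \<epsilon>) \<le> prob (dyadic_tube (\<lambda>_. 0) \<epsilon>)"
proof (rule LIMSEQ_le[OF dyadic_tube_LIMSEQ dyadic_tube_LIMSEQ], intro exI allI impI)
  fix K :: nat
  have "emeasure M (grid_tube (2 ^ K) g \<epsilon>) \<le> emeasure M (grid_tube (2 ^ K) (\<lambda>_. 0) \<epsilon>)"
    unfolding emeasure_grid_tube[OF zero_less_power[OF zero_less_numeral]]
    by (rule anderson_gaussian_walk) (simp add: T_pos)
  then show "prob (grid_tube (2 ^ K) g \<epsilon>) \<le> prob (grid_tube (2 ^ K) (\<lambda>_. 0) \<epsilon>)"
    by (simp add: emeasure_eq_measure)
qed

lemma prob_dyadic_tube_ge: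
  assumes "g 0 = 0" and E: "\<And>K. dyadic_energy T K g \<le> E"
  shows "exp (- E / 2) * prob (dyadic_tube (\<lambda>_. 0) \<epsilon>) \<le> prob (dyadic_tube g \<epsilon>)"
proof (rule LIMSEQ_le_const[OF dyadic_tube_LIMSEQ], intro exI allI impI)
  fix K :: nat
  define k :: nat where "k = 2 ^ K"
  have k: "k > 0" "real k = 2 ^ K" by (simp_all add: k_def)
  let ?h = "\<lambda>j. g (T * real j / real k)"
  have "ennreal (exp (- (\<Sum>i<k. (norm (?h (Suc i) - ?h i))\<^sup>2) / (2 * (T / real k)))) *
      emeasure M (grid_tube k (\<lambda>_. 0) \<epsilon>) \<le> emeasure M (grid_tube k g \<epsilon>)"
    unfolding emeasure_grid_tube[OF \<open>k > 0\<close>]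
    by (rule emeasure_walk_tube_ge) (use T_pos k assms in auto)
  then have *: "exp (- (\<Sum>i<k. (norm (?h (Suc i) - ?h i))\<^sup>2) / (2 * (T / real k))) *
      prob (grid_tube k (\<lambda>_. 0) \<epsilon>) \<le> prob (grid_tube k g \<epsilon>)"
    by (simp add: emeasure_eq_measure ennreal_mult[symmetric])
  have "- E / 2 \<le> - (\<Sum>i<k. (norm (?h (Suc i) - ?h i))\<^sup>2) / (2 * (T / real k))"
    using E[of K] unfolding dyadic_energy_def k(2)[symmetric] by (simp add: k_def[symmetric])
  then have "exp (- E / 2) * prob (dyadic_tube (\<lambda>_. 0) \<epsilon>) \<le>
      exp (- (\<Sum>i<k. (norm (?h (Suc i) - ?h i))\<^sup>2) / (2 * (T / real k))) * prob (grid_tube k (\<lambda>_. 0) \<epsilon>)"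
    by (intro mult_mono) (auto simp: k_def prob_dyadic_tube_le_grid simp del: of_nat_power)
  with * show "exp (- E / 2) * prob (dyadic_tube (\<lambda>_. 0) \<epsilon>) \<le> prob (grid_tube (2 ^ K) g \<epsilon>)"
    by (simp add: k_def)
qed

text \<open>The coarse level \<open>K\<close> carries the shift and stays fixed while the fine level
  \<open>L\<close> tends to infinity. With \<open>p = 2 ^ (L - K)\<close> steps per coarse interval,
  \<open>p\<close> times the fine mesh is \<open>T / 2 ^ K\<close>, so the constant does not depend
  on \<open>L\<close>.\<close>

lemma prob_dyadic_tube_upper:
  assumes "g 0 = 0"
  shows "prob (dyadic_tube g \<epsilon>) \<le>
    exp (2 * \<epsilon> * (\<Sum>i<2 ^ K. norm (g (T * real (Suc i) / 2 ^ K) - g (T * real i / 2 ^ K))) / (T / 2 ^ K)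
       - dyadic_energy T K g / 2) * prob (dyadic_tube (\<lambda>_. 0) \<epsilon>)" (is "_ \<le> ?c * _")
proof (rule LIMSEQ_le[OF dyadic_tube_LIMSEQ tendsto_mult_left[OF dyadic_tube_LIMSEQ]], intro exI allI impI)
  fix L assume "K \<le> L"
  define n p :: nat where "n = 2 ^ K" and "p = 2 ^ (L - K)"
  have np: "n * p = 2 ^ L" using \<open>K \<le> L\<close> by (simp add: n_def p_def flip: power_add)
  have pos: "n > 0" "p > 0" "n * p > 0" by (simp_all add: n_def p_def)
  let ?h = "\<lambda>j. g (T * real j / real (n * p))"
  let ?d = "T / real (n * p)"
  have pd: "real p * ?d = T / 2 ^ K" using pos by (simp add: n_def)
  have hp: "?h (a * p) = g (T * real a / 2 ^ K)" for a
    using pos by (simp add: n_def)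
  have "emeasure M (grid_tube (n * p) g \<epsilon>) \<le>
    ennreal (exp (2 * \<epsilon> * (\<Sum>a<n. norm (?h (Suc a * p) - ?h (a * p))) / (real p * ?d)
        - (\<Sum>a<n. (norm (?h (Suc a * p) - ?h (a * p)))\<^sup>2) / (2 * (real p * ?d)))) *
      emeasure M (grid_tube (n * p) (\<lambda>_. 0) \<epsilon>)"
    unfolding emeasure_grid_tube[OF \<open>n * p > 0\<close>]
    by (rule emeasure_walk_tube_le) (use T_pos pos assms in auto)
  also have "exp (2 * \<epsilon> * (\<Sum>a<n. norm (?h (Suc a * p) - ?h (a * p))) / (real p * ?d)
        - (\<Sum>a<n. (norm (?h (Suc a * p) - ?h (a * p)))\<^sup>2) / (2 * (real p * ?d))) = ?c"
    unfolding hp pd dyadic_energy_def by (simp add: n_def)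
  finally have "prob (grid_tube (n * p) g \<epsilon>) \<le> ?c * prob (grid_tube (n * p) (\<lambda>_. 0) \<epsilon>)"
    by (simp add: emeasure_eq_measure ennreal_mult[symmetric])
  then show "prob (grid_tube (2 ^ L) g \<epsilon>) \<le> ?c * prob (grid_tube (2 ^ L) (\<lambda>_. 0) \<epsilon>)"
    by (simp only: np)
qed

lemma mem_dyadic_tube_iff:
  assumes "\<omega> \<in> space M" "continuous_on {0..T} g"
  shows "\<omega> \<in> dyadic_tube g \<epsilon> \<longleftrightarrow> (\<forall>t\<in>{0..T}. norm (W t \<omega> - g t) \<le> \<epsilon>)"
proof
  assume \<omega>: "\<omega> \<in> dyadic_tube g \<epsilon>"
  show "\<forall>t\<in>{0..T}. norm (W t \<omega> - g t) \<le> \<epsilon>"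
  proof (rule ballI, rule dyadic_le_imp_le[OF T_pos, where u = "\<lambda>t. norm (W t \<omega> - g t)"])
    show "continuous_on {0..T} (\<lambda>t. norm (W t \<omega> - g t))"
      using W_continuous assms by (intro continuous_intros) auto
    show "norm (W (T * real j / 2 ^ K) \<omega> - g (T * real j / 2 ^ K)) \<le> \<epsilon>" if "j \<le> 2 ^ K" for K j
      using \<omega> that by (auto simp: dyadic_tube_def grid_tube_def)
  qed
next
  assume "\<forall>t\<in>{0..T}. norm (W t \<omega> - g t) \<le> \<epsilon>"
  then show "\<omega> \<in> dyadic_tube g \<epsilon>"
    using assms grid_mem[of "2 ^ _"] by (auto simp: dyadic_tube_def grid_tube_def)
qed

text \<open>Countably many step functions come uniformly \<open>\<epsilon>\<close>-close to every continuous path; by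
  Anderson's inequality none of their tubes is more likely than the centered one.\<close>

lemma prob_dyadic_tube_pos:
  assumes "\<epsilon> > 0"
  shows "prob (dyadic_tube (\<lambda>_. 0) \<epsilon>) > 0"
proof (rule ccontr)
  assume "\<not> ?thesis"
  then have zero: "prob (dyadic_tube g \<epsilon>) = 0" for g
    using prob_dyadic_tube_le_0[of g \<epsilon>] measure_nonneg[of M "dyadic_tube g \<epsilon>"] by linarith
  obtain D :: "(real ^ 'n) set" where D: "countable D" "\<And>X. open X \<Longrightarrow> X \<noteq> {} \<Longrightarrow> \<exists>d\<in>D. d \<in> X"
    using countable_dense_setE by blast
  \<comment> \<open>Step function with value \<open>v ! i\<close> on the \<open>i\<close>-th of
    \<open>n\<close> equal pieces of \<open>[0, T]\<close>. A number of pieces and a list over a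
    countable dense set leave only countably many such functions.\<close>
  define g where "g = (\<lambda>(n, v) t. v ! nat \<lfloor>t * real n / T\<rfloor> :: real ^ 'n)"
  let ?I = "(UNIV :: nat set) \<times> lists D"
  have cover: "space M \<subseteq> (\<Union>i\<in>?I. dyadic_tube (g i) \<epsilon>)"
  proof
    fix \<omega> assume \<omega>: "\<omega> \<in> space M"
    have "uniformly_continuous_on {0..T} (\<lambda>t. W t \<omega>)"
      using W_continuous[OF \<omega>] by (intro compact_uniformly_continuous) auto
    then obtain \<delta> where \<delta>: "\<delta> > 0" "\<And>s t. s \<in> {0..T} \<Longrightarrow> t \<in> {0..T} \<Longrightarrow> dist s t < \<delta> \<Longrightarrow> dist (W s \<omega>) (W t \<omega>) < \<epsilon> / 2"
      unfolding uniformly_continuous_on_def using assms by (metis half_gt_zero)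
    obtain n :: nat where n: "real n > T / \<delta>" using reals_Archimedean2 by blast
    then have "n > 0" using T_pos \<delta>(1) by (metis divide_pos_pos gr0I not_less_iff_gr_or_eq of_nat_0 order_less_trans)
    have Tn: "T / real n < \<delta>" using n \<open>n > 0\<close> \<delta>(1) by (simp add: field_simps)
    have "\<exists>d\<in>D. d \<in> ball (W (T * real i / real n) \<omega>) (\<epsilon> / 2)" for i
      using assms by (intro D(2)) auto
    then obtain d where d: "\<And>i. d i \<in> D" "\<And>i. dist (W (T * real i / real n) \<omega>) (d i) < \<epsilon> / 2"
      unfolding Bex_def by (metis mem_ball)
    \<comment> \<open>One entry more than there are pieces: the time \<open>t = T\<close> has index
      \<open>n\<close>.\<close>
    define v where "v = map d [0..<Suc n]"
    have "v \<in> lists D" using d(1) by (auto simp: v_def)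
    moreover have "norm (W t \<omega> - g (n, v) t) \<le> \<epsilon>" if t: "t \<in> {0..T}" for t
    proof -
      define i where "i = nat \<lfloor>t * real n / T\<rfloor>"
      have nonneg: "0 \<le> t * real n / T" using t T_pos by simp
      then have i: "real i \<le> t * real n / T" "t * real n / T < real i + 1"
        unfolding i_def by auto
      have "t * real n / T \<le> real n" using mult_right_mono[of t T "real n"] t T_pos by (simp add: divide_le_eq mult.commute)
      then have "i \<le> n" using i(1) by linarith
      have "dist t (T * real i / real n) \<le> T / real n"
      proof -
        have "T * real i / real n \<le> t" using i(1) T_pos \<open>n > 0\<close> by (simp add: field_simps)
        moreover have "t \<le> T * real i / real n + T / real n"
          using i(2) T_pos \<open>n > 0\<close> by (simp add: field_simps)
        ultimately show ?thesis by (simp add: dist_real_def)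
      qed
      then have "dist (W t \<omega>) (W (T * real i / real n) \<omega>) < \<epsilon> / 2"
        using Tn t grid_mem[OF \<open>n > 0\<close> \<open>i \<le> n\<close>] by (intro \<delta>(2)) auto
      then have "dist (W t \<omega>) (d i) < \<epsilon>"
        using d(2)[of i] dist_triangle_half_r[of "W (T * real i / real n) \<omega>" "W t \<omega>" \<epsilon> "d i"]
        by (simp add: dist_commute)
      moreover have "g (n, v) t = d i"
        using \<open>i \<le> n\<close> unfolding g_def v_def by (simp add: i_def[symmetric] nth_append del: upt_Suc)
      ultimately show ?thesis by (simp add: dist_norm)
    qed
    then have "\<omega> \<in> dyadic_tube (g (n, v)) \<epsilon>"
      using \<omega> grid_mem[of "2 ^ _"] by (auto simp: dyadic_tube_def grid_tube_def)
    ultimately show "\<omega> \<in> (\<Union>i\<in>?I. dyadic_tube (g i) \<epsilon>)" by blast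
  qed
  have null: "(\<Union>i\<in>?I. dyadic_tube (g i) \<epsilon>) \<in> null_sets M"
    using D(1) zero
    by (intro null_sets_UN') (auto simp: null_sets_def dyadic_tube_sets emeasure_eq_measure)
  have "emeasure M (space M) \<le> 0"
    using emeasure_mono[OF cover null_setsD2[OF null]] unfolding null_setsD1[OF null] .
  then show False by (simp add: emeasure_space_1)
qed

end

section \<open>Differentiability of absolutely continuous paths\<close>

definition nonoverlapping :: "real \<Rightarrow> real \<Rightarrow> (real \<times> real) set \<Rightarrow> bool" where
  "nonoverlapping a b D \<longleftrightarrow> finite D \<and> (\<forall>(u, v)\<in>D. a \<le> u \<and> u \<le> v \<and> v \<le> b) \<and>
     pairwise (\<lambda>I J. {fst I<..<snd I} \<inter> {fst J<..<snd J} = {}) D"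

lemma absolutely_continuous_path_iff:
  "absolutely_continuous_path a b \<phi> \<longleftrightarrow>
     (\<forall>e>0. \<exists>d>0. \<forall>D. nonoverlapping a b D \<longrightarrow> (\<Sum>(u, v)\<in>D. v - u) < d \<longrightarrow>
        (\<Sum>(u, v)\<in>D. norm (\<phi> v - \<phi> u)) < e)"
  unfolding absolutely_continuous_path_def nonoverlapping_def by (simp only: imp_conjL)

lemma absolutely_continuous_pathD:
  assumes "absolutely_continuous_path a b \<phi>" "e > 0"
  obtains d where "d > 0" "\<And>D. nonoverlapping a b D \<Longrightarrow>
    (\<Sum>(u, v)\<in>D. v - u) < d \<Longrightarrow> (\<Sum>(u, v)\<in>D. norm (\<phi> v - \<phi> u)) < e"
  using assms unfolding absolutely_continuous_path_iff by blast

lemma absolutely_continuous_path_continuous_on: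
  assumes "absolutely_continuous_path a b \<phi>"
  shows "continuous_on {a..b} \<phi>"
  unfolding continuous_on_iff
proof (intro ballI allI impI)
  fix x e :: real assume x: "x \<in> {a..b}" and "e > 0"
  obtain d where d: "d > 0" "\<And>D. nonoverlapping a b D \<Longrightarrow>
    (\<Sum>(u, v)\<in>D. v - u) < d \<Longrightarrow> (\<Sum>(u, v)\<in>D. norm (\<phi> v - \<phi> u)) < e"
    using absolutely_continuous_pathD[OF assms \<open>e > 0\<close>] by blast
  have "dist (\<phi> y) (\<phi> x) < e" if "y \<in> {a..b}" "dist y x < d" for y
    using d(2)[of "{(min x y, max x y)}"] x that
    by (auto simp: nonoverlapping_def dist_norm abs_if min_def max_def norm_minus_commute split: if_splits)
  then show "\<exists>d>0. \<forall>x'\<in>{a..b}. dist x' x < d \<longrightarrow> dist (\<phi> x') (\<phi> x) < e"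
    using d(1) by blast
qed

text \<open>Two dominating paths cover all uses: a coordinate is dominated by the path itself, while
  \<open>f x - q * x\<close> and an affine image plus an integral are dominated by a path and the
  identity.\<close>

lemma absolutely_continuous_path_dominated:
  fixes \<phi> :: "real \<Rightarrow> 'a::real_normed_vector" and \<psi> :: "real \<Rightarrow> 'b::real_normed_vector"
    and \<xi> :: "real \<Rightarrow> 'c::real_normed_vector"
  assumes \<phi>: "absolutely_continuous_path a b \<phi>" and \<psi>: "absolutely_continuous_path a b \<psi>"
    and le: "\<And>u v. a \<le> u \<Longrightarrow> u \<le> v \<Longrightarrow> v \<le> b \<Longrightarrow>
      norm (\<xi> v - \<xi> u) \<le> C * (norm (\<phi> v - \<phi> u) + norm (\<psi> v - \<psi> u))"
  shows "absolutely_continuous_path a b \<xi>"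
  unfolding absolutely_continuous_path_iff
proof (intro allI impI)
  fix e :: real assume "e > 0"
  \<comment> \<open>\<open>\<bar>C\<bar> + 1\<close> is positive whatever the sign of
    \<open>C\<close>, so it may be divided by.\<close>
  define e' where "e' = e / (\<bar>C\<bar> + 1) / 2"
  have "e' > 0" using \<open>e > 0\<close> by (simp add: e'_def)
  obtain d1 where d1: "d1 > 0" "\<And>D. nonoverlapping a b D \<Longrightarrow>
    (\<Sum>(u, v)\<in>D. v - u) < d1 \<Longrightarrow> (\<Sum>(u, v)\<in>D. norm (\<phi> v - \<phi> u)) < e'"
    using absolutely_continuous_pathD[OF \<phi> \<open>e' > 0\<close>] by blast
  obtain d2 where d2: "d2 > 0" "\<And>D. nonoverlapping a b D \<Longrightarrow>
    (\<Sum>(u, v)\<in>D. v - u) < d2 \<Longrightarrow> (\<Sum>(u, v)\<in>D. norm (\<psi> v - \<psi> u)) < e'"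
    using absolutely_continuous_pathD[OF \<psi> \<open>e' > 0\<close>] by blast
  show "\<exists>d>0. \<forall>D. nonoverlapping a b D \<longrightarrow>
    (\<Sum>(u, v)\<in>D. v - u) < d \<longrightarrow> (\<Sum>(u, v)\<in>D. norm (\<xi> v - \<xi> u)) < e"
  proof (intro exI[of _ "min d1 d2"] conjI allI impI)
    fix D :: "(real \<times> real) set"
    assume D: "nonoverlapping a b D" "(\<Sum>(u, v)\<in>D. v - u) < min d1 d2"
    have "(\<Sum>(u, v)\<in>D. norm (\<xi> v - \<xi> u)) \<le>
       (\<Sum>(u, v)\<in>D. (\<bar>C\<bar> + 1) * norm (\<phi> v - \<phi> u) + (\<bar>C\<bar> + 1) * norm (\<psi> v - \<psi> u))"
    proof (intro sum_mono, clarify)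
      fix u v assume "(u, v) \<in> D"
      then have "norm (\<xi> v - \<xi> u) \<le> C * (norm (\<phi> v - \<phi> u) + norm (\<psi> v - \<psi> u))"
        using D(1) by (intro le) (auto simp: nonoverlapping_def)
      also have "\<dots> \<le> (\<bar>C\<bar> + 1) * (norm (\<phi> v - \<phi> u) + norm (\<psi> v - \<psi> u))"
        by (intro mult_right_mono) auto
      finally show "norm (\<xi> v - \<xi> u) \<le> (\<bar>C\<bar> + 1) * norm (\<phi> v - \<phi> u) + (\<bar>C\<bar> + 1) * norm (\<psi> v - \<psi> u)"
        by (simp add: distrib_left)
    qed
    also have "\<dots> = (\<bar>C\<bar> + 1) * ((\<Sum>(u, v)\<in>D. norm (\<phi> v - \<phi> u)) + (\<Sum>(u, v)\<in>D. norm (\<psi> v - \<psi> u)))"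
      by (simp add: case_prod_beta sum.distrib sum_distrib_left distrib_left)
    also have "\<dots> < (\<bar>C\<bar> + 1) * (e' + e')"
      using D by (intro mult_strict_left_mono add_strict_mono d1(2) d2(2)) auto
    also have "e' + e' = e / (\<bar>C\<bar> + 1)" by (simp only: e'_def field_sum_of_halves)
    also have "(\<bar>C\<bar> + 1) * (e / (\<bar>C\<bar> + 1)) = e" using abs_ge_zero[of C] by simp
    finally show "(\<Sum>(u, v)\<in>D. norm (\<xi> v - \<xi> u)) < e" .
  qed (use d1 d2 in auto)
qed

lemma absolutely_continuous_path_ident: "absolutely_continuous_path a b (\<lambda>x. x)"
  unfolding absolutely_continuous_path_iff
proof (intro allI impI)
  fix e :: real assume "e > 0"
  show "\<exists>d>0. \<forall>D. nonoverlapping a b D \<longrightarrow>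
    (\<Sum>(u, v)\<in>D. v - u) < d \<longrightarrow> (\<Sum>(u, v)\<in>D. norm (v - u)) < e"
  proof (intro exI[of _ e] conjI allI impI)
    fix D :: "(real \<times> real) set"
    assume D: "nonoverlapping a b D" "(\<Sum>(u, v)\<in>D. v - u) < e"
    have "(\<Sum>(u, v)\<in>D. norm (v - u)) = (\<Sum>(u, v)\<in>D. v - u)"
      using D(1) by (intro sum.cong) (auto simp: nonoverlapping_def)
    with D(2) show "(\<Sum>(u, v)\<in>D. norm (v - u)) < e" by simp
  qed fact
qed

text \<open>Tagging every interval with its left end turns the division into a tagged division, to
  which the additivity theorem applies.\<close>

lemma sum_division_telescope:
  fixes f :: "real \<Rightarrow> real"
  assumes "q division_of {a..b}" "a \<le> b"
  shows "(\<Sum>K\<in>q. f (Sup K) - f (Inf K)) = f b - f a"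
proof -
  note q = division_ofD[OF assms(1)]
  have "(\<lambda>K. (Inf K, K)) ` q tagged_division_of {a..b}"
  proof (rule tagged_division_ofI)
    fix x K assume "(x, K) \<in> (\<lambda>K. (Inf K, K)) ` q"
    then have K: "K \<in> q" "x = Inf K" by auto
    obtain u v where uv: "K = cbox u v" using q(4)[OF K(1)] by blast
    with q(3)[OF K(1)] K(2) show "x \<in> K" by auto
    show "K \<subseteq> {a..b}" by (rule q(2)[OF K(1)])
    show "\<exists>u v. K = cbox u v" using uv by blast
  next
    fix x1 K1 x2 K2
    assume "(x1, K1) \<in> (\<lambda>K. (Inf K, K)) ` q" "(x2, K2) \<in> (\<lambda>K. (Inf K, K)) ` q" "(x1, K1) \<noteq> (x2, K2)"
    then show "interior K1 \<inter> interior K2 = {}" using q(5) by auto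
  next
    have "{K. \<exists>x. (x, K) \<in> (\<lambda>K. (Inf K, K)) ` q} = q" by auto
    then show "\<Union>{K. \<exists>x. (x, K) \<in> (\<lambda>K. (Inf K, K)) ` q} = {a..b}" using q(6) by simp
  qed (use q(1) in auto)
  from additive_tagged_division_1[OF assms(2) this, of f]
  show ?thesis by (subst (asm) sum.reindex) (auto simp: inj_on_def)
qed

text \<open>Closed, nondegenerate and pairwise disjoint, as delivered by the Vitali covering
  theorem: distinct pairs are distinct intervals, and lengths add up to the measure of the
  union.\<close>

definition disjoint_intervals :: "real \<Rightarrow> real \<Rightarrow> (real \<times> real) set \<Rightarrow> bool" where
  "disjoint_intervals a b C \<longleftrightarrow> finite C \<and> (\<forall>(u, v)\<in>C. a \<le> u \<and> u < v \<and> v \<le> b) \<and>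
     pairwise (\<lambda>i j. disjnt {fst i..snd i} {fst j..snd j}) C"

text \<open>The complement of \<open>I\<close> and the family \<open>J\<close> are completed to one division of \<open>[a, b]\<close>; the
  intervals added in this step have total length \<open>\<bar>I\<bar> - \<bar>J\<bar>\<close> and carry the difference of the
  increments.\<close>

lemma absolutely_continuous_path_gaps:
  fixes f :: "real \<Rightarrow> real"
  assumes f: "absolutely_continuous_path a b f" and "e > 0" "a \<le> b"
  obtains d where "d > 0"
    "\<forall>I J. disjoint_intervals a b I \<longrightarrow> disjoint_intervals a b J \<longrightarrow>
      (\<forall>(u, v)\<in>J. \<exists>(u', v')\<in>I. {u..v} \<subseteq> {u'..v'}) \<longrightarrow>
      (\<Sum>(u, v)\<in>I. v - u) - (\<Sum>(u, v)\<in>J. v - u) < d \<longrightarrow>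
      \<bar>(\<Sum>(u, v)\<in>I. f v - f u) - (\<Sum>(u, v)\<in>J. f v - f u)\<bar> < e"
proof -
  obtain d where d: "d > 0" "\<And>D. nonoverlapping a b D \<Longrightarrow>
    (\<Sum>(u, v)\<in>D. v - u) < d \<Longrightarrow> (\<Sum>(u, v)\<in>D. norm (f v - f u)) < e"
    using absolutely_continuous_pathD[OF f \<open>e > 0\<close>] by blast
  let ?iv = "\<lambda>(u, v). {u..v} :: real set"
  show thesis
  proof (rule that[OF d(1)], intro allI impI)
    fix I J
    assume I: "disjoint_intervals a b I" and J: "disjoint_intervals a b J"
      and sub: "\<forall>(u, v)\<in>J. \<exists>(u', v')\<in>I. {u..v} \<subseteq> {u'..v'}"
      and small: "(\<Sum>(u, v)\<in>I. v - u) - (\<Sum>(u, v)\<in>J. v - u) < d"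
    have div: "?iv ` C division_of \<Union>(?iv ` C)" if "disjoint_intervals a b C" for C
    proof (rule division_ofI)
      fix K1 K2 assume "K1 \<in> ?iv ` C" "K2 \<in> ?iv ` C" "K1 \<noteq> K2"
      then have "disjnt K1 K2" using that unfolding disjoint_intervals_def pairwise_def
        by (auto simp: case_prod_beta)
      then show "interior K1 \<inter> interior K2 = {}"
        unfolding disjnt_def using interior_subset by blast
    next
      fix K assume "K \<in> ?iv ` C"
      then obtain u v where "(u, v) \<in> C" "K = {u..v}" by auto
      then show "K \<noteq> {}" "\<exists>a b. K = cbox a b"
        using that unfolding disjoint_intervals_def by (auto simp: less_imp_le)
    qed (use that in \<open>auto simp: disjoint_intervals_def\<close>)
    have sub_ab: "\<Union>(?iv ` C) \<subseteq> cbox a b" if "disjoint_intervals a b C" for C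
      using that unfolding disjoint_intervals_def by fastforce
    have sum_iv: "(\<Sum>K\<in>?iv ` C. g (Sup K) - g (Inf K)) = (\<Sum>(u, v)\<in>C. g v - g u)"
      if C: "disjoint_intervals a b C" for C and g :: "real \<Rightarrow> real"
    proof (subst sum.reindex)
      show "inj_on ?iv C"
        using C unfolding inj_on_def disjoint_intervals_def
        by (auto simp: Icc_eq_Icc)
      show "sum ((\<lambda>K. g (Sup K) - g (Inf K)) \<circ> ?iv) C = (\<Sum>(u, v)\<in>C. g v - g u)"
        using C unfolding disjoint_intervals_def by (intro sum.cong) (auto simp: less_imp_le)
    qed
    define PI where "PI = ?iv ` I"
    define PJ where "PJ = ?iv ` J"
    note dJ = division_ofD[OF div[OF J], folded PJ_def]
    obtain q where q: "PI \<subseteq> q" "q division_of cbox a b"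
      using partial_division_extend_interval[OF div[OF I] sub_ab[OF I]] unfolding PI_def by blast
    define K where "K = q - PI"
    note qD = division_ofD[OF q(2)]
    have JI: "\<exists>A\<in>PI. B \<subseteq> A" if "B \<in> PJ" for B
    proof -
      from that have B: "B \<in> ?iv ` J" by (simp add: PJ_def)
      obtain j where j: "j \<in> J" "B = ?iv j" using B by (rule imageE)
      obtain u v where "j = (u, v)" by (cases j)
      with j have uv: "(u, v) \<in> J" "B = {u..v}" by auto
      obtain p where "p \<in> I" "{u..v} \<subseteq> ?iv p" using sub uv(1) by fast
      then show ?thesis using uv(2) unfolding PI_def by blast
    qed
    have Jint: "interior B \<noteq> {}" if "B \<in> PJ" for B
    proof -
      from that have B: "B \<in> ?iv ` J" by (simp add: PJ_def)
      obtain j where j: "j \<in> J" "B = ?iv j" using B by (rule imageE)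
      then show ?thesis using J unfolding disjoint_intervals_def by (cases j) auto
    qed
    have JK: "interior B \<inter> interior A = {}" if B: "B \<in> PJ" and A: "A \<in> K" for A B
    proof -
      obtain A' where A': "A' \<in> PI" "B \<subseteq> A'" using JI[OF B] by blast
      then have "interior A' \<inter> interior A = {}"
        using A q(1) unfolding K_def by (intro qD(5)) auto
      then show ?thesis using interior_mono[OF A'(2)] by blast
    qed
    have divJK: "PJ \<union> K division_of \<Union>(PJ \<union> K)"
    proof (rule division_ofI)
      fix A B assume "A \<in> PJ \<union> K" "B \<in> PJ \<union> K" "A \<noteq> B"
      then consider "A \<in> PJ" "B \<in> PJ" | "A \<in> PJ" "B \<in> K" | "A \<in> K" "B \<in> PJ" | "A \<in> K" "B \<in> K"
        unfolding Un_iff by argo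
      then show "interior A \<inter> interior B = {}"
      proof cases
        case 1 then show ?thesis using dJ(5) \<open>A \<noteq> B\<close> by simp
      next
        case 4 then show ?thesis using qD(5) \<open>A \<noteq> B\<close> unfolding K_def by blast
      next
        case 2 then show ?thesis using JK by simp
      next
        case 3 then show ?thesis using JK[OF 3(2,1)] by (simp add: Int_commute)
      qed
    next
      fix A assume "A \<in> PJ \<union> K"
      then show "A \<noteq> {}" "\<exists>a b. A = cbox a b"
        using dJ(3,4) qD(3,4) unfolding K_def by blast+
    next
      show "finite (PJ \<union> K)" using dJ(1) qD(1) by (simp add: K_def)
    qed auto
    have subJK: "\<Union>(PJ \<union> K) \<subseteq> cbox a b"
      using sub_ab[OF J, folded PJ_def] qD(2) unfolding K_def by blast
    obtain q' where q': "PJ \<union> K \<subseteq> q'" "q' division_of cbox a b"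
      by (rule partial_division_extend_interval[OF divJK subJK]) (rule that)
    note qD' = division_ofD[OF q'(2)]
    define R where "R = q' - (PJ \<union> K)"
    have disj: "PJ \<inter> K = {}" using JK Jint by blast
    \<comment> \<open>The divisions \<open>q\<close> (from \<open>I\<close> and \<open>K\<close>)
      and \<open>q'\<close> (from \<open>J\<close>, \<open>K\<close> and the added \<open>R\<close>)
      telescope to the same total, so \<open>K\<close> cancels. Taking \<open>g\<close> to be the
      identity gives the length of \<open>R\<close>, taking \<open>f\<close> gives its
      increments.\<close>
    have R_eq: "(\<Sum>A\<in>R. g (Sup A) - g (Inf A)) = (\<Sum>(u, v)\<in>I. g v - g u) - (\<Sum>(u, v)\<in>J. g v - g u)"
      for g :: "real \<Rightarrow> real"
    proof -
      let ?s = "\<lambda>A. g (Sup A) - g (Inf A)"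
      have "sum ?s q = sum ?s (PI) + sum ?s K"
        using sum.subset_diff[OF q(1) qD(1), of ?s] by (simp only: K_def add.commute)
      moreover have "sum ?s q' = (sum ?s (PJ) + sum ?s K) + sum ?s R"
      proof -
        have "sum ?s q' = sum ?s (PJ \<union> K) + sum ?s R"
          using sum.subset_diff[OF q'(1) qD'(1), of ?s] by (simp only: R_def add.commute)
        also have "sum ?s (PJ \<union> K) = sum ?s (PJ) + sum ?s K"
          using disj dJ(1) qD(1) by (intro sum.union_disjoint) (auto simp: K_def)
        finally show ?thesis .
      qed
      moreover have "sum ?s q = sum ?s q'"
        using sum_division_telescope[of q a b g] sum_division_telescope[of q' a b g] q q' \<open>a \<le> b\<close> by simp
      ultimately show ?thesis using sum_iv[OF I, of g] sum_iv[OF J, of g] unfolding PI_def PJ_def by linarith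
    qed
    have RD: "\<exists>u v. A = {u..v} \<and> a \<le> u \<and> u \<le> v \<and> v \<le> b" if "A \<in> R" for A
    proof -
      have "A \<in> q'" using that by (simp add: R_def)
      obtain u v where uv: "A = cbox u v" using qD'(4)[OF \<open>A \<in> q'\<close>] by blast
      then have "u \<le> v" using qD'(3)[OF \<open>A \<in> q'\<close>] by auto
      then show ?thesis using qD'(2)[OF \<open>A \<in> q'\<close>] uv by auto
    qed
    let ?D = "(\<lambda>A. (Inf A, Sup A)) ` R"
    have inj: "inj_on (\<lambda>A. (Inf A, Sup A)) R"
      unfolding inj_on_def using RD by (metis Pair_inject cInf_atLeastAtMost cSup_atLeastAtMost)
    have sumD: "(\<Sum>(u, v)\<in>?D. h u v) = (\<Sum>A\<in>R. h (Inf A) (Sup A))" for h :: "real \<Rightarrow> real \<Rightarrow> real"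
      by (subst sum.reindex[OF inj]) (simp add: comp_def)
    have "(\<Sum>(u, v)\<in>?D. norm (f v - f u)) < e"
    proof (rule d(2), unfold nonoverlapping_def, intro conjI)
      show "finite ?D" using qD'(1) by (simp add: R_def)
      show "\<forall>(u, v)\<in>?D. a \<le> u \<and> u \<le> v \<and> v \<le> b"
        using RD by fastforce
      show "pairwise (\<lambda>I J. {fst I<..<snd I} \<inter> {fst J<..<snd J} = {}) ?D"
      proof (rule pairwiseI)
        fix i j assume "i \<in> ?D" "j \<in> ?D" "i \<noteq> j"
        then obtain A B where AB: "A \<in> R" "B \<in> R" "i = (Inf A, Sup A)" "j = (Inf B, Sup B)" "A \<noteq> B" by blast
        have "interior A \<inter> interior B = {}" using AB qD'(5) by (auto simp: R_def)
        moreover have "interior A = {fst i<..<snd i}" "interior B = {fst j<..<snd j}"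
          using RD[OF AB(1)] RD[OF AB(2)] AB(3,4) by (auto simp: interior_atLeastAtMost_real)
        ultimately show "{fst i<..<snd i} \<inter> {fst j<..<snd j} = {}" by simp
      qed
      show "(\<Sum>(u, v)\<in>?D. v - u) < d"
        using small R_eq[of "\<lambda>x. x"] unfolding sumD by simp
    qed
    then have "(\<Sum>A\<in>R. \<bar>f (Sup A) - f (Inf A)\<bar>) < e" unfolding sumD by simp
    then show "\<bar>(\<Sum>(u, v)\<in>I. f v - f u) - (\<Sum>(u, v)\<in>J. f v - f u)\<bar> < e"
      using sum_abs[of "\<lambda>A. f (Sup A) - f (Inf A)" R] unfolding R_eq[of f] by linarith
  qed
qed

section \<open>Vitali coverings and differentiability almost everywhere\<close>

text \<open>The covering theorem for balls yields a countable disjoint family that exhausts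
  \<open>S\<close> up to a null set; by continuity of the measure from above, finitely many members
  leave less than \<open>e\<close>. Midpoints and half lengths turn intervals into balls.\<close>

lemma vitali_finite_cover:
  fixes S :: "real set"
  assumes S: "S \<in> lmeasurable" and "e > 0"
    and cover: "\<And>x d. x \<in> S \<Longrightarrow> d > 0 \<Longrightarrow> \<exists>u v. u < v \<and> v - u < d \<and> x \<in> {u..v} \<and> P u v"
  obtains C where "finite C" "\<forall>(u, v)\<in>C. u < v \<and> P u v"
    "pairwise (\<lambda>i j. disjnt {fst i..snd i} {fst j..snd j}) C"
    "measure lebesgue (S - (\<Union>(u, v)\<in>C. {u..v})) < e"
proof -
  let ?K = "{(u, v). u < v \<and> P u v}"
  let ?a = "\<lambda>(u, v). (u + v) / 2 :: real" and ?r = "\<lambda>(u, v). (v - u) / 2 :: real"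
  have cb: "cball (?a i) (?r i) = {fst i..snd i}" for i
    by (cases i) (simp add: cball_eq_atLeastAtMost field_simps)
  obtain C where C: "countable C" "C \<subseteq> ?K"
     "pairwise (\<lambda>i j. disjnt (cball (?a i) (?r i)) (cball (?a j) (?r j))) C"
     "negligible (S - (\<Union>i\<in>C. cball (?a i) (?r i)))"
  proof (rule Vitali_covering_theorem_cballs[of ?K ?r S ?a])
    show "0 < ?r i" if "i \<in> ?K" for i using that by auto
    show "\<exists>i. i \<in> ?K \<and> x \<in> cball (?a i) (?r i) \<and> ?r i < d" if x: "x \<in> S" "0 < d" for x d
    proof -
      obtain u v where uv: "u < v" "v - u < d" "x \<in> {u..v}" "P u v" using cover[OF x] by blast
      then show ?thesis unfolding cb by (intro exI[of _ "(u, v)"]) auto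
    qed
  qed blast
  define F where "F n = S - (\<Union>i\<in>{i \<in> C. to_nat_on C i < n}. {fst i..snd i})" for n
  have fin: "finite {i \<in> C. to_nat_on C i < n}" for n
  proof (rule inj_on_finite)
    show "inj_on (to_nat_on C) {i \<in> C. to_nat_on C i < n}"
      using inj_on_to_nat_on[OF C(1)] by (rule inj_on_subset) auto
    show "to_nat_on C ` {i \<in> C. to_nat_on C i < n} \<subseteq> {..<n}" by auto
  qed auto
  have Fm: "F n \<in> lmeasurable" for n
    unfolding F_def using S by (intro fmeasurable_Diff sets.finite_UN fin) auto
  have "(\<lambda>n. measure lebesgue (F n)) \<longlonglongrightarrow> measure lebesgue (\<Inter>n. F n)"
  proof (rule Lim_measure_decseq)
    show "range F \<subseteq> sets lebesgue" using Fm by (auto simp: fmeasurableD)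
    show "decseq F" unfolding F_def decseq_def by (auto; meson less_le_trans)
    show "emeasure lebesgue (F n) \<noteq> \<infinity>" for n using fmeasurableD2[OF Fm] by simp
  qed
  moreover have "(\<Inter>n. F n) = S - (\<Union>i\<in>C. cball (?a i) (?r i))"
    unfolding F_def cb by (auto; blast)
  then have "measure lebesgue (\<Inter>n. F n) = 0"
    using C(4) by (simp add: negligible_imp_measure0)
  ultimately have "\<forall>\<^sub>F n in sequentially. measure lebesgue (F n) < e"
    using \<open>e > 0\<close> by (intro order_tendstoD(2)[of _ 0]) auto
  then obtain n where n: "measure lebesgue (F n) < e" by (auto simp: eventually_sequentially)
  show thesis
  proof (rule that)
    show "finite {i \<in> C. to_nat_on C i < n}" by (rule fin)
    show "\<forall>(u, v)\<in>{i \<in> C. to_nat_on C i < n}. u < v \<and> P u v" using C(2) by auto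
    show "pairwise (\<lambda>i j. disjnt {fst i..snd i} {fst j..snd j}) {i \<in> C. to_nat_on C i < n}"
      using C(3) unfolding cb pairwise_def by blast
    show "measure lebesgue (S - (\<Union>(u, v)\<in>{i \<in> C. to_nat_on C i < n}. {u..v})) < e"
      using n by (simp add: F_def case_prod_beta)
  qed
qed

lemma measure_disjoint_intervals:
  assumes "disjoint_intervals a b C"
  shows "measure lebesgue (\<Union>(u, v)\<in>C. {u..v}) = (\<Sum>(u, v)\<in>C. v - u)"
proof -
  have "measure lebesgue (\<Union>i\<in>C. {fst i..snd i}) = (\<Sum>i\<in>C. measure lebesgue {fst i..snd i})"
    using assms unfolding disjoint_intervals_def
    by (intro measure_UNION') auto
  also have "\<dots> = (\<Sum>(u, v)\<in>C. v - u)"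
    using assms unfolding disjoint_intervals_def by (intro sum.cong) (auto simp: case_prod_beta less_imp_le)
  finally show ?thesis by (simp add: case_prod_beta)
qed

text \<open>Slopes will be taken over intervals with \<open>x\<close> strictly inside. Such an
  interval works for all points near \<open>x\<close> as well, which makes the set a countable
  intersection of open sets for any \<open>P\<close>, and these intervals form a Vitali cover of
  it.\<close>

definition arbitrarily_short :: "real \<Rightarrow> real \<Rightarrow> (real \<Rightarrow> real \<Rightarrow> bool) \<Rightarrow> real \<Rightarrow> bool" where
  "arbitrarily_short a b P x \<longleftrightarrow>
     (\<forall>e>0. \<exists>u v. a \<le> u \<and> u < x \<and> x < v \<and> v \<le> b \<and> v - u < e \<and> P u v)"

lemma arbitrarily_shortD:
  assumes "arbitrarily_short a b P x" "open U" "x \<in> U" "e > 0"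
  obtains u v where "a \<le> u" "u < x" "x < v" "v \<le> b" "v - u < e" "P u v" "{u..v} \<subseteq> U"
proof -
  obtain r where r: "r > 0" "ball x r \<subseteq> U" using assms(2,3) by (rule openE)
  have "min r e > 0" using r(1) assms(4) by simp
  with assms(1) obtain u v where uv: "a \<le> u" "u < x" "x < v" "v \<le> b" "v - u < min r e" "P u v"
    unfolding arbitrarily_short_def by metis
  have "{u..v} \<subseteq> ball x r" using uv by (auto simp: dist_real_def)
  then have "{u..v} \<subseteq> U" using r(2) by (rule order_trans)
  then show thesis using uv by (intro that[of u v]) auto
qed

lemma arbitrarily_short_borel: "{x. arbitrarily_short a b P x} \<in> sets borel"
proof -
  define U where "U n = (\<Union>(u, v)\<in>{(u, v). a \<le> u \<and> v \<le> b \<and> v - u < 1 / real (Suc n) \<and> P u v}. {u<..<v})" for n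
  have "{x. arbitrarily_short a b P x} = (\<Inter>n. U n)"
  proof (intro set_eqI iffI)
    fix x assume x: "x \<in> {x. arbitrarily_short a b P x}"
    have "x \<in> U n" for n
    proof -
      have "0 < 1 / real (Suc n)" by simp
      then obtain u v where "a \<le> u" "u < x" "x < v" "v \<le> b" "v - u < 1 / real (Suc n)" "P u v"
        using x unfolding arbitrarily_short_def mem_Collect_eq by metis
      then show ?thesis unfolding U_def by (intro UN_I[of "(u, v)"]) auto
    qed
    then show "x \<in> (\<Inter>n. U n)" by blast
  next
    fix x assume x: "x \<in> (\<Inter>n. U n)"
    have "\<exists>u v. a \<le> u \<and> u < x \<and> x < v \<and> v \<le> b \<and> v - u < e \<and> P u v" if e: "e > 0" for e
    proof -
      obtain n where n: "1 / real (Suc n) < e" using nat_approx_posE[OF e] by blast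
      have "x \<in> U n" using x by blast
      then obtain u v where "a \<le> u" "v \<le> b" "v - u < 1 / real (Suc n)" "P u v" "u < x" "x < v"
        unfolding U_def by auto
      then show ?thesis using n by (intro exI[of _ u] exI[of _ v]) auto
    qed
    then show "x \<in> {x. arbitrarily_short a b P x}" by (simp add: arbitrarily_short_def)
  qed
  moreover have "open (U n)" for n unfolding U_def by (intro open_UN) auto
  ultimately show ?thesis by auto
qed

lemma lmeasurable_arbitrarily_short: "{x. arbitrarily_short a b P x} \<in> lmeasurable"
proof (rule fmeasurableI2)
  show "{a..b} \<in> lmeasurable" by simp
  show "{x. arbitrarily_short a b P x} \<subseteq> {a..b}"
    unfolding arbitrarily_short_def by (auto dest!: spec[of _ 1])
  show "{x. arbitrarily_short a b P x} \<in> sets lebesgue"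
    using arbitrarily_short_borel by (metis sets_completionI_sets sets_lborel)
qed

text \<open>Vitali's theorem covers the set by disjoint intervals on which \<open>f\<close> increases, and once more,
  inside these, by intervals on which \<open>f\<close> decreases with slope \<open>- c\<close>. Both families have nearly the
  measure of the set, so by absolute continuity their increments nearly agree, which is absurd.\<close>

lemma negligible_conflicting_slopes:
  fixes f :: "real \<Rightarrow> real"
  assumes f: "absolutely_continuous_path a b f" and "a \<le> b" "c > 0"
  shows "negligible ({x. arbitrarily_short a b (\<lambda>u v. f v - f u > 0) x} \<inter>
    {x. arbitrarily_short a b (\<lambda>u v. f v - f u < - c * (v - u)) x})" (is "negligible ?E")
proof (rule ccontr)
  assume neg: "\<not> negligible ?E"
  have E: "?E \<in> lmeasurable" by (intro fmeasurable.Int lmeasurable_arbitrarily_short)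
  define s where "s = measure lebesgue ?E"
  have "s > 0" using neg E negligible_iff_measure[of ?E] by (simp add: s_def zero_less_measure_iff)
  then have "c * s / 2 > 0" using \<open>c > 0\<close> by simp
  then obtain d where d: "d > 0" "\<forall>I J. disjoint_intervals a b I \<longrightarrow> disjoint_intervals a b J \<longrightarrow>
      (\<forall>(u, v)\<in>J. \<exists>(u', v')\<in>I. {u..v} \<subseteq> {u'..v'}) \<longrightarrow>
      (\<Sum>(u, v)\<in>I. v - u) - (\<Sum>(u, v)\<in>J. v - u) < d \<longrightarrow>
      \<bar>(\<Sum>(u, v)\<in>I. f v - f u) - (\<Sum>(u, v)\<in>J. f v - f u)\<bar> < c * s / 2"
    by (rule absolutely_continuous_path_gaps[OF f _ \<open>a \<le> b\<close>, where e = "c * s / 2"]) (rule that)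
  \<comment> \<open>Budget: the length of \<open>I\<close> exceeds \<open>s\<close> by less than
    \<open>\<delta>\<close>, that of \<open>J\<close> falls short of \<open>s\<close> by at most
    \<open>2 * \<delta>\<close>. So the gap is below \<open>3 * \<delta> \<le> d\<close>, and
    \<open>J\<close> still has length at least \<open>s / 2\<close>.\<close>
  define \<delta> where "\<delta> = min (s / 4) (d / 3)"
  have \<delta>: "\<delta> > 0" "\<delta> \<le> s / 4" "3 * \<delta> \<le> d" using d(1) \<open>s > 0\<close> by (auto simp: \<delta>_def)
  obtain U where U: "open U" "?E \<subseteq> U" "U - ?E \<in> lmeasurable" "emeasure lebesgue (U - ?E) < ennreal \<delta>"
    by (rule sets_lebesgue_outer_open[OF fmeasurableD[OF E] \<open>\<delta> > 0\<close>]) (rule that)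
  have U_E: "measure lebesgue (U - ?E) < \<delta>"
    using U(3,4) \<delta>(1) by (simp add: emeasure_eq_measure2 ennreal_less_iff)
  obtain I where I: "finite I" "\<forall>(u, v)\<in>I. u < v \<and> (a \<le> u \<and> v \<le> b \<and> {u..v} \<subseteq> U \<and> f v - f u > 0)"
    "pairwise (\<lambda>i j. disjnt {fst i..snd i} {fst j..snd j}) I"
    "measure lebesgue (?E - (\<Union>(u, v)\<in>I. {u..v})) < \<delta>"
  proof (rule vitali_finite_cover[OF E \<open>\<delta> > 0\<close>, of "\<lambda>u v. a \<le> u \<and> v \<le> b \<and> {u..v} \<subseteq> U \<and> f v - f u > 0"])
    fix x e :: real assume x: "x \<in> ?E" and "e > 0"
    from x have as: "arbitrarily_short a b (\<lambda>u v. f v - f u > 0) x" "x \<in> U" using U(2) by auto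
    obtain u v where "a \<le> u" "u < x" "x < v" "v \<le> b" "v - u < e" "f v - f u > 0" "{u..v} \<subseteq> U"
      by (rule arbitrarily_shortD[OF as(1) U(1) as(2) \<open>e > 0\<close>]) (rule that)
    then show "\<exists>u v. u < v \<and> v - u < e \<and> x \<in> {u..v} \<and> a \<le> u \<and> v \<le> b \<and> {u..v} \<subseteq> U \<and> f v - f u > 0"
      by (intro exI[of _ u] exI[of _ v]) auto
  qed (rule that)
  have dI: "disjoint_intervals a b I"
    unfolding disjoint_intervals_def using I by auto
  \<comment> \<open>Only interior points of the intervals in \<open>I\<close> are covered again, so
    that short intervals around them fit inside; the finitely many endpoints form a null
    set.\<close>
  define E' where "E' = ?E \<inter> (\<Union>(u, v)\<in>I. {u<..<v})"
  have E': "E' \<in> lmeasurable"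
    unfolding E'_def by (rule fmeasurable_Int_fmeasurable[OF E]) (auto intro!: sets.finite_UN I(1))
  obtain J where J: "finite J" "\<forall>(u, v)\<in>J. u < v \<and> (a \<le> u \<and> v \<le> b \<and>
      (\<exists>(u', v')\<in>I. {u..v} \<subseteq> {u'..v'}) \<and> f v - f u < - c * (v - u))"
    "pairwise (\<lambda>i j. disjnt {fst i..snd i} {fst j..snd j}) J"
    "measure lebesgue (E' - (\<Union>(u, v)\<in>J. {u..v})) < \<delta>"
  proof (rule vitali_finite_cover[OF E' \<open>\<delta> > 0\<close>, of "\<lambda>u v. a \<le> u \<and> v \<le> b \<and>
      (\<exists>(u', v')\<in>I. {u..v} \<subseteq> {u'..v'}) \<and> f v - f u < - c * (v - u)"])
    fix x e :: real assume x: "x \<in> E'" and "e > 0"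
    then obtain u' v' where uv': "(u', v') \<in> I" "x \<in> {u'<..<v'}" unfolding E'_def by auto
    from x have as: "arbitrarily_short a b (\<lambda>u v. f v - f u < - c * (v - u)) x" by (simp add: E'_def)
    obtain u v where "a \<le> u" "u < x" "x < v" "v \<le> b" "v - u < e" "f v - f u < - c * (v - u)" "{u..v} \<subseteq> {u'<..<v'}"
      by (rule arbitrarily_shortD[OF as open_greaterThanLessThan uv'(2) \<open>e > 0\<close>]) (rule that)
    moreover have "\<exists>(u', v')\<in>I. {u..v} \<subseteq> {u'..v'}"
      using uv'(1) \<open>{u..v} \<subseteq> {u'<..<v'}\<close> by (intro bexI[of _ "(u', v')"]) auto
    ultimately show "\<exists>u v. u < v \<and> v - u < e \<and> x \<in> {u..v} \<and> a \<le> u \<and> v \<le> b \<and>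
      (\<exists>(u', v')\<in>I. {u..v} \<subseteq> {u'..v'}) \<and> f v - f u < - c * (v - u)"
      by (intro exI[of _ u] exI[of _ v]) auto
  qed (rule that)
  have dJ: "disjoint_intervals a b J"
    unfolding disjoint_intervals_def using J by auto
  let ?UI = "\<Union>(u, v)\<in>I. {u..v}" and ?UJ = "\<Union>(u, v)\<in>J. {u..v}"
  have UIm: "?UI \<in> lmeasurable" and UJm: "?UJ \<in> lmeasurable"
    using I(1) J(1) by (auto intro!: fmeasurable.finite_UN simp: case_prod_beta)
  have "measure lebesgue ?UI \<le> measure lebesgue (?E \<union> (U - ?E))"
    using I(2) UIm E U(3) by (intro measure_mono_fmeasurable fmeasurable.Un) (auto simp: fmeasurableD)
  also have "\<dots> \<le> s + measure lebesgue (U - ?E)"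
    unfolding s_def by (intro measure_Un_le fmeasurableD E U(3))
  finally have lI: "(\<Sum>(u, v)\<in>I. v - u) < s + \<delta>"
    using U_E unfolding measure_disjoint_intervals[OF dI] by linarith
  let ?ends = "(\<Union>(u, v)\<in>I. {u, v})"
  have ends: "?ends \<in> lmeasurable" "measure lebesgue ?ends = 0"
    using I(1) by (auto intro!: negligible_imp_measurable negligible_imp_measure0 negligible_finite)
  have cov: "?E \<subseteq> ((?E - ?UI) \<union> (E' - ?UJ)) \<union> (?UJ \<union> ?ends)"
  proof
    fix x assume x: "x \<in> ?E"
    show "x \<in> ((?E - ?UI) \<union> (E' - ?UJ)) \<union> (?UJ \<union> ?ends)"
    proof (cases "x \<in> ?UI")
      case True
      then obtain u v where uv: "(u, v) \<in> I" "x \<in> {u..v}" by auto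
      show ?thesis
      proof (cases "x = u \<or> x = v")
        case True then show ?thesis using uv by auto
      next
        case False
        then have "x \<in> E'" using uv x unfolding E'_def by (auto intro!: bexI[of _ "(u, v)"])
        then show ?thesis by blast
      qed
    qed (use x in blast)
  qed
  have m1: "?E - ?UI \<in> lmeasurable" "E' - ?UJ \<in> lmeasurable"
    using E E' UIm UJm by (auto intro: fmeasurable.Diff)
  have "s \<le> measure lebesgue (((?E - ?UI) \<union> (E' - ?UJ)) \<union> (?UJ \<union> ?ends))"
    unfolding s_def using m1 UJm ends E cov
    by (intro measure_mono_fmeasurable fmeasurable.Un) (auto simp: fmeasurableD)
  also have "\<dots> \<le> measure lebesgue ((?E - ?UI) \<union> (E' - ?UJ)) + measure lebesgue (?UJ \<union> ?ends)"
    using m1 UJm ends by (intro measure_Un_le fmeasurableD fmeasurable.Un)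
  also have "\<dots> \<le> (measure lebesgue (?E - ?UI) + measure lebesgue (E' - ?UJ)) + (measure lebesgue ?UJ + measure lebesgue ?ends)"
    using m1 UJm ends by (intro add_mono measure_Un_le fmeasurableD)
  finally have lJ: "s - 2 * \<delta> \<le> (\<Sum>(u, v)\<in>J. v - u)"
    using I(4) J(4) ends(2) unfolding measure_disjoint_intervals[OF dJ] by linarith
  have sub: "\<forall>(u, v)\<in>J. \<exists>(u', v')\<in>I. {u..v} \<subseteq> {u'..v'}" using J(2) by blast
  have "(\<Sum>(u, v)\<in>I. v - u) - (\<Sum>(u, v)\<in>J. v - u) < d" using lI lJ \<delta> by linarith
  then have "\<bar>(\<Sum>(u, v)\<in>I. f v - f u) - (\<Sum>(u, v)\<in>J. f v - f u)\<bar> < c * s / 2"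
    by (rule d(2)[THEN spec, THEN spec, THEN mp, OF dI, THEN mp, OF dJ, THEN mp, OF sub, THEN mp])
  \<comment> \<open>The increments over \<open>I\<close> have a nonnegative sum, those over
    \<open>J\<close> a sum of at most \<open>- c * s / 2\<close>, so the two sums cannot differ by
    less than \<open>c * s / 2\<close>.\<close>
  moreover have "0 \<le> (\<Sum>(u, v)\<in>I. f v - f u)"
    using I(2) by (intro sum_nonneg) (auto simp: less_imp_le)
  moreover have "(\<Sum>(u, v)\<in>J. f v - f u) \<le> (\<Sum>(u, v)\<in>J. - c * (v - u))"
    using J(2) by (intro sum_mono) (auto simp: less_imp_le)
  moreover have "(\<Sum>(u, v)\<in>J. - c * (v - u)) = - c * (\<Sum>(u, v)\<in>J. v - u)"
    by (simp add: sum_distrib_left case_prod_beta)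
  moreover have "c * (s / 2) \<le> c * (\<Sum>(u, v)\<in>J. v - u)"
    using lJ \<delta> \<open>c > 0\<close> by (intro mult_left_mono) linarith+
  ultimately show False by linarith
qed

text \<open>In a window shorter than \<open>d\<close>, disjoint intervals have total length below
  \<open>d\<close>, so their increments sum to less than \<open>1\<close>. If they have slope above
  \<open>N\<close> and cover half the measure \<open>s\<close> of the set in that window, the sum is
  at least \<open>N * s / 2\<close>. Countably many windows exhaust the set.\<close>

lemma negligible_unbounded_slopes:
  fixes f :: "real \<Rightarrow> real"
  assumes f: "absolutely_continuous_path a b f"
  shows "negligible {x. \<forall>N::nat. arbitrarily_short a b (\<lambda>u v. \<bar>f v - f u\<bar> > real N * (v - u)) x}"
    (is "negligible ?F")
proof -
  obtain d where d: "d > 0" "\<And>D. nonoverlapping a b D \<Longrightarrow> (\<Sum>(u, v)\<in>D. v - u) < d \<Longrightarrow>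
      (\<Sum>(u, v)\<in>D. norm (f v - f u)) < 1"
    using absolutely_continuous_pathD[OF f zero_less_one] by blast
  have Feq: "?F = (\<Inter>N. {x. arbitrarily_short a b (\<lambda>u v. \<bar>f v - f u\<bar> > real N * (v - u)) x})" by auto
  have F: "?F \<in> lmeasurable"
    unfolding Feq
  proof (rule fmeasurableI2[OF lmeasurable_arbitrarily_short])
    show "(\<Inter>N. {x. arbitrarily_short a b (\<lambda>u v. \<bar>f v - f u\<bar> > real N * (v - u)) x}) \<subseteq>
      {x. arbitrarily_short a b (\<lambda>u v. \<bar>f v - f u\<bar> > real 0 * (v - u)) x}" by blast
    show "(\<Inter>N. {x. arbitrarily_short a b (\<lambda>u v. \<bar>f v - f u\<bar> > real N * (v - u)) x}) \<in> sets lebesgue"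
      using lmeasurable_arbitrarily_short by (intro sets.countable_INT) (blast dest: fmeasurableD)+
  qed
  have win: "negligible (?F \<inter> {z<..<z + d / 2})" (is "negligible ?S") for z
  proof (rule ccontr)
    assume neg: "\<not> negligible ?S"
    have S: "?S \<in> lmeasurable" using F by (intro fmeasurable.Int) auto
    define s where "s = measure lebesgue ?S"
    have "s > 0" using neg S negligible_iff_measure[of ?S] by (simp add: s_def zero_less_measure_iff)
    \<comment> \<open>Chosen so that \<open>N * (s / 2)\<close> reaches \<open>1\<close>.\<close>
    obtain N :: nat where N: "2 / s \<le> real N" using real_arch_simple by blast
    have "s / 2 > 0" using \<open>s > 0\<close> by simp
    obtain C where C: "finite C" "\<forall>(u, v)\<in>C. u < v \<and> (a \<le> u \<and> v \<le> b \<and> {u..v} \<subseteq> {z<..<z + d / 2} \<and> \<bar>f v - f u\<bar> > real N * (v - u))"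
      "pairwise (\<lambda>i j. disjnt {fst i..snd i} {fst j..snd j}) C"
      "measure lebesgue (?S - (\<Union>(u, v)\<in>C. {u..v})) < s / 2"
    proof (rule vitali_finite_cover[OF S \<open>s / 2 > 0\<close>, of "\<lambda>u v. a \<le> u \<and> v \<le> b \<and> {u..v} \<subseteq> {z<..<z + d / 2} \<and> \<bar>f v - f u\<bar> > real N * (v - u)"])
      fix x e :: real assume x: "x \<in> ?S" and "e > 0"
      then have as: "arbitrarily_short a b (\<lambda>u v. \<bar>f v - f u\<bar> > real N * (v - u)) x" "x \<in> {z<..<z + d / 2}" by auto
      obtain u v where "a \<le> u" "u < x" "x < v" "v \<le> b" "v - u < e" "\<bar>f v - f u\<bar> > real N * (v - u)" "{u..v} \<subseteq> {z<..<z + d / 2}"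
        by (rule arbitrarily_shortD[OF as(1) open_greaterThanLessThan as(2) \<open>e > 0\<close>]) (rule that)
      then show "\<exists>u v. u < v \<and> v - u < e \<and> x \<in> {u..v} \<and> a \<le> u \<and> v \<le> b \<and> {u..v} \<subseteq> {z<..<z + d / 2} \<and> \<bar>f v - f u\<bar> > real N * (v - u)"
        by (intro exI[of _ u] exI[of _ v]) auto
    qed (rule that)
    have dC: "disjoint_intervals a b C" unfolding disjoint_intervals_def using C by auto
    let ?U = "\<Union>(u, v)\<in>C. {u..v}"
    have Um: "?U \<in> lmeasurable" using C(1) by (auto intro!: fmeasurable.finite_UN simp: case_prod_beta)
    have "measure lebesgue ?U \<le> measure lebesgue {z<..<z + d / 2}"
      using C(2) Um by (intro measure_mono_fmeasurable) (auto simp: fmeasurableD)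
    then have short: "(\<Sum>(u, v)\<in>C. v - u) < d"
      using d(1) unfolding measure_disjoint_intervals[OF dC] by simp
    have "nonoverlapping a b C"
      using dC unfolding nonoverlapping_def disjoint_intervals_def pairwise_def disjnt_def
      by (fastforce simp: less_imp_le)
    then have small: "(\<Sum>(u, v)\<in>C. norm (f v - f u)) < 1" using short by (rule d(2))
    have "s \<le> measure lebesgue ((?S - ?U) \<union> ?U)"
      unfolding s_def using S Um by (intro measure_mono_fmeasurable) (auto simp: fmeasurableD intro: fmeasurable.Un fmeasurable.Diff)
    also have "\<dots> \<le> measure lebesgue (?S - ?U) + measure lebesgue ?U"
      using S Um by (intro measure_Un_le) (auto simp: fmeasurableD)
    finally have "s / 2 \<le> (\<Sum>(u, v)\<in>C. v - u)"
      using C(4) unfolding measure_disjoint_intervals[OF dC] by linarith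
    then have "real N * (s / 2) \<le> real N * (\<Sum>(u, v)\<in>C. v - u)" by (intro mult_left_mono) auto
    also have "\<dots> = (\<Sum>(u, v)\<in>C. real N * (v - u))" by (simp add: sum_distrib_left case_prod_beta)
    also have "\<dots> \<le> (\<Sum>(u, v)\<in>C. norm (f v - f u))"
      using C(2) by (intro sum_mono) (auto simp: less_imp_le)
    finally have "real N * (s / 2) < 1" using small by linarith
    moreover have "1 \<le> real N * (s / 2)" using N \<open>s > 0\<close> by (simp add: field_simps)
    ultimately show False by linarith
  qed
  have "?F \<subseteq> (\<Union>z\<in>\<rat>. ?F \<inter> {z<..<z + d / 2})"
  proof
    fix x assume "x \<in> ?F"
    obtain z where "z \<in> \<rat>" "x - d / 2 < z" "z < x" using Rats_dense_in_real[of "x - d / 2" x] d(1) by auto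
    then show "x \<in> (\<Union>z\<in>\<rat>. ?F \<inter> {z<..<z + d / 2})" using \<open>x \<in> ?F\<close> by (intro UN_I[of z]) auto
  qed
  moreover have "negligible (\<Union>z\<in>\<rat>. ?F \<inter> {z<..<z + d / 2})"
    using win by (intro negligible_countable_Union) (auto intro: countable_rat)
  ultimately show ?thesis by (rule negligible_subset[rotated])
qed

lemma arbitrarily_short_mono:
  assumes "arbitrarily_short a b P x" "\<And>u v. u < v \<Longrightarrow> P u v \<Longrightarrow> Q u v"
  shows "arbitrarily_short a b Q x"
  unfolding arbitrarily_short_def
proof (intro allI impI)
  fix e :: real assume "e > 0"
  then obtain u v where "a \<le> u" "u < x" "x < v" "v \<le> b" "v - u < e" "P u v"
    using assms(1) unfolding arbitrarily_short_def by blast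
  then show "\<exists>u v. a \<le> u \<and> u < x \<and> x < v \<and> v \<le> b \<and> v - u < e \<and> Q u v"
    using assms(2)[of u v] by (intro exI[of _ u] exI[of _ v]) auto
qed

lemma not_arbitrarily_shortD:
  assumes "\<not> arbitrarily_short a b P x"
  obtains e where "e > 0" "\<And>u v. a \<le> u \<Longrightarrow> u < x \<Longrightarrow> x < v \<Longrightarrow> v \<le> b \<Longrightarrow> v - u < e \<Longrightarrow> \<not> P u v"
  using assms unfolding arbitrarily_short_def by blast

text \<open>\<open>A\<close> collects the slopes exceeded on arbitrarily short intervals around
  \<open>x\<close>; the bound \<open>N\<close> makes it nonempty and bounded above. Slopes clearly
  below \<open>L = Sup A\<close> cannot recur, so the slopes over straddling intervals converge to
  \<open>L\<close>, and continuity of \<open>f\<close> lets one endpoint tend to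
  \<open>x\<close>.\<close>

lemma differentiable_if_slopes_converge:
  fixes f :: "real \<Rightarrow> real"
  assumes cont: "continuous_on {a..b} f" and x: "x \<in> {a<..<b}"
    and bdd: "\<not> arbitrarily_short a b (\<lambda>u v. \<bar>f v - f u\<bar> > N * (v - u)) x"
    and conv: "\<And>p q. p \<in> \<rat> \<Longrightarrow> q \<in> \<rat> \<Longrightarrow> p < q \<Longrightarrow>
      arbitrarily_short a b (\<lambda>u v. f v - f u > q * (v - u)) x \<Longrightarrow>
      \<not> arbitrarily_short a b (\<lambda>u v. f v - f u < p * (v - u)) x"
  shows "\<exists>D. (f has_real_derivative D) (at x)"
proof -
  define A where "A = {q. arbitrarily_short a b (\<lambda>u v. f v - f u > q * (v - u)) x}"
  obtain e0 where e0: "e0 > 0" "\<And>u v. a \<le> u \<Longrightarrow> u < x \<Longrightarrow> x < v \<Longrightarrow> v \<le> b \<Longrightarrow> v - u < e0 \<Longrightarrow>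
      \<bar>f v - f u\<bar> \<le> N * (v - u)"
    using not_arbitrarily_shortD[OF bdd] by (metis not_less)
  have ub: "q \<le> N" if q: "q \<in> A" for q
  proof (rule ccontr)
    assume "\<not> q \<le> N"
    obtain u v where uv: "a \<le> u" "u < x" "x < v" "v \<le> b" "v - u < e0" "f v - f u > q * (v - u)"
      using q e0(1) unfolding A_def arbitrarily_short_def by blast
    have "q * (v - u) > N * (v - u)" using \<open>\<not> q \<le> N\<close> uv by (intro mult_strict_right_mono) auto
    then show False using e0(2)[OF uv(1-5)] uv(6) by linarith
  qed
  have mem: "- N - 1 \<in> A"
    unfolding A_def arbitrarily_short_def mem_Collect_eq
  proof (intro allI impI)
    fix e :: real assume "e > 0"
    define h where "h = min (min e e0 / 3) (min (x - a) (b - x))"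
    have h: "h > 0" "2 * h < e" "2 * h < e0" "h \<le> x - a" "h \<le> b - x"
      using \<open>e > 0\<close> e0(1) x by (auto simp: h_def min_def)
    have "\<bar>f (x + h) - f (x - h)\<bar> \<le> N * ((x + h) - (x - h))"
      using h by (intro e0(2)) auto
    moreover have "(- N - 1) * ((x + h) - (x - h)) < - (N * ((x + h) - (x - h)))"
      using h(1) by (simp add: algebra_simps)
    ultimately have "(- N - 1) * ((x + h) - (x - h)) < f (x + h) - f (x - h)" by linarith
    then show "\<exists>u v. a \<le> u \<and> u < x \<and> x < v \<and> v \<le> b \<and> v - u < e \<and> (- N - 1) * (v - u) < f v - f u"
      using h by (intro exI[of _ "x - h"] exI[of _ "x + h"]) auto
  qed
  have bA: "bdd_above A" using ub by (auto simp: bdd_above_def)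
  define L where "L = Sup A"
  have down: "q \<in> A" if "q < L" for q
  proof -
    obtain q' where q': "q' \<in> A" "q < q'" using less_cSupD[of A q] \<open>q < L\<close> mem unfolding L_def by blast
    show ?thesis unfolding A_def mem_Collect_eq
    proof (rule arbitrarily_short_mono)
      show "arbitrarily_short a b (\<lambda>u v. f v - f u > q' * (v - u)) x" using q'(1) by (simp add: A_def)
      fix u v :: real assume "u < v" "f v - f u > q' * (v - u)"
      moreover from this have "q * (v - u) < q' * (v - u)" using q'(2) by simp
      ultimately show "f v - f u > q * (v - u)" by linarith
    qed
  qed
  have slope: "\<exists>e>0. \<forall>u v. a \<le> u \<longrightarrow> u < x \<longrightarrow> x < v \<longrightarrow> v \<le> b \<longrightarrow> v - u < e \<longrightarrow>
      \<bar>f v - f u - L * (v - u)\<bar> \<le> \<eta> * (v - u)" if \<eta>: "\<eta> > 0" for \<eta>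
  proof -
    have "L + \<eta> \<notin> A" using cSup_upper[OF _ bA, of "L + \<eta>"] \<eta> unfolding L_def by auto
    then have "\<not> arbitrarily_short a b (\<lambda>u v. f v - f u > (L + \<eta>) * (v - u)) x" by (simp add: A_def)
    then obtain e1 where e1: "e1 > 0" "\<And>u v. a \<le> u \<Longrightarrow> u < x \<Longrightarrow> x < v \<Longrightarrow> v \<le> b \<Longrightarrow> v - u < e1 \<Longrightarrow>
        \<not> f v - f u > (L + \<eta>) * (v - u)"
      by (rule not_arbitrarily_shortD) blast
    \<comment> \<open>The hypothesis \<open>conv\<close> speaks of rational thresholds: two of them
      are fitted between \<open>L - \<eta>\<close> and \<open>L\<close>.\<close>
    obtain q where q: "q \<in> \<rat>" "L - \<eta> < q" "q < L" using Rats_dense_in_real[of "L - \<eta>" L] \<eta> by auto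
    obtain p where p: "p \<in> \<rat>" "L - \<eta> < p" "p < q" using Rats_dense_in_real[OF q(2)] by auto
    have "\<not> arbitrarily_short a b (\<lambda>u v. f v - f u < p * (v - u)) x"
      using conv[OF p(1) q(1) p(3)] down[OF q(3)] by (simp add: A_def)
    then obtain e2 where e2: "e2 > 0" "\<And>u v. a \<le> u \<Longrightarrow> u < x \<Longrightarrow> x < v \<Longrightarrow> v \<le> b \<Longrightarrow> v - u < e2 \<Longrightarrow>
        \<not> f v - f u < p * (v - u)"
      by (rule not_arbitrarily_shortD) blast
    show ?thesis
    proof (intro exI[of _ "min e1 e2"] conjI allI impI)
      fix u v assume uv: "a \<le> u" "u < x" "x < v" "v \<le> b" "v - u < min e1 e2"
      have "f v - f u \<le> L * (v - u) + \<eta> * (v - u)"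
        using e1(2)[of u v] uv by (simp add: distrib_right not_less)
      moreover have "p * (v - u) \<le> f v - f u" using e2(2)[of u v] uv by (simp add: not_less)
      moreover have "(L - \<eta>) * (v - u) \<le> p * (v - u)" using p(2) uv by (intro mult_right_mono) auto
      ultimately show "\<bar>f v - f u - L * (v - u)\<bar> \<le> \<eta> * (v - u)"
        by (simp add: abs_le_iff left_diff_distrib)
    qed (use e1 e2 in auto)
  qed
  have "isCont f x"
    using continuous_on_interior[OF cont] x by simp
  then have ftl: "(f \<longlongrightarrow> f x) (at_left x)" and ftr: "(f \<longlongrightarrow> f x) (at_right x)"
    unfolding isCont_def by (auto intro: filterlim_mono at_le)
  have "(f has_derivative (\<lambda>h. L * h)) (at x)"
    unfolding has_derivative_at_alt
  proof (intro conjI allI impI)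
    show "bounded_linear (\<lambda>h. L * h)" by (rule bounded_linear_mult_right)
    fix \<eta> :: real assume "\<eta> > 0"
    then obtain e where e: "e > 0" "\<And>u v. a \<le> u \<Longrightarrow> u < x \<Longrightarrow> x < v \<Longrightarrow> v \<le> b \<Longrightarrow> v - u < e \<Longrightarrow>
      \<bar>f v - f u - L * (v - u)\<bar> \<le> \<eta> * (v - u)" using slope by blast
    define h where "h = min (e / 2) (min (x - a) (b - x))"
    have h: "h > 0" "2 * h \<le> e" "h \<le> x - a" "h \<le> b - x"
      using e(1) x by (auto simp: h_def min_def)
    have "norm (f y - f x - L * (y - x)) \<le> \<eta> * norm (y - x)" if y: "norm (y - x) < h" for y
    proof (cases x y rule: linorder_cases)
      case less
      have "((\<lambda>u. \<eta> * (y - u) - \<bar>f y - f u - L * (y - u)\<bar>) \<longlongrightarrow> \<eta> * (y - x) - \<bar>f y - f x - L * (y - x)\<bar>) (at_left x)"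
        by (intro tendsto_intros ftl)
      moreover have "\<forall>\<^sub>F u in at_left x. 0 \<le> \<eta> * (y - u) - \<bar>f y - f u - L * (y - u)\<bar>"
      proof -
        have "\<forall>\<^sub>F u in at_left x. u \<in> {x - h<..<x}" using h(1) by (intro eventually_at_left_real) simp
        then show ?thesis
        proof eventually_elim
          case (elim u)
          then show ?case using e(2)[of u y] less y h by (auto simp: dist_norm)
        qed
      qed
      ultimately have "0 \<le> \<eta> * (y - x) - \<bar>f y - f x - L * (y - x)\<bar>"
        by (rule tendsto_lowerbound) simp
      then show ?thesis using less by simp
    next
      case equal then show ?thesis by simp
    next
      case greater
      have "((\<lambda>v. \<eta> * (v - y) - \<bar>f v - f y - L * (v - y)\<bar>) \<longlongrightarrow> \<eta> * (x - y) - \<bar>f x - f y - L * (x - y)\<bar>) (at_right x)"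
        by (intro tendsto_intros ftr)
      moreover have "\<forall>\<^sub>F v in at_right x. 0 \<le> \<eta> * (v - y) - \<bar>f v - f y - L * (v - y)\<bar>"
      proof -
        have "\<forall>\<^sub>F v in at_right x. v \<in> {x<..<x + h}" using h(1) by (intro eventually_at_right_real) simp
        then show ?thesis
        proof eventually_elim
          case (elim v)
          then show ?case using e(2)[of y v] greater y h by (auto simp: dist_norm)
        qed
      qed
      ultimately have "0 \<le> \<eta> * (x - y) - \<bar>f x - f y - L * (x - y)\<bar>"
        by (rule tendsto_lowerbound) simp
      moreover have "\<bar>f x - f y - L * (x - y)\<bar> = \<bar>f y - f x - L * (y - x)\<bar>"
        by (simp add: abs_minus_commute[of "f y - f x"] algebra_simps)
      ultimately show ?thesis using greater by simp
    qed
    then show "\<exists>d>0. \<forall>y. norm (y - x) < d \<longrightarrow> norm (f y - f x - L * (y - x)) \<le> \<eta> * norm (y - x)"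
      using h(1) by blast
  qed
  then show ?thesis unfolding has_field_derivative_def by blast
qed

text \<open>Where no derivative exists, slopes over short intervals are either unbounded or, for
  some rationals \<open>p < q\<close>, both exceed \<open>q\<close> and fall below \<open>p\<close>
  again and again. Each case is a null set, and there are countably many of them.\<close>

lemma absolutely_continuous_path_AE_differentiable_real:
  fixes f :: "real \<Rightarrow> real"
  assumes f: "absolutely_continuous_path a b f" and "a \<le> b"
  shows "negligible {x \<in> {a<..<b}. \<not> (\<exists>D. (f has_real_derivative D) (at x))}"
proof -
  let ?F = "{x. \<forall>N::nat. arbitrarily_short a b (\<lambda>u v. \<bar>f v - f u\<bar> > real N * (v - u)) x}"
  let ?E = "\<lambda>(p, q). {x. arbitrarily_short a b (\<lambda>u v. f v - f u > q * (v - u)) x} \<inter>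
      {x. arbitrarily_short a b (\<lambda>u v. f v - f u < p * (v - u)) x}"
  let ?I = "{(p, q). p \<in> \<rat> \<and> q \<in> \<rat> \<and> p < q} :: (real \<times> real) set"
  have E: "negligible (?E i)" if i: "i \<in> ?I" for i
  proof -
    obtain p q where pq: "i = (p, q)" "p < q" using i by auto
    \<comment> \<open>Subtracting \<open>q * x\<close> moves the upper threshold to slope
      \<open>0\<close> and the lower one to \<open>- (q - p)\<close>.\<close>
    define g where "g x = f x - q * x" for x
    have "absolutely_continuous_path a b g"
    proof (rule absolutely_continuous_path_dominated[OF f absolutely_continuous_path_ident])
      fix u v :: real
      have "norm (g v - g u) = \<bar>(f v - f u) - q * (v - u)\<bar>" by (simp add: g_def algebra_simps)
      also have "\<dots> \<le> \<bar>f v - f u\<bar> + \<bar>q\<bar> * \<bar>v - u\<bar>" unfolding abs_mult[symmetric] by (rule abs_triangle_ineq4)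
      also have "\<dots> \<le> (1 + \<bar>q\<bar>) * (norm (f v - f u) + norm (v - u))"
        by (simp add: algebra_simps)
      finally show "norm (g v - g u) \<le> (1 + \<bar>q\<bar>) * (norm (f v - f u) + norm (v - u))" .
    qed
    from negligible_conflicting_slopes[OF this \<open>a \<le> b\<close>, of "q - p"] pq(2)
    show ?thesis unfolding pq(1) g_def by (simp add: algebra_simps)
  qed
  have sub: "{x \<in> {a<..<b}. \<not> (\<exists>D. (f has_real_derivative D) (at x))} \<subseteq> ?F \<union> (\<Union>i\<in>?I. ?E i)"
  proof (rule subsetI, rule ccontr)
    fix x assume x: "x \<in> {x \<in> {a<..<b}. \<not> (\<exists>D. (f has_real_derivative D) (at x))}"
      and nx: "x \<notin> ?F \<union> (\<Union>i\<in>?I. ?E i)"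
    then obtain N :: nat where N: "\<not> arbitrarily_short a b (\<lambda>u v. \<bar>f v - f u\<bar> > real N * (v - u)) x" by auto
    have "\<exists>D. (f has_real_derivative D) (at x)"
    proof (rule differentiable_if_slopes_converge[OF absolutely_continuous_path_continuous_on[OF f] _ N])
      show "x \<in> {a<..<b}" using x by simp
      fix p q :: real assume "p \<in> \<rat>" "q \<in> \<rat>" "p < q" "arbitrarily_short a b (\<lambda>u v. f v - f u > q * (v - u)) x"
      then show "\<not> arbitrarily_short a b (\<lambda>u v. f v - f u < p * (v - u)) x" using nx by auto
    qed
    then show False using x by simp
  qed
  have neg: "negligible (\<Union>i\<in>?I. ?E i)"
  proof (rule negligible_countable_Union)
    have "countable (\<rat> \<times> \<rat> :: (real \<times> real) set)" by (intro countable_SIGMA countable_rat)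
    then have "countable ?I" by (rule countable_subset[rotated]) auto
    then show "countable (?E ` ?I)" by (rule countable_image)
  qed (use E in blast)
  show ?thesis
    by (rule negligible_subset[OF negligible_Un[OF negligible_unbounded_slopes[OF f] neg] sub])
qed

theorem absolutely_continuous_path_AE_differentiable:
  fixes \<phi> :: "real \<Rightarrow> 'a::euclidean_space"
  assumes \<phi>: "absolutely_continuous_path a b \<phi>" and "a \<le> b"
  shows "negligible {x \<in> {a..b}. \<not> (\<exists>D. (\<phi> has_vector_derivative D) (at x within {a..b}))}"
proof -
  let ?N = "\<lambda>i. {x \<in> {a<..<b}. \<not> (\<exists>D. ((\<lambda>t. \<phi> t \<bullet> i) has_real_derivative D) (at x))}"
  have "negligible (?N i)" for i
  proof (rule absolutely_continuous_path_AE_differentiable_real[OF _ \<open>a \<le> b\<close>])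
    show "absolutely_continuous_path a b (\<lambda>t. \<phi> t \<bullet> i)"
    proof (rule absolutely_continuous_path_dominated[OF \<phi> \<phi>])
      fix u v :: real
      have "norm (\<phi> v \<bullet> i - \<phi> u \<bullet> i) \<le> norm (\<phi> v - \<phi> u) * norm i"
        unfolding inner_diff_left[symmetric] real_norm_def by (rule Cauchy_Schwarz_ineq2)
      then show "norm (\<phi> v \<bullet> i - \<phi> u \<bullet> i) \<le> norm i * (norm (\<phi> v - \<phi> u) + norm (\<phi> v - \<phi> u))"
        by (simp add: algebra_simps add_increasing2)
    qed
  qed
  then have "negligible (\<Union>i\<in>Basis. ?N i)"
    by (intro negligible_Union) auto
  then have "negligible ((\<Union>i\<in>Basis. ?N i) \<union> {a, b})"
    by (rule negligible_Un) (simp add: negligible_finite)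
  moreover have "{x \<in> {a..b}. \<not> (\<exists>D. (\<phi> has_vector_derivative D) (at x within {a..b}))} \<subseteq> (\<Union>i\<in>Basis. ?N i) \<union> {a, b}"
  proof (rule subsetI, rule ccontr)
    fix x assume x: "x \<in> {x \<in> {a..b}. \<not> (\<exists>D. (\<phi> has_vector_derivative D) (at x within {a..b}))}"
      and "x \<notin> (\<Union>i\<in>Basis. ?N i) \<union> {a, b}"
    then have "\<forall>i\<in>Basis. \<exists>D. ((\<lambda>t. \<phi> t \<bullet> i) has_real_derivative D) (at x)" by force
    then obtain D where D: "\<And>i. i \<in> Basis \<Longrightarrow> ((\<lambda>t. \<phi> t \<bullet> i) has_real_derivative D i) (at x)" by metis
    have "(\<phi> has_derivative (\<lambda>h. h *\<^sub>R (\<Sum>i\<in>Basis. D i *\<^sub>R i))) (at x)"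
    proof (rule has_derivative_componentwise_within[THEN iffD2], rule ballI)
      fix i :: 'a assume i: "i \<in> Basis"
      have "(\<Sum>i\<in>Basis. D i *\<^sub>R i) \<bullet> i = D i" using i by (rule inner_sum_left_Basis)
      then have "(\<lambda>h. (h *\<^sub>R (\<Sum>i\<in>Basis. D i *\<^sub>R i)) \<bullet> i) = (*) (D i)"
        unfolding inner_scaleR_left by (simp only: mult.commute[of _ "D i"])
      then show "((\<lambda>t. \<phi> t \<bullet> i) has_derivative (\<lambda>h. (h *\<^sub>R (\<Sum>i\<in>Basis. D i *\<^sub>R i)) \<bullet> i)) (at x)"
        using D[OF i] by (simp add: has_field_derivative_def)
    qed
    then have "(\<phi> has_vector_derivative (\<Sum>i\<in>Basis. D i *\<^sub>R i)) (at x within {a..b})"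
      unfolding has_vector_derivative_def by (rule has_derivative_at_withinI)
    then show False using x by blast
  qed
  ultimately show ?thesis by (rule negligible_subset)
qed

section \<open>The fundamental theorem of calculus for absolutely continuous paths\<close>

text \<open>Riemann sums are estimated directly with a gauge. Off \<open>N\<close> differentiability
  controls each interval. On \<open>N\<close> the integrand is set to \<open>0\<close>, and the
  gauge confines the intervals to an open set of measure below \<open>d\<close>, where absolute
  continuity bounds the increments.\<close>

theorem absolutely_continuous_path_has_integral:
  fixes \<phi> :: "real \<Rightarrow> 'a::euclidean_space"
  assumes \<phi>: "absolutely_continuous_path a b \<phi>" and "a \<le> b" and N: "negligible N"
    and deriv: "\<And>x. x \<in> {a..b} - N \<Longrightarrow> (\<phi> has_vector_derivative g x) (at x within {a..b})"
  shows "(g has_integral (\<phi> b - \<phi> a)) {a..b}"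
proof -
  define g' where "g' x = (if x \<in> N then 0 else g x)" for x
  have "(g' has_integral (\<phi> b - \<phi> a)) {a..b}"
    unfolding has_integral_real
  proof (intro allI impI)
    fix e :: real assume "e > 0"
    then have "e / 2 > 0" by simp
    then obtain d where d: "d > 0" "\<And>D. nonoverlapping a b D \<Longrightarrow> (\<Sum>(u, v)\<in>D. v - u) < d \<Longrightarrow>
        (\<Sum>(u, v)\<in>D. norm (\<phi> v - \<phi> u)) < e / 2"
      using absolutely_continuous_pathD[OF \<phi>] by blast
    \<comment> \<open>The summand \<open>1\<close> guards against \<open>a = b\<close>.\<close>
    define e1 where "e1 = e / 2 / (b - a + 1)"
    have e1: "e1 > 0" "e1 * (b - a) \<le> e / 2"
      using \<open>e > 0\<close> \<open>a \<le> b\<close> by (auto simp: e1_def field_simps)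
    have "N \<in> sets lebesgue" using N by (simp add: negligible_imp_sets)
    then obtain U where U: "open U" "N \<subseteq> U" "U - N \<in> lmeasurable" "emeasure lebesgue (U - N) < ennreal d"
      by (rule sets_lebesgue_outer_open[OF _ d(1)]) (rule that)
    have UN: "U = N \<union> (U - N)" using U(2) by blast
    have Um: "U \<in> lmeasurable"
      by (subst UN, intro fmeasurable.Un U(3)) (use N in \<open>simp add: negligible_iff_measure\<close>)
    have Ud: "measure lebesgue U < d"
    proof -
      have "measure lebesgue U \<le> measure lebesgue N + measure lebesgue (U - N)"
        by (subst UN, intro measure_Un_le) (use \<open>N \<in> sets lebesgue\<close> U(3) in auto)
      also have "\<dots> < d" using N U(3,4) d(1)
        by (simp add: negligible_imp_measure0 emeasure_eq_measure2 ennreal_less_iff)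
      finally show ?thesis .
    qed
    have "\<exists>\<delta>>0. \<forall>y\<in>{a..b}. norm (y - x) < \<delta> \<longrightarrow> norm (\<phi> y - \<phi> x - (y - x) *\<^sub>R g x) \<le> e1 * norm (y - x)"
      if x: "x \<in> {a..b} - N" for x
      using deriv[OF x] e1(1) unfolding has_vector_derivative_def has_derivative_within_alt by blast
    then obtain \<delta> where \<delta>: "\<And>x. x \<in> {a..b} - N \<Longrightarrow> \<delta> x > 0"
      "\<And>x y. x \<in> {a..b} - N \<Longrightarrow> y \<in> {a..b} \<Longrightarrow> norm (y - x) < \<delta> x \<Longrightarrow>
        norm (\<phi> y - \<phi> x - (y - x) *\<^sub>R g x) \<le> e1 * norm (y - x)"
      by metis
    define \<gamma> where "\<gamma> x = (if x \<in> N then U else if x \<in> {a..b} then ball x (\<delta> x) else ball x 1)" for x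
    have gauge: "gauge \<gamma>"
      unfolding gauge_def \<gamma>_def using U(1,2) \<delta>(1) by auto
    have est: "norm ((\<Sum>(x, K)\<in>p. measure lborel K *\<^sub>R g' x) - (\<phi> b - \<phi> a)) < e"
      if p: "p tagged_division_of {a..b}" and fine: "\<gamma> fine p" for p
    proof -
      note pD = tagged_division_ofD[OF p]
      define q where "q = {(x, K) \<in> p. x \<in> N}"
      let ?t = "\<lambda>(x, K). measure lborel K *\<^sub>R g' x - (\<phi> (Sup K) - \<phi> (Inf K))"
      have fin: "finite p" "finite q" "q \<subseteq> p" using pD(1) by (auto simp: q_def intro: finite_subset)
      have iv: "\<exists>u v. K = {u..v} \<and> u \<le> x \<and> x \<le> v \<and> a \<le> u \<and> v \<le> b" if xK: "(x, K) \<in> p" for x K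
      proof -
        obtain u v where uv: "K = {u..v}" using pD(4)[OF xK] by auto
        then show ?thesis using pD(2,3)[OF xK] by (intro exI[of _ u] exI[of _ v]) auto
      qed
      have "(\<Sum>(x, K)\<in>p. measure lborel K *\<^sub>R g' x) - (\<phi> b - \<phi> a) = (\<Sum>i\<in>p. ?t i)"
        unfolding additive_tagged_division_1[OF \<open>a \<le> b\<close> p, of \<phi>, symmetric] sum_subtractf[symmetric]
        by (intro sum.cong) auto
      also have "norm \<dots> \<le> (\<Sum>i\<in>p. norm (?t i))" by (rule norm_sum)
      also have "\<dots> = (\<Sum>i\<in>p - q. norm (?t i)) + (\<Sum>i\<in>q. norm (?t i))"
        by (rule sum.subset_diff[OF fin(3,1)])
      also have "(\<Sum>i\<in>p - q. norm (?t i)) \<le> (\<Sum>(x, K)\<in>p - q. e1 * measure lborel K)"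
      proof (intro sum_mono, clarify)
        fix x K assume "(x, K) \<in> p" "(x, K) \<notin> q"
        then obtain u v where K: "K = {u..v}" "u \<le> x" "x \<le> v" "a \<le> u" "v \<le> b" using iv by blast
        have x: "x \<in> {a..b} - N" using K \<open>(x, K) \<in> p\<close> \<open>(x, K) \<notin> q\<close> by (auto simp: q_def)
        have "K \<subseteq> ball x (\<delta> x)" using fine \<open>(x, K) \<in> p\<close> x unfolding fine_def \<gamma>_def by fastforce
        moreover have "v \<in> K" "u \<in> K" using K by auto
        ultimately have "v \<in> ball x (\<delta> x)" "u \<in> ball x (\<delta> x)" by blast+
        then have "norm (v - x) < \<delta> x" "norm (u - x) < \<delta> x"
          by (simp_all add: dist_norm norm_minus_commute)
        moreover have "u \<in> {a..b}" "v \<in> {a..b}" using K by auto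
        ultimately have bounds: "norm (\<phi> v - \<phi> x - (v - x) *\<^sub>R g x) \<le> e1 * norm (v - x)"
          "norm (\<phi> u - \<phi> x - (u - x) *\<^sub>R g x) \<le> e1 * norm (u - x)"
          using \<delta>(2)[OF x] by blast+
        have eq: "(v - u) *\<^sub>R g x - (\<phi> v - \<phi> u) =
           (\<phi> u - \<phi> x - (u - x) *\<^sub>R g x) - (\<phi> v - \<phi> x - (v - x) *\<^sub>R g x)" by (simp add: algebra_simps)
        have "norm ((v - u) *\<^sub>R g x - (\<phi> v - \<phi> u)) \<le> e1 * norm (u - x) + e1 * norm (v - x)"
          unfolding eq using norm_triangle_ineq4 add_mono[OF bounds(2,1)] by (rule order_trans)
        also have "\<dots> = e1 * (v - u)" using K by (simp add: algebra_simps)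
        finally show "norm (measure lborel K *\<^sub>R g' x - (\<phi> (Sup K) - \<phi> (Inf K))) \<le> e1 * measure lborel K"
          using K x by (simp add: g'_def)
      qed
      also have "(\<Sum>(x, K)\<in>p - q. e1 * measure lborel K) \<le> (\<Sum>(x, K)\<in>p. e1 * measure lborel K)"
        using e1(1) by (intro sum_mono2 fin) auto
      also have "\<dots> = e1 * (b - a)"
        using additive_content_tagged_division[of p a b] p \<open>a \<le> b\<close> by (simp add: case_prod_beta flip: sum_distrib_left)
      also note e1(2)
      also have "(\<Sum>i\<in>q. norm (?t i)) < e / 2"
      proof -
        let ?h = "\<lambda>(x :: real, K). (Inf K, Sup K) :: real \<times> real"
        let ?D = "?h ` q"
        \<comment> \<open>Passing from tagged intervals to pairs of endpoints identifies two members
          only if the interval is degenerate, and then the summands are \<open>0\<close>.\<close>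
        have deg: "Inf K1 = Sup K1" if "(x1, K1) \<in> q" "(x2, K2) \<in> q" "(x1, K1) \<noteq> (x2, K2)" "?h (x1, K1) = ?h (x2, K2)"
          for x1 K1 x2 K2
        proof -
          have m: "(x1, K1) \<in> p" "(x2, K2) \<in> p" using that(1,2) fin(3) by auto
          have "interior K1 \<inter> interior K2 = {}" by (rule pD(5)[OF m that(3)])
          moreover have "K1 = K2" using iv[OF m(1)] iv[OF m(2)] that(4) by auto
          ultimately have "interior K1 = {}" by simp
          then show ?thesis using iv[OF m(1)] by (auto simp: interior_atLeastAtMost_real)
        qed
        have reindex: "(\<Sum>(u, v)\<in>?D. r u v) = (\<Sum>(x, K)\<in>q. r (Inf K) (Sup K))"
          if r: "\<And>u. r u u = 0" for r :: "real \<Rightarrow> real \<Rightarrow> real"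
        proof (subst sum.reindex_nontrivial[OF fin(2)])
          fix i j assume ij: "i \<in> q" "j \<in> q" "i \<noteq> j" "?h i = ?h j"
          then have "Inf (snd i) = Sup (snd i)" using deg[of "fst i" "snd i" "fst j" "snd j"] by simp
          then show "(case ?h i of (u, v) \<Rightarrow> r u v) = 0" using r by (simp add: case_prod_beta)
        qed (simp add: comp_def case_prod_beta)
        have noD: "nonoverlapping a b ?D"
          unfolding nonoverlapping_def
        proof (intro conjI)
          show "finite ?D" using fin by simp
          show "\<forall>(u, v)\<in>?D. a \<le> u \<and> u \<le> v \<and> v \<le> b"
          proof clarify
            fix x K assume "(x, K) \<in> q"
            then have "(x, K) \<in> p" using fin(3) by blast
            then show "a \<le> Inf K \<and> Inf K \<le> Sup K \<and> Sup K \<le> b" using iv[of x K] by auto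
          qed
          show "pairwise (\<lambda>I J. {fst I<..<snd I} \<inter> {fst J<..<snd J} = {}) ?D"
          proof (rule pairwiseI)
            fix I J assume "I \<in> ?D" "J \<in> ?D" "I \<noteq> J"
            then obtain x1 K1 x2 K2 where K: "(x1, K1) \<in> q" "(x2, K2) \<in> q" "I = (Inf K1, Sup K1)" "J = (Inf K2, Sup K2)"
              by auto
            have m: "(x1, K1) \<in> p" "(x2, K2) \<in> p" using K(1,2) fin(3) by auto
            have "interior K1 \<inter> interior K2 = {}" using K \<open>I \<noteq> J\<close> by (intro pD(5)[OF m]) auto
            moreover have "interior K1 = {fst I<..<snd I}" "interior K2 = {fst J<..<snd J}"
              using iv[OF m(1)] iv[OF m(2)] K(3,4) by (auto simp: interior_atLeastAtMost_real)
            ultimately show "{fst I<..<snd I} \<inter> {fst J<..<snd J} = {}" by simp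
          qed
        qed
        have "(\<Sum>(u, v)\<in>?D. v - u) = (\<Sum>i\<in>?D. measure lebesgue {fst i<..<snd i})"
          using noD unfolding nonoverlapping_def by (intro sum.cong) (auto simp: case_prod_beta)
        also have "\<dots> = measure lebesgue (\<Union>i\<in>?D. {fst i<..<snd i})"
          using noD unfolding nonoverlapping_def
          by (intro measure_UNION'[symmetric]) (auto simp: disjnt_def)
        also have "\<dots> \<le> measure lebesgue U"
        proof (rule measure_mono_fmeasurable[OF _ _ Um])
          show "(\<Union>i\<in>?D. {fst i<..<snd i}) \<subseteq> U"
          proof (rule UN_least)
            fix i assume "i \<in> ?D"
            then obtain x K where K: "(x, K) \<in> q" "i = (Inf K, Sup K)" by auto
            then have m: "(x, K) \<in> p" "x \<in> N" by (auto simp: q_def)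
            have "K \<subseteq> U" using fine m unfolding fine_def \<gamma>_def by fastforce
            then show "{fst i<..<snd i} \<subseteq> U" using iv[OF m(1)] K(2) by auto
          qed
        qed (auto intro!: sets.finite_UN fin)
        finally have "(\<Sum>(u, v)\<in>?D. v - u) < d" using Ud by simp
        then have "(\<Sum>(u, v)\<in>?D. norm (\<phi> v - \<phi> u)) < e / 2" by (rule d(2)[OF noD])
        moreover have "(\<Sum>i\<in>q. norm (?t i)) = (\<Sum>(x, K)\<in>q. norm (\<phi> (Sup K) - \<phi> (Inf K)))"
          by (intro sum.cong) (auto simp: q_def g'_def norm_minus_commute)
        ultimately show ?thesis using reindex[of "\<lambda>u v. norm (\<phi> v - \<phi> u)"] by simp
      qed
      finally show ?thesis by simp
    qed
    show "\<exists>\<gamma>. gauge \<gamma> \<and> (\<forall>p. p tagged_division_of {a..b} \<and> \<gamma> fine p \<longrightarrow>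
        norm ((\<Sum>(x, K)\<in>p. measure lborel K *\<^sub>R g' x) - (\<phi> b - \<phi> a)) < e)"
    proof (intro exI[of _ \<gamma>] conjI allI impI gauge)
      fix p assume "p tagged_division_of {a..b} \<and> \<gamma> fine p"
      then show "norm ((\<Sum>(x, K)\<in>p. measure lborel K *\<^sub>R g' x) - (\<phi> b - \<phi> a)) < e"
        by (intro est) simp_all
    qed
  qed
  then show ?thesis
    by (rule has_integral_spike[OF N, rotated]) (simp add: g'_def)
qed

section \<open>The Cameron--Martin space\<close>

lemma absolutely_continuous_path_subinterval:
  assumes "absolutely_continuous_path a b \<phi>" "a \<le> s" "t \<le> b"
  shows "absolutely_continuous_path s t \<phi>"
proof -
  have "nonoverlapping a b D" if "nonoverlapping s t D" for D
    using that assms(2,3) unfolding nonoverlapping_def by fastforce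
  then show ?thesis
    using assms(1) unfolding absolutely_continuous_path_iff by meson
qed

lemma path_deriv_eqI:
  fixes \<phi> :: "real \<Rightarrow> 'a::euclidean_space"
  assumes "T > 0" "t \<in> {0..T}" "(\<phi> has_vector_derivative D) (at t within {0..T})"
  shows "path_deriv T \<phi> t = D"
  unfolding path_deriv_def by (rule vector_derivative_within_closed_interval[OF assms])

lemma has_vector_derivative_path_deriv:
  fixes \<phi> :: "real \<Rightarrow> 'a::euclidean_space"
  assumes "absolutely_continuous_path 0 T \<phi>" "T > 0"
  obtains N where "negligible N"
    "\<forall>t\<in>{0..T} - N. (\<phi> has_vector_derivative path_deriv T \<phi> t) (at t within {0..T})"
proof
  let ?N = "{x \<in> {0..T}. \<not> (\<exists>D. (\<phi> has_vector_derivative D) (at x within {0..T}))}"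
  show "negligible ?N"
    using absolutely_continuous_path_AE_differentiable[OF assms(1)] assms(2) by simp
  show "\<forall>t\<in>{0..T} - ?N. (\<phi> has_vector_derivative path_deriv T \<phi> t) (at t within {0..T})"
  proof
    fix t assume t: "t \<in> {0..T} - ?N"
    then obtain D where D: "(\<phi> has_vector_derivative D) (at t within {0..T})" by blast
    have "path_deriv T \<phi> t = D" by (rule path_deriv_eqI[OF assms(2) _ D]) (use t in simp)
    with D show "(\<phi> has_vector_derivative path_deriv T \<phi> t) (at t within {0..T})" by simp
  qed
qed

lemma has_integral_path_deriv:
  fixes \<phi> :: "real \<Rightarrow> 'a::euclidean_space"
  assumes \<phi>: "absolutely_continuous_path 0 T \<phi>" and "T > 0" and st: "0 \<le> s" "s \<le> t" "t \<le> T"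
  shows "(path_deriv T \<phi> has_integral (\<phi> t - \<phi> s)) {s..t}"
proof -
  obtain N where N: "negligible N"
    "\<forall>t\<in>{0..T} - N. (\<phi> has_vector_derivative path_deriv T \<phi> t) (at t within {0..T})"
    by (rule has_vector_derivative_path_deriv[OF \<phi> \<open>T > 0\<close>]) (rule that)
  show ?thesis
  proof (rule absolutely_continuous_path_has_integral[OF _ st(2) N(1)])
    show "absolutely_continuous_path s t \<phi>"
      by (rule absolutely_continuous_path_subinterval[OF \<phi> st(1,3)])
    fix x assume x: "x \<in> {s..t} - N"
    then have "(\<phi> has_vector_derivative path_deriv T \<phi> x) (at x within {0..T})"
      using N(2) st by auto
    then show "(\<phi> has_vector_derivative path_deriv T \<phi> x) (at x within {s..t})"
      by (rule has_vector_derivative_within_subset) (use st in auto)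
  qed
qed

section \<open>Energy of a path and of its dyadic interpolants\<close>

definition path_energy :: "real \<Rightarrow> (real \<Rightarrow> 'a::euclidean_space) \<Rightarrow> real" where
  "path_energy T \<phi> = (LINT t:{0..T}|lebesgue. (norm (path_deriv T \<phi> t))\<^sup>2)"

lemma cameron_martinD:
  assumes "\<phi> \<in> cameron_martin T"
  shows "absolutely_continuous_path 0 T \<phi>" "set_borel_measurable lebesgue {0..T} (path_deriv T \<phi>)"
    "set_integrable lebesgue {0..T} (\<lambda>t. (norm (path_deriv T \<phi> t))\<^sup>2)"
    "continuous_on {0..T} \<phi>"
  using assms absolutely_continuous_path_continuous_on
  by (auto simp: cameron_martin_def square_integrable_on_def)

text \<open>Cauchy--Schwarz, obtained by integrating
  \<open>(norm (path_deriv T \<phi> x - c))\<^sup>2 \<ge> 0\<close> with \<open>c\<close> the mean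
  slope over \<open>[s, t]\<close>.\<close>

lemma square_increment_le_energy:
  fixes \<phi> :: "real \<Rightarrow> 'a::euclidean_space"
  assumes \<phi>: "\<phi> \<in> cameron_martin T" and "T > 0" and st: "0 \<le> s" "s < t" "t \<le> T"
  shows "(norm (\<phi> t - \<phi> s))\<^sup>2 / (t - s) \<le> integral {s..t} (\<lambda>x. (norm (path_deriv T \<phi> x))\<^sup>2)"
proof -
  let ?p = "path_deriv T \<phi>"
  define c where "c = (1 / (t - s)) *\<^sub>R (\<phi> t - \<phi> s)"
  have p: "(?p has_integral (\<phi> t - \<phi> s)) {s..t}"
    by (rule has_integral_path_deriv) (use cameron_martinD[OF \<phi>] \<open>T > 0\<close> st in auto)
  have "(\<lambda>x. (norm (?p x))\<^sup>2) integrable_on {0..T}"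
    by (rule set_lebesgue_integral_eq_integral(1)[OF cameron_martinD(3)[OF \<phi>]])
  then have "(\<lambda>x. (norm (?p x))\<^sup>2) integrable_on {s..t}"
    by (rule integrable_subinterval_real) (use st in auto)
  then have sq: "((\<lambda>x. (norm (?p x))\<^sup>2) has_integral integral {s..t} (\<lambda>x. (norm (?p x))\<^sup>2)) {s..t}"
    by (rule integrable_integral)
  have lin: "((\<lambda>x. c \<bullet> ?p x) has_integral (c \<bullet> (\<phi> t - \<phi> s))) {s..t}"
    using has_integral_linear[OF p bounded_linear_inner_right[of c]] by (simp add: comp_def)
  have const: "((\<lambda>x. (norm c)\<^sup>2) has_integral ((t - s) * (norm c)\<^sup>2)) {s..t}"
    using has_integral_const_real[of "(norm c)\<^sup>2" s t] st by simp
  have "((\<lambda>x. (norm (?p x))\<^sup>2 - 2 * (c \<bullet> ?p x) + (norm c)\<^sup>2) has_integral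
     (integral {s..t} (\<lambda>x. (norm (?p x))\<^sup>2) - 2 * (c \<bullet> (\<phi> t - \<phi> s)) + (t - s) * (norm c)\<^sup>2)) {s..t}"
    by (intro has_integral_add has_integral_diff sq const has_integral_mult_right lin)
  moreover have "0 \<le> (norm (?p x))\<^sup>2 - 2 * (c \<bullet> ?p x) + (norm c)\<^sup>2" for x
  proof -
    have "(norm (?p x - c))\<^sup>2 = (norm (?p x))\<^sup>2 - 2 * (c \<bullet> ?p x) + (norm c)\<^sup>2"
      by (simp add: power2_norm_eq_inner inner_diff inner_commute)
    then show ?thesis by (metis zero_le_power2)
  qed
  ultimately have "0 \<le> integral {s..t} (\<lambda>x. (norm (?p x))\<^sup>2) - 2 * (c \<bullet> (\<phi> t - \<phi> s)) + (t - s) * (norm c)\<^sup>2"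
    by (rule has_integral_nonneg)
  moreover have "c \<bullet> (\<phi> t - \<phi> s) = (norm (\<phi> t - \<phi> s))\<^sup>2 / (t - s)"
    by (simp add: c_def power2_norm_eq_inner)
  moreover have "(t - s) * (norm c)\<^sup>2 = (norm (\<phi> t - \<phi> s))\<^sup>2 / (t - s)"
    using st by (simp add: c_def power_divide power2_eq_square)
  ultimately show ?thesis by simp
qed

lemma dyadic_energy_le_path_energy:
  fixes \<phi> :: "real \<Rightarrow> 'a::euclidean_space"
  assumes \<phi>: "\<phi> \<in> cameron_martin T" and "T > 0"
  shows "dyadic_energy T K \<phi> \<le> path_energy T \<phi>"
proof -
  let ?e = "\<lambda>x. (norm (path_deriv T \<phi> x))\<^sup>2"
  let ?t = "\<lambda>i. T * real i / 2 ^ K"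
  have int: "?e integrable_on {0..T}"
    by (rule set_lebesgue_integral_eq_integral(1)[OF cameron_martinD(3)[OF \<phi>]])
  have t_le: "?t i \<le> T" if "i \<le> 2 ^ K" for i
  proof -
    have "real i \<le> 2 ^ K" using that by (metis of_nat_le_iff of_nat_numeral of_nat_power)
    then show ?thesis using \<open>T > 0\<close> by (simp add: divide_le_eq)
  qed
  have step: "?t i < ?t (Suc i)" for i
    using \<open>T > 0\<close> by (intro divide_strict_right_mono mult_strict_left_mono) auto
  have sum: "(\<Sum>i<n. integral {?t i..?t (Suc i)} ?e) = integral {0..?t n} ?e" if "n \<le> 2 ^ K" for n
    using that
  proof (induction n)
    case (Suc n)
    have "?e integrable_on {0..?t (Suc n)}"
      using t_le[of "Suc n"] Suc.prems by (intro integrable_subinterval_real[OF int]) auto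
    then have "integral {0..?t n} ?e + integral {?t n..?t (Suc n)} ?e = integral {0..?t (Suc n)} ?e"
      using step[of n] \<open>T > 0\<close> by (intro Henstock_Kurzweil_Integration.integral_combine) (auto simp del: of_nat_Suc)
    then show ?case using Suc by simp
  qed simp
  have "dyadic_energy T K \<phi> = (\<Sum>i<2 ^ K. (norm (\<phi> (?t (Suc i)) - \<phi> (?t i)))\<^sup>2 / (?t (Suc i) - ?t i))"
    unfolding dyadic_energy_def sum_divide_distrib
    by (intro sum.cong refl) (simp add: algebra_simps add_divide_distrib)
  also have "\<dots> \<le> (\<Sum>i<2 ^ K. integral {?t i..?t (Suc i)} ?e)"
    using step t_le \<open>T > 0\<close> by (intro sum_mono square_increment_le_energy[OF \<phi>]) (auto simp del: of_nat_Suc)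
  also have "\<dots> = integral {0..T} ?e" using sum[of "2 ^ K"] by simp
  also have "\<dots> = path_energy T \<phi>"
    unfolding path_energy_def by (rule set_lebesgue_integral_eq_integral(2)[OF cameron_martinD(3)[OF \<phi>], symmetric])
  finally show ?thesis .
qed

text \<open>The difference quotients over the dyadic intervals containing \<open>t\<close> converge to the
  derivative wherever it exists, so Fatou's lemma bounds the energy by the dyadic energies.\<close>

lemma dyadic_energy_tendsto_path_energy:
  fixes \<phi> :: "real \<Rightarrow> 'a::euclidean_space"
  assumes \<phi>: "\<phi> \<in> cameron_martin T" and "T > 0" and c: "c < path_energy T \<phi>"
  shows "\<exists>K. c < dyadic_energy T K \<phi>"
proof (rule ccontr)
  assume "\<not> ?thesis"
  then have le: "dyadic_energy T K \<phi> \<le> c" for K by (simp add: not_less)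
  have "0 \<le> dyadic_energy T 0 \<phi>" using \<open>T > 0\<close> by (simp add: dyadic_energy_def)
  then have "0 \<le> c" using le order_trans by blast
  let ?p = "path_deriv T \<phi>" and ?t = "\<lambda>K i. T * real i / 2 ^ K"
  have tdiff: "?t K (Suc i) - ?t K i = T / 2 ^ K" for K i
    by (simp add: algebra_simps add_divide_distrib)
  \<comment> \<open>Squared slope over the \<open>i\<close>-th dyadic interval; \<open>S K\<close>
    is the resulting step function, whose integral is the dyadic energy.\<close>
  define a where "a K i = (norm ((\<phi> (?t K (Suc i)) - \<phi> (?t K i)) /\<^sub>R (T / 2 ^ K)))\<^sup>2" for K i
  define S where "S K t = (\<Sum>i<2 ^ K. ennreal (a K i) * indicator {?t K i..<?t K (Suc i)} t)" for K t
  have S_m: "S K \<in> borel_measurable lebesgue" for K unfolding S_def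
    by (intro borel_measurable_sum borel_measurable_times_ennreal borel_measurable_const borel_measurable_indicator) auto
  have S_int: "(\<integral>\<^sup>+t. S K t \<partial>lebesgue) = ennreal (dyadic_energy T K \<phi>)" for K
  proof -
    have "(\<integral>\<^sup>+t. S K t \<partial>lebesgue) = (\<Sum>i<2 ^ K. ennreal (a K i) * ennreal (T / 2 ^ K))"
    proof -
      have "(\<integral>\<^sup>+t. S K t \<partial>lebesgue) = (\<Sum>i<2 ^ K. \<integral>\<^sup>+t. ennreal (a K i) * indicator {?t K i..<?t K (Suc i)} t \<partial>lebesgue)"
        unfolding S_def by (intro nn_integral_sum borel_measurable_times_ennreal borel_measurable_const borel_measurable_indicator) auto
      also have "\<dots> = (\<Sum>i<2 ^ K. ennreal (a K i) * ennreal (T / 2 ^ K))"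
      proof (rule sum.cong[OF refl])
        fix i
        have "?t K i \<le> ?t K (Suc i)" using tdiff[of K i] \<open>T > 0\<close> by (simp add: divide_right_mono)
        then have "emeasure lebesgue {?t K i..<?t K (Suc i)} = ennreal (?t K (Suc i) - ?t K i)"
          by (simp add: emeasure_lborel_Ico)
        then show "(\<integral>\<^sup>+t. ennreal (a K i) * indicator {?t K i..<?t K (Suc i)} t \<partial>lebesgue) = ennreal (a K i) * ennreal (T / 2 ^ K)"
          unfolding tdiff by (subst nn_integral_cmult_indicator) auto
      qed
      finally show ?thesis .
    qed
    also have "\<dots> = ennreal (\<Sum>i<2 ^ K. a K i * (T / 2 ^ K))"
    proof -
      have nn: "0 \<le> a K i" "0 \<le> T / 2 ^ K" for i using \<open>T > 0\<close> by (auto simp: a_def)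
      show ?thesis
        unfolding ennreal_mult[OF nn, symmetric] by (rule sum_ennreal) (rule mult_nonneg_nonneg[OF nn])
    qed
    also have "(\<Sum>i<2 ^ K. a K i * (T / 2 ^ K)) = dyadic_energy T K \<phi>"
      unfolding dyadic_energy_def a_def sum_divide_distrib using \<open>T > 0\<close>
      by (intro sum.cong refl) (simp add: power_mult_distrib power2_eq_square divide_simps)
    finally show ?thesis .
  qed
  obtain N where N: "negligible N"
    "\<forall>t\<in>{0..T} - N. (\<phi> has_vector_derivative ?p t) (at t within {0..T})"
    by (rule has_vector_derivative_path_deriv[OF cameron_martinD(1)[OF \<phi>] \<open>T > 0\<close>]) (rule that)
  have lim: "(\<lambda>K. S K t) \<longlonglongrightarrow> ennreal ((norm (?p t))\<^sup>2)" if t: "t \<in> {0..<T}" "t \<notin> N" for t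
  proof -
    define i where "i K = nat \<lfloor>t / T * 2 ^ K\<rfloor>" for K
    have "0 \<le> t / T" "t / T < 1" using t \<open>T > 0\<close> by auto
    then have pos: "0 \<le> t / T * 2 ^ K" and less: "t / T * 2 ^ K < 2 ^ K" for K
      using mult_nonneg_nonneg[of "t / T" "2 ^ K"] mult_strict_right_mono[of "t / T" 1 "2 ^ K"] by simp_all
    have iK: "real (i K) \<le> t / T * 2 ^ K" "t / T * 2 ^ K < real (i K) + 1" for K
      using pos[of K] by (auto simp: i_def)
    have i_less: "i K < 2 ^ K" for K using order_le_less_trans[OF iK(1) less, of K] by simp
    have mem: "?t K (i K) \<le> t" "t < ?t K (Suc (i K))" for K
      using iK[of K] \<open>T > 0\<close> by (simp_all add: field_simps)
    have S_eq: "S K t = ennreal (a K (i K))" for K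
    proof -
      have "indicator {?t K j..<?t K (Suc j)} t = (if j = i K then 1 else 0 :: ennreal)" for j
      proof -
        have uniq: "j = i K" if "?t K j \<le> t" "t < ?t K (Suc j)"
        proof -
          have "?t K j < ?t K (Suc (i K))" "?t K (i K) < ?t K (Suc j)"
            using mem[of K] that by linarith+
          then have "real j < real (Suc (i K))" "real (i K) < real (Suc j)"
            using \<open>T > 0\<close> by (auto simp: divide_less_cancel simp del: of_nat_Suc)
          then show ?thesis by linarith
        qed
        show ?thesis
        proof (cases "j = i K")
          case True
          then show ?thesis using mem[of K] by (simp del: of_nat_Suc)
        next
          case False
          then have "t \<notin> {?t K j..<?t K (Suc j)}" using uniq by fastforce
          then show ?thesis using False by (simp del: of_nat_Suc)
        qed
      qed
      then have "S K t = (\<Sum>j<2 ^ K. if j = i K then ennreal (a K j) else 0)"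
        unfolding S_def by (intro sum.cong refl) simp
      then show ?thesis using i_less[of K] by simp
    qed
    have "(\<lambda>K. (\<phi> (?t K (Suc (i K))) - \<phi> (?t K (i K))) /\<^sub>R (T / 2 ^ K)) \<longlonglongrightarrow> ?p t"
    proof (rule LIMSEQ_I)
      fix r :: real assume "r > 0"
      define r' where "r' = r / 2"
      have "r' > 0" using \<open>r > 0\<close> by (simp add: r'_def)
      have "(\<phi> has_vector_derivative ?p t) (at t within {0..T})" using N(2) t by auto
      then obtain \<delta> where \<delta>: "\<delta> > 0" "\<And>y. y \<in> {0..T} \<Longrightarrow> norm (y - t) < \<delta> \<Longrightarrow>
          norm (\<phi> y - \<phi> t - (y - t) *\<^sub>R ?p t) \<le> r' * norm (y - t)"
        using \<open>r' > 0\<close> unfolding has_vector_derivative_def has_derivative_within_alt by blast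
      have "(\<lambda>K. T * (1 / 2) ^ K) \<longlonglongrightarrow> T * 0"
        by (intro tendsto_intros LIMSEQ_realpow_zero) auto
      then have "\<forall>\<^sub>F K in sequentially. T * (1 / 2) ^ K < \<delta>"
        using \<delta>(1) by (intro order_tendstoD(2)) auto
      then obtain K0 where K0: "\<And>K. K \<ge> K0 \<Longrightarrow> T / 2 ^ K < \<delta>"
        unfolding eventually_sequentially by (auto simp: power_one_over)
      show "\<exists>K0. \<forall>K\<ge>K0. norm ((\<phi> (?t K (Suc (i K))) - \<phi> (?t K (i K))) /\<^sub>R (T / 2 ^ K) - ?p t) < r"
      proof (intro exI[of _ K0] allI impI)
        fix K assume "K \<ge> K0"
        let ?u = "?t K (i K)" and ?v = "?t K (Suc (i K))" and ?d = "T / 2 ^ K"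
        have d: "?d > 0" "?v - ?u = ?d" using \<open>T > 0\<close> tdiff by auto
        have uv: "?u \<in> {0..T}" "?v \<in> {0..T}"
        proof -
          have "real (Suc (i K)) \<le> 2 ^ K" using i_less[of K] by (metis Suc_leI of_nat_le_iff of_nat_numeral of_nat_power)
          then have v: "?v \<le> T" using \<open>T > 0\<close> by (simp add: divide_le_eq)
          have u: "0 \<le> ?u" using \<open>T > 0\<close> by simp
          show "?v \<in> {0..T}" "?u \<in> {0..T}"
            unfolding atLeastAtMost_iff using u v d by linarith+
        qed
        have near: "norm (?u - t) < \<delta>" "norm (?v - t) < \<delta>"
          using mem[of K] d(2) K0[OF \<open>K \<ge> K0\<close>] by auto
        have "(\<phi> ?v - \<phi> ?u) - ?d *\<^sub>R ?p t = (\<phi> ?v - \<phi> t - (?v - t) *\<^sub>R ?p t) - (\<phi> ?u - \<phi> t - (?u - t) *\<^sub>R ?p t)"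
          unfolding d(2)[symmetric] by (simp add: algebra_simps)
        also have "norm \<dots> \<le> r' * norm (?v - t) + r' * norm (?u - t)"
          using norm_triangle_ineq4 add_mono[OF \<delta>(2)[OF uv(2) near(2)] \<delta>(2)[OF uv(1) near(1)]] by (rule order_trans)
        also have "\<dots> = r' * (norm (?v - t) + norm (?u - t))" by (rule distrib_left[symmetric])
        \<comment> \<open>\<open>t\<close> lies between the endpoints, so the two distances add up
          to the mesh width; hence the difference quotient is off by at most
          \<open>r'\<close>.\<close>
        also have "norm (?v - t) + norm (?u - t) = ?d" using mem[of K] d(2) by auto
        finally have "norm ((\<phi> ?v - \<phi> ?u) - ?d *\<^sub>R ?p t) \<le> r' * ?d" .
        moreover have "norm (x /\<^sub>R d - p) \<le> r'" if "d > 0" "norm (x - d *\<^sub>R p) \<le> r' * d" for x p :: 'a and d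
        proof -
          have "x /\<^sub>R d - p = (x - d *\<^sub>R p) /\<^sub>R d" using that(1) by (simp add: scaleR_diff_right)
          then have "norm (x /\<^sub>R d - p) = norm (x - d *\<^sub>R p) / d"
            using that(1) by (simp add: divide_inverse mult.commute)
          then show ?thesis using that by (simp add: pos_divide_le_eq)
        qed
        ultimately have "norm ((\<phi> ?v - \<phi> ?u) /\<^sub>R ?d - ?p t) \<le> r'" using d(1) by blast
        then show "norm ((\<phi> ?v - \<phi> ?u) /\<^sub>R ?d - ?p t) < r" using \<open>r > 0\<close> by (simp add: r'_def)
      qed
    qed
    then have "(\<lambda>K. a K (i K)) \<longlonglongrightarrow> (norm (?p t))\<^sup>2"
      unfolding a_def by (intro tendsto_intros)
    then show ?thesis unfolding S_eq by (rule tendsto_ennrealI)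
  qed
  have "set_integrable lebesgue {0..T} (\<lambda>t. (norm (?p t))\<^sup>2)" by (rule cameron_martinD(3)[OF \<phi>])
  then have int: "integrable lebesgue (\<lambda>t. indicator {0..T} t *\<^sub>R (norm (?p t))\<^sup>2)" by (simp add: set_integrable_def)
  have "ennreal (path_energy T \<phi>) = (\<integral>\<^sup>+t. ennreal (indicator {0..T} t *\<^sub>R (norm (?p t))\<^sup>2) \<partial>lebesgue)"
    unfolding path_energy_def set_lebesgue_integral_def using int by (subst nn_integral_eq_integral) auto
  also have "\<dots> \<le> (\<integral>\<^sup>+t. liminf (\<lambda>K. S K t) \<partial>lebesgue)"
  proof (rule nn_integral_mono_AE)
    have "negligible (N \<union> {T})" using N(1) by (simp add: negligible_Un)
    then have "AE t in lebesgue. t \<notin> N \<union> {T}"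
      unfolding negligible_iff_null_sets by (rule AE_not_in)
    then show "AE t in lebesgue. ennreal (indicator {0..T} t *\<^sub>R (norm (?p t))\<^sup>2) \<le> liminf (\<lambda>K. S K t)"
    proof eventually_elim
      case (elim t)
      show ?case
      proof (cases "t \<in> {0..T}")
        case True
        then have "(\<lambda>K. S K t) \<longlonglongrightarrow> ennreal ((norm (?p t))\<^sup>2)" using elim by (intro lim) auto
        then have "liminf (\<lambda>K. S K t) = ennreal ((norm (?p t))\<^sup>2)"
          by (intro lim_imp_Liminf) auto
        then show ?thesis using True by simp
      qed simp
    qed
  qed
  also have "\<dots> \<le> liminf (\<lambda>K. \<integral>\<^sup>+t. S K t \<partial>lebesgue)" by (rule nn_integral_liminf[OF S_m])
  also have "\<dots> \<le> ennreal c"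
    unfolding S_int by (rule Liminf_le) (use le in \<open>auto intro!: always_eventually ennreal_leI\<close>)
  finally have "path_energy T \<phi> \<le> c" using \<open>0 \<le> c\<close> by simp
  then show False using c by simp
qed

lemma matrix_vector_mul_norm_bound:
  fixes A :: "real ^ 'n ^ 'm"
  obtains C where "C > 0" "\<And>x. norm (A *v x) \<le> C * norm x"
  using bounded_linear.pos_bounded[OF matrix_vector_mul_bounded_linear[of A]] by (metis mult.commute)

text \<open>One closure property for three uses: the state path of a noise (\<open>A = G\<close>,
  with \<open>g\<close> the drift along the path), the noise of a state path (\<open>A\<close> the
  inverse of \<open>G\<close>), and polynomial paths (\<open>A = 0\<close>).\<close>

lemma cameron_martin_affine:
  fixes \<phi> \<psi> :: "real \<Rightarrow> real ^ 'n" and A :: "real ^ 'n ^ 'n"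
  assumes \<phi>: "\<phi> \<in> cameron_martin T" and "T > 0" and g: "continuous_on {0..T} g"
    and \<psi>: "\<And>t. t \<in> {0..T} \<Longrightarrow> \<psi> t = A *v \<phi> t + integral {0..t} g + c"
  shows "\<psi> \<in> cameron_martin T"
    and "AE t in lebesgue_on {0..T}. path_deriv T \<psi> t = A *v path_deriv T \<phi> t + g t"
proof -
  obtain C where C: "C > 0" "\<And>x. norm (A *v x) \<le> C * norm x"
    using matrix_vector_mul_norm_bound by blast
  have "compact (g ` {0..T})" using g by (intro compact_continuous_image) auto
  then obtain B where B: "B > 0" "\<And>t. t \<in> {0..T} \<Longrightarrow> norm (g t) \<le> B"
    using compact_imp_bounded bounded_pos by (metis imageI)
  have gi: "g integrable_on {u..v}" if "0 \<le> u" "v \<le> T" for u v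
    using that by (intro integrable_continuous_real continuous_on_subset[OF g]) auto
  have AC: "absolutely_continuous_path 0 T \<psi>"
  proof (rule absolutely_continuous_path_dominated[OF cameron_martinD(1)[OF \<phi>] absolutely_continuous_path_ident])
    fix u v assume uv: "0 \<le> u" "u \<le> v" "v \<le> T"
    have "\<psi> v - \<psi> u = A *v (\<phi> v - \<phi> u) + integral {u..v} g"
      using \<psi>[of u] \<psi>[of v] uv Henstock_Kurzweil_Integration.integral_combine[of 0 u v g] gi[of 0 v]
      by (simp add: matrix_vector_mult_diff_distrib algebra_simps)
    also have "norm \<dots> \<le> norm (A *v (\<phi> v - \<phi> u)) + norm (integral {u..v} g)" by (rule norm_triangle_ineq)
    also have "\<dots> \<le> C * norm (\<phi> v - \<phi> u) + B * (v - u)"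
    proof (intro add_mono C(2))
      show "norm (integral {u..v} g) \<le> B * (v - u)"
        using uv B by (intro integral_bound continuous_on_subset[OF g]) auto
    qed
    also have "\<dots> \<le> (C + B) * (norm (\<phi> v - \<phi> u) + norm (v - u))"
    proof -
      have "0 \<le> B * norm (\<phi> v - \<phi> u)" "0 \<le> C * (v - u)" using C(1) B(1) uv by auto
      then show ?thesis using uv by (simp add: algebra_simps)
    qed
    finally show "norm (\<psi> v - \<psi> u) \<le> (C + B) * (norm (\<phi> v - \<phi> u) + norm (v - u))" .
  qed
  obtain N where N: "negligible N"
    "\<forall>t\<in>{0..T} - N. (\<phi> has_vector_derivative path_deriv T \<phi> t) (at t within {0..T})"
    by (rule has_vector_derivative_path_deriv[OF cameron_martinD(1)[OF \<phi>] \<open>T > 0\<close>]) (rule that)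
  let ?h = "\<lambda>t. A *v path_deriv T \<phi> t + g t"
  have deriv: "path_deriv T \<psi> t = ?h t" if t: "t \<in> {0..T}" "t \<notin> N" for t
  proof (rule path_deriv_eqI[OF \<open>T > 0\<close> t(1)])
    have "((\<lambda>t. A *v \<phi> t + integral {0..t} g + c) has_vector_derivative (?h t + 0)) (at t within {0..T})"
    proof (intro has_vector_derivative_add has_vector_derivative_const integral_has_vector_derivative g t(1))
      show "((\<lambda>t. A *v \<phi> t) has_vector_derivative A *v path_deriv T \<phi> t) (at t within {0..T})"
        using N(2) t by (intro bounded_linear.has_vector_derivative[OF matrix_vector_mul_bounded_linear]) auto
    qed
    then have "((\<lambda>t. A *v \<phi> t + integral {0..t} g + c) has_vector_derivative ?h t) (at t within {0..T})" by simp
    then show "(\<psi> has_vector_derivative ?h t) (at t within {0..T})"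
      by (rule has_vector_derivative_transform[OF t(1), rotated]) (simp add: \<psi>)
  qed
  have AE_N: "AE t in lebesgue. t \<notin> N" using N(1) by (simp add: negligible_iff_null_sets AE_not_in)
  then show AE: "AE t in lebesgue_on {0..T}. path_deriv T \<psi> t = ?h t"
    by (subst AE_restrict_space_iff) (auto elim!: eventually_mono simp: deriv)
  have m\<phi>: "(\<lambda>t. indicator {0..T} t *\<^sub>R path_deriv T \<phi> t) \<in> borel_measurable lebesgue"
    using cameron_martinD(2)[OF \<phi>] by (simp add: set_borel_measurable_def)
  have mg: "(\<lambda>t. indicator {0..T} t *\<^sub>R g t) \<in> borel_measurable lebesgue"
    using borel_measurable_continuous_on_indicator[OF _ g] by (auto intro: measurable_completion)
  have "(\<lambda>t. A *v (indicator {0..T} t *\<^sub>R path_deriv T \<phi> t) + indicator {0..T} t *\<^sub>R g t) \<in> borel_measurable lebesgue"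
    using mg by (intro borel_measurable_add borel_measurable_continuous_on[OF _ m\<phi>])
      (auto intro!: linear_continuous_on matrix_vector_mul_bounded_linear)
  then have mh: "(\<lambda>t. indicator {0..T} t *\<^sub>R ?h t) \<in> borel_measurable lebesgue"
    by (simp add: scaleR_add_right matrix_vector_mult_scaleR)
  have AE': "AE t in lebesgue. indicator {0..T} t *\<^sub>R ?h t = indicator {0..T} t *\<^sub>R path_deriv T \<psi> t"
    using AE_N by eventually_elim (auto simp: indicator_def deriv)
  have m\<psi>: "(\<lambda>t. indicator {0..T} t *\<^sub>R path_deriv T \<psi> t) \<in> borel_measurable lebesgue"
    by (rule borel_measurable_AE[OF mh AE'])
  have "integrable lebesgue (\<lambda>t. indicator {0..T} t *\<^sub>R (2 * C\<^sup>2 * (norm (path_deriv T \<phi> t))\<^sup>2) + indicator {0..T} t *\<^sub>R (2 * B\<^sup>2))"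
  proof (rule Bochner_Integration.integrable_add)
    show "integrable lebesgue (\<lambda>t. indicator {0..T} t *\<^sub>R (2 * C\<^sup>2 * (norm (path_deriv T \<phi> t))\<^sup>2))"
      using set_integrable_mult_right[of "2 * C\<^sup>2", OF cameron_martinD(3)[OF \<phi>]] by (simp add: set_integrable_def)
    show "integrable lebesgue (\<lambda>t. indicator {0..T} t *\<^sub>R (2 * B\<^sup>2))"
      using \<open>T > 0\<close> by (intro integrable_scaleR_left integrable_real_indicator) auto
  qed
  then have "integrable lebesgue (\<lambda>t. indicator {0..T} t *\<^sub>R (norm (path_deriv T \<psi> t))\<^sup>2)"
  proof (rule Bochner_Integration.integrable_bound)
    have "(\<lambda>t. (norm (indicator {0..T} t *\<^sub>R path_deriv T \<psi> t))\<^sup>2) \<in> borel_measurable lebesgue"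
      using m\<psi> by measurable
    also have "(\<lambda>t. (norm (indicator {0..T} t *\<^sub>R path_deriv T \<psi> t))\<^sup>2) =
        (\<lambda>t. indicator {0..T} t *\<^sub>R (norm (path_deriv T \<psi> t))\<^sup>2)"
      by (auto simp: indicator_def)
    finally show "(\<lambda>t. indicator {0..T} t *\<^sub>R (norm (path_deriv T \<psi> t))\<^sup>2) \<in> borel_measurable lebesgue" .
    show "AE t in lebesgue. norm (indicator {0..T} t *\<^sub>R (norm (path_deriv T \<psi> t))\<^sup>2) \<le>
      norm (indicator {0..T} t *\<^sub>R (2 * C\<^sup>2 * (norm (path_deriv T \<phi> t))\<^sup>2) + indicator {0..T} t *\<^sub>R (2 * B\<^sup>2))"
      using AE_N
    proof eventually_elim
      case (elim t)
      have "(norm (?h t))\<^sup>2 \<le> 2 * C\<^sup>2 * (norm (path_deriv T \<phi> t))\<^sup>2 + 2 * B\<^sup>2" if t: "t \<in> {0..T}"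
      proof -
        have "norm (?h t) \<le> C * norm (path_deriv T \<phi> t) + B"
          using C(2) B(2)[OF t] by (intro norm_triangle_le add_mono)
        then have "(norm (?h t))\<^sup>2 \<le> (C * norm (path_deriv T \<phi> t) + B)\<^sup>2" by (intro power_mono) auto
        also have "\<dots> \<le> 2 * (C * norm (path_deriv T \<phi> t))\<^sup>2 + 2 * B\<^sup>2"
          using sum_squares_bound[of "C * norm (path_deriv T \<phi> t)" B] by (simp add: power2_sum)
        finally show ?thesis by (simp add: power_mult_distrib)
      qed
      then show ?case using elim by (auto simp: indicator_def deriv)
    qed
  qed
  then show "\<psi> \<in> cameron_martin T"
    using AC m\<psi> by (simp add: cameron_martin_def square_integrable_on_def set_borel_measurable_def set_integrable_def)
qed

text \<open>The lower bound holds for every positive \<open>\<epsilon>\<close>. For an upper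
  threshold \<open>b\<close>, a level \<open>K\<close> is fixed with
  \<open>exp (- dyadic_energy T K \<eta> / 2) < b\<close>; the linear term of the bound is
  proportional to \<open>\<epsilon>\<close> and disappears in the limit.\<close>

lemma (in wiener) small_ball_ratio:
  assumes \<eta>: "\<eta> \<in> cameron_martin T" and "\<eta> 0 = 0"
  shows "((\<lambda>\<epsilon>. prob (dyadic_tube \<eta> \<epsilon>) / prob (dyadic_tube (\<lambda>_. 0) \<epsilon>)) \<longlongrightarrow> exp (- path_energy T \<eta> / 2)) (at_right 0)"
proof (rule order_tendstoI)
  let ?r = "\<lambda>\<epsilon>. prob (dyadic_tube \<eta> \<epsilon>) / prob (dyadic_tube (\<lambda>_. 0) \<epsilon>)"
  have pos: "\<forall>\<^sub>F \<epsilon> in at_right 0. prob (dyadic_tube (\<lambda>_. 0) \<epsilon>) > 0"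
    using eventually_at_right_less[of "0 :: real"] by eventually_elim (rule prob_dyadic_tube_pos)
  {
    fix a assume a: "a < exp (- path_energy T \<eta> / 2)"
    show "\<forall>\<^sub>F \<epsilon> in at_right 0. a < ?r \<epsilon>"
      using pos
    proof eventually_elim
      case (elim \<epsilon>)
      have "exp (- path_energy T \<eta> / 2) * prob (dyadic_tube (\<lambda>_. 0) \<epsilon>) \<le> prob (dyadic_tube \<eta> \<epsilon>)"
        by (rule prob_dyadic_tube_ge[where g = \<eta>, OF \<open>\<eta> 0 = 0\<close> dyadic_energy_le_path_energy[OF \<eta> T_pos]])
      then have "exp (- path_energy T \<eta> / 2) \<le> ?r \<epsilon>" using elim by (simp add: pos_le_divide_eq)
      then show ?case using a by linarith
    qed
  next
    fix b assume b: "exp (- path_energy T \<eta> / 2) < b"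
    then have "b > 0" using exp_gt_zero less_trans by blast
    have "- path_energy T \<eta> / 2 < ln b" using b \<open>b > 0\<close> by (simp add: ln_less_cancel_iff[symmetric] del: ln_less_cancel_iff)
    then have "- 2 * ln b < path_energy T \<eta>" by simp
    then obtain K where K: "- 2 * ln b < dyadic_energy T K \<eta>"
      using dyadic_energy_tendsto_path_energy[OF \<eta> T_pos] by blast
    define C where "C = 2 * (\<Sum>i<2 ^ K. norm (\<eta> (T * real (Suc i) / 2 ^ K) - \<eta> (T * real i / 2 ^ K))) / (T / 2 ^ K)"
    have "exp (- dyadic_energy T K \<eta> / 2) < exp (ln b)" using K by simp
    then have less: "exp (- dyadic_energy T K \<eta> / 2) < b" using \<open>b > 0\<close> by simp
    have "((\<lambda>\<epsilon>. exp (\<epsilon> * C - dyadic_energy T K \<eta> / 2)) \<longlongrightarrow> exp (0 * C - dyadic_energy T K \<eta> / 2)) (at_right 0)"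
      by (intro tendsto_intros)
    then have "\<forall>\<^sub>F \<epsilon> in at_right 0. exp (\<epsilon> * C - dyadic_energy T K \<eta> / 2) < b"
      using less by (intro order_tendstoD(2)) auto
    then show "\<forall>\<^sub>F \<epsilon> in at_right 0. ?r \<epsilon> < b"
      using pos
    proof eventually_elim
      case (elim \<epsilon>)
      have "prob (dyadic_tube \<eta> \<epsilon>) \<le> exp (\<epsilon> * C - dyadic_energy T K \<eta> / 2) * prob (dyadic_tube (\<lambda>_. 0) \<epsilon>)"
        using prob_dyadic_tube_upper[of \<eta> \<epsilon> K, OF \<open>\<eta> 0 = 0\<close>] by (simp add: C_def mult_ac)
      then have "?r \<epsilon> \<le> exp (\<epsilon> * C - dyadic_energy T K \<eta> / 2)" using elim by (simp add: pos_divide_le_eq)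
      then show ?case using elim by linarith
    qed
  }
qed

text \<open>A crude Gronwall bound: maximise \<open>u t * exp (- 2 * L * t)\<close>.\<close>

lemma gronwall_bound:
  fixes u :: "real \<Rightarrow> real"
  assumes cont: "continuous_on {0..T} u" and "T \<ge> 0" "L > 0"
    and le: "\<And>t. t \<in> {0..T} \<Longrightarrow> u t \<le> c + L * integral {0..t} u" and "c \<ge> 0" and t: "t \<in> {0..T}"
  shows "u t \<le> 2 * c * exp (2 * L * T)"
proof -
  have "continuous_on {0..T} (\<lambda>t. u t * exp (- 2 * L * t))" by (intro continuous_intros cont)
  then obtain t0 where t0: "t0 \<in> {0..T}" "\<And>t. t \<in> {0..T} \<Longrightarrow> u t * exp (- 2 * L * t) \<le> u t0 * exp (- 2 * L * t0)"
    using continuous_attains_sup[of "{0..T}" "\<lambda>t. u t * exp (- 2 * L * t)"] \<open>T \<ge> 0\<close> by auto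
  define m where "m = u t0 * exp (- 2 * L * t0)"
  have bound: "u s \<le> m * exp (2 * L * s)" if "s \<in> {0..T}" for s
  proof -
    have "u s * exp (- 2 * L * s) * exp (2 * L * s) \<le> m * exp (2 * L * s)"
      using t0(2)[OF that] unfolding m_def by (intro mult_right_mono) auto
    then show ?thesis by (simp add: mult.assoc mult_exp_exp)
  qed
  have "((\<lambda>s. m * exp (2 * L * s)) has_integral (m * exp (2 * L * t0) / (2 * L) - m * exp (2 * L * 0) / (2 * L))) {0..t0}"
  proof (rule fundamental_theorem_of_calculus)
    show "0 \<le> t0" using t0(1) by simp
    fix s
    have "((\<lambda>s. m * exp (2 * L * s) / (2 * L)) has_real_derivative m * exp (2 * L * s)) (at s within {0..t0})"
      using \<open>L > 0\<close> by (auto intro!: derivative_eq_intros)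
    then show "((\<lambda>s. m * exp (2 * L * s) / (2 * L)) has_vector_derivative m * exp (2 * L * s)) (at s within {0..t0})"
      by (simp add: has_real_derivative_iff_has_vector_derivative)
  qed
  moreover have "u integrable_on {0..t0}"
    using t0(1) by (intro integrable_continuous_real continuous_on_subset[OF cont]) auto
  ultimately have "integral {0..t0} u \<le> m * exp (2 * L * t0) / (2 * L) - m * exp (2 * L * 0) / (2 * L)"
    using bound t0(1) by (intro has_integral_le[OF integrable_integral]) auto
  then have "L * integral {0..t0} u \<le> L * (m * exp (2 * L * t0) / (2 * L) - m * exp (2 * L * 0) / (2 * L))"
    using \<open>L > 0\<close> by (intro mult_left_mono) auto
  \<comment> \<open>With the exponent \<open>2 * L\<close> the integral term is half of
    \<open>u t0 = m * exp (2 * L * t0)\<close>, up to \<open>- m / 2\<close>, and can be absorbed on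
    the left.\<close>
  also have "\<dots> = (m * exp (2 * L * t0) - m) / 2"
    using \<open>L > 0\<close> by (simp add: field_simps)
  finally have "u t0 \<le> c + (m * exp (2 * L * t0) - m) / 2" using le[OF t0(1)] by linarith
  moreover have "u t0 = m * exp (2 * L * t0)" by (simp add: m_def mult.assoc mult_exp_exp)
  moreover have "v \<le> c + (z - m) / 2 \<Longrightarrow> v = z \<Longrightarrow> z + m \<le> 2 * c" for v z
    by (simp add: field_simps)
  ultimately have *: "m * exp (2 * L * t0) + m \<le> 2 * c" by blast
  have "m \<le> 2 * c"
  proof (cases "m \<le> 0")
    case True then show ?thesis using \<open>c \<ge> 0\<close> by linarith
  next
    case False
    then have "0 \<le> m * exp (2 * L * t0)" by simp
    then show ?thesis using * by linarith
  qed
  have "u t \<le> m * exp (2 * L * t)" by (rule bound[OF t])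
  also have "\<dots> \<le> 2 * c * exp (2 * L * t)" using \<open>m \<le> 2 * c\<close> by (intro mult_right_mono) auto
  also have "\<dots> \<le> 2 * c * exp (2 * L * T)" using t \<open>L > 0\<close> \<open>c \<ge> 0\<close> by (intro mult_left_mono) auto
  finally show ?thesis .
qed

lemma prod_continuity_modulus:
  fixes q :: "real \<Rightarrow> 'a::real_normed_vector \<Rightarrow> real"
  assumes "finite I" "\<And>t. t \<in> I \<Longrightarrow> continuous_on UNIV (q t)" "d > 0"
  shows "\<exists>r>0. \<forall>z. (\<forall>t\<in>I. norm (z t - x t) \<le> r) \<longrightarrow> \<bar>(\<Prod>t\<in>I. q t (z t)) - (\<Prod>t\<in>I. q t (x t))\<bar> < d"
proof (rule ccontr)
  assume neg: "\<not> ?thesis"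
  have "\<forall>n. \<exists>z. (\<forall>t\<in>I. norm (z t - x t) \<le> 1 / real (Suc n)) \<and> \<not> \<bar>(\<Prod>t\<in>I. q t (z t)) - (\<Prod>t\<in>I. q t (x t))\<bar> < d"
  proof
    fix n
    have "1 / real (Suc n) > 0" by simp
    then show "\<exists>z. (\<forall>t\<in>I. norm (z t - x t) \<le> 1 / real (Suc n)) \<and> \<not> \<bar>(\<Prod>t\<in>I. q t (z t)) - (\<Prod>t\<in>I. q t (x t))\<bar> < d"
      using neg by blast
  qed
  then obtain z where z: "\<And>n t. t \<in> I \<Longrightarrow> norm (z n t - x t) \<le> 1 / real (Suc n)"
    "\<And>n. \<not> \<bar>(\<Prod>t\<in>I. q t (z n t)) - (\<Prod>t\<in>I. q t (x t))\<bar> < d"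
    by metis
  have "(\<lambda>n. \<Prod>t\<in>I. q t (z n t)) \<longlonglongrightarrow> (\<Prod>t\<in>I. q t (x t))"
  proof (rule tendsto_prod)
    fix t assume t: "t \<in> I"
    have "(\<lambda>n. z n t - x t) \<longlonglongrightarrow> 0"
    proof (rule Lim_null_comparison)
      show "\<forall>\<^sub>F n in sequentially. norm (z n t - x t) \<le> 1 / real (Suc n)" using z(1)[OF t] by simp
      show "(\<lambda>n. 1 / real (Suc n)) \<longlonglongrightarrow> 0" by (rule LIMSEQ_Suc[OF lim_1_over_n])
    qed
    then have "(\<lambda>n. z n t) \<longlonglongrightarrow> x t" by (rule LIM_zero_cancel)
    then show "(\<lambda>n. q t (z n t)) \<longlonglongrightarrow> q t (x t)"
      using assms(2)[OF t] by (auto intro: continuous_on_tendsto_compose)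
  qed
  then have "\<forall>\<^sub>F n in sequentially. dist (\<Prod>t\<in>I. q t (z n t)) (\<Prod>t\<in>I. q t (x t)) < d"
    using \<open>d > 0\<close> by (rule tendstoD)
  then show False using z(2) by (auto simp: eventually_sequentially dist_real_def)
qed

lemma ereal_ln_mult:
  assumes "0 \<le> a" "0 \<le> b"
  shows "ereal_ln (a * b) = ereal_ln a + ereal_ln b"
  using assms by (auto simp: ereal_ln_def ln_mult)

lemma ereal_ln_prod:
  assumes "finite I" "\<And>i. i \<in> I \<Longrightarrow> 0 \<le> a i"
  shows "ereal_ln (\<Prod>i\<in>I. a i) = (\<Sum>i\<in>I. ereal_ln (a i))"
  using assms
proof (induction I rule: finite_induct)
  case (insert i I)
  then show ?case by (simp add: ereal_ln_mult prod_nonneg)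
qed (simp add: ereal_ln_def)

lemma ereal_ln_exp: "ereal_ln (exp r) = ereal r"
  by (simp add: ereal_ln_def)

lemma ereal_ln_le_iff:
  assumes "0 \<le> a" "0 \<le> b"
  shows "ereal_ln a \<le> ereal_ln b \<longleftrightarrow> a \<le> b"
  using assms by (auto simp: ereal_ln_def)

lemma matrix_inv_cancel:
  fixes A :: "real ^ 'n ^ 'n"
  assumes "invertible A"
  shows "A ** matrix_inv A = mat 1" "matrix_inv A ** A = mat 1"
  using someI_ex[OF assms[unfolded invertible_def]] by (simp_all add: matrix_inv_def)

text \<open>With \<open>w\<close> the image of \<open>G *v v\<close> under the inverse of
  \<open>G ** transpose G\<close>, cancelling \<open>G\<close> gives
  \<open>transpose G *v w = v\<close>. This identity converts the weighted residual of a state path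
  into the energy of its noise.\<close>

lemma weighted_norm_matrix_image:
  fixes G :: "real ^ 'n ^ 'n"
  assumes G: "invertible G"
  shows "weighted_norm (matrix_inv (G ** transpose G)) (G *v v) = norm v"
proof -
  let ?S = "G ** transpose G"
  define w where "w = matrix_inv ?S *v (G *v v)"
  have "invertible ?S" using G by (simp add: invertible_mult transpose_invertible)
  then have "?S ** matrix_inv ?S = mat 1" by (rule matrix_inv_cancel)
  moreover have "?S *v w = (?S ** matrix_inv ?S) *v (G *v v)"
    unfolding w_def by (rule matrix_vector_mul_assoc)
  moreover have "G *v (transpose G *v w) = ?S *v w" by (rule matrix_vector_mul_assoc)
  ultimately have "G *v (transpose G *v w) = G *v v" by (simp only: matrix_vector_mul_lid)
  moreover have "matrix_inv G *v (G *v z) = z" for z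
    by (simp add: matrix_vector_mul_assoc matrix_inv_cancel[OF G])
  ultimately have "transpose G *v w = v" by metis
  then have "(G *v v) \<bullet> w = v \<bullet> v"
    by (metis dot_lmul_matrix inner_commute transpose_matrix_vector)
  then show ?thesis
    by (simp add: weighted_norm_def w_def[symmetric] norm_eq_sqrt_inner)
qed

text \<open>On small balls around \<open>x0\<close> the density stays within \<open>e / 2\<close> of
  \<open>\<nu> x0\<close>, and so does its mean over the ball.\<close>

lemma ball_prob_density_limit:
  fixes \<nu> :: "'a::euclidean_space \<Rightarrow> real"
  assumes "prob_space M" and dist: "distributed M lborel X (\<lambda>x. ennreal (\<nu> x))"
    and nonneg: "\<And>x. 0 \<le> \<nu> x" and cont: "continuous_on UNIV \<nu>"
  shows "((\<lambda>\<epsilon>. measure M {\<omega> \<in> space M. norm (X \<omega> - x0) \<le> \<epsilon>} / measure lborel (cball (0 :: 'a) \<epsilon>)) \<longlongrightarrow> \<nu> x0) (at_right 0)"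
proof (rule tendstoI)
  fix e :: real assume "e > 0"
  interpret prob_space M by fact
  let ?V = "\<lambda>\<epsilon>. measure lborel (cball (0 :: 'a) \<epsilon>)"
  have [measurable]: "\<nu> \<in> borel_measurable borel" using cont by (rule borel_measurable_continuous_onI)
  have "isCont \<nu> x0" using cont by (simp add: continuous_on_eq_continuous_at)
  then obtain d where d: "d > 0" "\<And>x. dist x x0 < d \<Longrightarrow> dist (\<nu> x) (\<nu> x0) < e / 2"
    using \<open>e > 0\<close> unfolding continuous_at_eps_delta by (metis half_gt_zero)
  have "\<forall>\<^sub>F \<epsilon> in at_right 0. \<epsilon> \<in> {0<..<d}" using d(1) by (rule eventually_at_right_real)
  then show "\<forall>\<^sub>F \<epsilon> in at_right 0. dist (measure M {\<omega> \<in> space M. norm (X \<omega> - x0) \<le> \<epsilon>} / ?V \<epsilon>) (\<nu> x0) < e"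
  proof eventually_elim
    case (elim \<epsilon>)
    let ?B = "cball x0 \<epsilon>"
    have V: "emeasure lborel ?B = ennreal (?V \<epsilon>)" "?V \<epsilon> > 0"
    proof -
      have "emeasure lborel ?B = emeasure lborel (cball (0 :: 'a) \<epsilon>)"
        using elim by (simp add: emeasure_cball)
      also have fin: "\<dots> = ennreal (?V \<epsilon>)"
        by (rule emeasure_eq_ennreal_measure) (use elim in \<open>simp add: emeasure_cball\<close>)
      finally show "emeasure lborel ?B = ennreal (?V \<epsilon>)" .
      show "?V \<epsilon> > 0" using content_cball_pos[of \<epsilon> "0 :: 'a"] elim by simp
    qed
    have near: "\<nu> x0 - e / 2 \<le> \<nu> x \<and> \<nu> x \<le> \<nu> x0 + e / 2" if "x \<in> ?B" for x
    proof -
      have "dist (\<nu> x) (\<nu> x0) < e / 2" by (rule d(2)) (use that elim in \<open>simp add: dist_commute\<close>)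
      then show ?thesis unfolding dist_real_def by linarith
    qed
    have set_eq: "{\<omega> \<in> space M. norm (X \<omega> - x0) \<le> \<epsilon>} = X -` ?B \<inter> space M"
      by (auto simp: dist_norm norm_minus_commute)
    have P: "emeasure M (X -` ?B \<inter> space M) = (\<integral>\<^sup>+x. ennreal (\<nu> x) * indicator ?B x \<partial>lborel)"
      by (rule distributed_emeasure[OF dist]) simp
    let ?p = "measure M (X -` ?B \<inter> space M)"
    have "ennreal ?p \<le> (\<integral>\<^sup>+x. ennreal (\<nu> x0 + e / 2) * indicator ?B x \<partial>lborel)"
      unfolding emeasure_eq_measure[symmetric] P
      using near by (intro nn_integral_mono) (auto simp: indicator_def intro: ennreal_leI)
    also have "\<dots> = ennreal ((\<nu> x0 + e / 2) * ?V \<epsilon>)"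
      using V nonneg[of x0] \<open>e > 0\<close> by (subst nn_integral_cmult_indicator) (auto simp: ennreal_mult)
    finally have up: "?p \<le> (\<nu> x0 + e / 2) * ?V \<epsilon>"
      using V nonneg[of x0] \<open>e > 0\<close> by (subst (asm) ennreal_le_iff) auto
    \<comment> \<open>The lower bound may be negative, where \<open>ennreal\<close> would truncate
      it; \<open>max 0\<close> keeps the product rule applicable.\<close>
    have "ennreal (max 0 (\<nu> x0 - e / 2) * ?V \<epsilon>) = (\<integral>\<^sup>+x. ennreal (max 0 (\<nu> x0 - e / 2)) * indicator ?B x \<partial>lborel)"
      using V by (subst nn_integral_cmult_indicator) (auto simp: ennreal_mult)
    also have "\<dots> \<le> ennreal ?p"
      unfolding emeasure_eq_measure[symmetric] P
      using near nonneg by (intro nn_integral_mono) (auto simp: indicator_def intro!: ennreal_leI)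
    finally have "max 0 (\<nu> x0 - e / 2) * ?V \<epsilon> \<le> ?p" by (subst (asm) ennreal_le_iff) auto
    moreover have "(\<nu> x0 - e / 2) * ?V \<epsilon> \<le> max 0 (\<nu> x0 - e / 2) * ?V \<epsilon>"
      using V(2) by (intro mult_right_mono) auto
    ultimately have "(\<nu> x0 - e / 2) * ?V \<epsilon> \<le> ?p" by linarith
    then have "\<nu> x0 - e / 2 \<le> ?p / ?V \<epsilon>" using V(2) by (simp only: pos_le_divide_eq)
    moreover have "?p / ?V \<epsilon> \<le> \<nu> x0 + e / 2" using up V(2) by (simp only: pos_divide_le_eq)
    ultimately show ?case unfolding set_eq dist_real_def using \<open>e > 0\<close> by linarith
  qed
qed

section \<open>Posterior probabilities of tubes\<close>

text \<open>\<open>q t\<close> stands for \<open>\<psi> t (y t)\<close>, the likelihood at the fixed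
  measured value, and \<open>L\<close> for a Lipschitz constant of the drift in the state.\<close>

locale sde_posterior = wiener M T W
  for M :: "'w measure" and T :: real and W :: "real \<Rightarrow> 'w \<Rightarrow> real ^ 'n" +
  fixes X :: "real \<Rightarrow> 'w \<Rightarrow> real ^ 'n" and f :: "real \<Rightarrow> real ^ 'n \<Rightarrow> real ^ 'n"
    and G :: "real ^ 'n ^ 'n" and \<nu> :: "real ^ 'n \<Rightarrow> real"
    and Tm :: "real set" and q :: "real \<Rightarrow> real ^ 'n \<Rightarrow> real" and L :: real
  assumes f_cont: "continuous_on UNIV (\<lambda>(t, x). f t x)"
    and L_pos: "L > 0" and f_lipschitz: "\<And>t x y. norm (f t x - f t y) \<le> L * norm (x - y)"
    and G: "invertible G"
    and sde: "solves_sde M T f G W X"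
    and indep: "indep_of_process M T (X 0) W"
    and \<nu>_nonneg: "\<And>x. 0 \<le> \<nu> x" and \<nu>_cont: "continuous_on UNIV \<nu>"
    and X0_distributed: "distributed M lborel (X 0) (\<lambda>x. ennreal (\<nu> x))"
    and finite_Tm: "finite Tm" and Tm_subset: "Tm \<subseteq> {0..T}"
    and q_nonneg: "\<And>t x. t \<in> Tm \<Longrightarrow> 0 \<le> q t x"
    and q_cont: "\<And>t. t \<in> Tm \<Longrightarrow> continuous_on UNIV (q t)"
    and q_bounded: "\<And>t. t \<in> Tm \<Longrightarrow> bounded (range (q t))"
    and q_pos: "\<And>t. t \<in> Tm \<Longrightarrow> (LINT \<omega>|M. q t (X t \<omega>)) > 0"
begin

text \<open>The integral form of the state equation contains no derivative of \<open>\<eta>\<close>.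
  It is therefore meaningful for sample paths of \<open>W\<close> as well as for Cameron--Martin
  noises, and one estimate compares both.\<close>

definition is_path :: "(real \<Rightarrow> real ^ 'n) \<Rightarrow> (real \<Rightarrow> real ^ 'n) \<Rightarrow> real ^ 'n \<Rightarrow> bool" where
  "is_path \<phi> \<eta> x0 \<longleftrightarrow> continuous_on {0..T} \<phi> \<and>
     (\<forall>t\<in>{0..T}. \<phi> t = x0 + integral {0..t} (\<lambda>s. f s (\<phi> s)) + G *v \<eta> t)"

lemma drift_continuous:
  assumes "continuous_on S \<phi>"
  shows "continuous_on S (\<lambda>s. f s (\<phi> s))"
  using continuous_on_compose2[OF f_cont continuous_on_Pair[OF continuous_on_id assms]] by simp

lemma drift_integrable:
  assumes "continuous_on {0..T} \<phi>" "t \<le> T"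
  shows "(\<lambda>s. f s (\<phi> s)) integrable_on {0..t}"
  using assms by (intro integrable_continuous_real drift_continuous continuous_on_subset[OF assms(1)]) auto

lemma X_measurable: "t \<in> {0..T} \<Longrightarrow> X t \<in> borel_measurable M"
  using sde by (auto simp: solves_sde_def)

text \<open>The right-hand side of the integral equation is continuous in \<open>t\<close>, which
  makes almost all sample paths of \<open>X\<close> continuous; the Lebesgue integral agrees with
  the gauge integral.\<close>

lemma AE_is_path: "AE \<omega> in M. is_path (\<lambda>t. X t \<omega>) (\<lambda>t. W t \<omega>) (X 0 \<omega>)"
proof -
  have "AE \<omega> in M. set_integrable lebesgue {0..T} (\<lambda>s. f s (X s \<omega>)) \<and>
        (\<forall>t\<in>{0..T}. X t \<omega> = X 0 \<omega> + (LINT s:{0..t}|lebesgue. f s (X s \<omega>)) + G *v W t \<omega>)"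
    using sde by (simp add: solves_sde_def)
  with AE_space show ?thesis
  proof eventually_elim
    case (elim \<omega>)
    have eq: "X t \<omega> = X 0 \<omega> + integral {0..t} (\<lambda>s. f s (X s \<omega>)) + G *v W t \<omega>" if t: "t \<in> {0..T}" for t
    proof -
      have "set_integrable lebesgue {0..t} (\<lambda>s. f s (X s \<omega>))"
        using elim t by (auto intro: set_integrable_subset)
      from set_lebesgue_integral_eq_integral(2)[OF this] show ?thesis using elim(2) t by metis
    qed
    have "(\<lambda>s. f s (X s \<omega>)) integrable_on {0..T}"
      using elim by (auto intro: set_lebesgue_integral_eq_integral(1))
    then have "continuous_on {0..T} (\<lambda>t. X 0 \<omega> + integral {0..t} (\<lambda>s. f s (X s \<omega>)) + G *v W t \<omega>)"
      using W_continuous elim(1)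
      by (intro continuous_on_add continuous_on_const indefinite_integral_continuous_1
          continuous_on_compose2[OF linear_continuous_on[OF matrix_vector_mul_bounded_linear]]) auto
    moreover have "continuous_on {0..T} (\<lambda>t. X t \<omega>) \<longleftrightarrow>
        continuous_on {0..T} (\<lambda>t. X 0 \<omega> + integral {0..t} (\<lambda>s. f s (X s \<omega>)) + G *v W t \<omega>)"
      by (intro continuous_on_cong refl eq)
    ultimately show ?case using eq unfolding is_path_def by blast
  qed
qed

lemma integral_drift_diff_le:
  assumes "continuous_on {0..T} \<phi>1" "continuous_on {0..T} \<phi>2" "t \<in> {0..T}"
  shows "norm (integral {0..t} (\<lambda>s. f s (\<phi>1 s)) - integral {0..t} (\<lambda>s. f s (\<phi>2 s)))
    \<le> L * integral {0..t} (\<lambda>s. norm (\<phi>1 s - \<phi>2 s))"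
proof -
  have "continuous_on {0..t} \<phi>1" "continuous_on {0..t} \<phi>2"
    using assms(3) by (auto intro: continuous_on_subset[OF assms(1)] continuous_on_subset[OF assms(2)])
  then have "continuous_on {0..t} (\<lambda>s. norm (\<phi>1 s - \<phi>2 s))" by (intro continuous_intros)
  then have "(\<lambda>s. L * norm (\<phi>1 s - \<phi>2 s)) integrable_on {0..t}"
    by (intro integrable_continuous_real continuous_on_mult_left)
  moreover have i: "(\<lambda>s. f s (\<phi>1 s)) integrable_on {0..t}" "(\<lambda>s. f s (\<phi>2 s)) integrable_on {0..t}"
    using assms by (auto intro: drift_integrable)
  ultimately have "norm (integral {0..t} (\<lambda>s. f s (\<phi>1 s) - f s (\<phi>2 s))) \<le> integral {0..t} (\<lambda>s. L * norm (\<phi>1 s - \<phi>2 s))"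
    by (intro integral_norm_bound_integral integrable_diff f_lipschitz)
  then show ?thesis using Henstock_Kurzweil_Integration.integral_diff[OF i] by simp
qed

text \<open>Gronwall applied to the distance of two paths shows that the state path is Lipschitz in
  noise and initial state. One constant serves all pairs: a sample path against a deterministic
  path, and two sample paths against each other.\<close>

lemma path_close:
  obtains C where "C > 0"
    "\<And>\<phi>1 \<eta>1 x1 \<phi>2 \<eta>2 x2 e t. is_path \<phi>1 \<eta>1 x1 \<Longrightarrow> is_path \<phi>2 \<eta>2 x2 \<Longrightarrow> norm (x1 - x2) \<le> e \<Longrightarrow>
      \<forall>t\<in>{0..T}. norm (\<eta>1 t - \<eta>2 t) \<le> e \<Longrightarrow> t \<in> {0..T} \<Longrightarrow> norm (\<phi>1 t - \<phi>2 t) \<le> C * e"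
proof -
  obtain B where B: "B > 0" "\<And>x. norm (G *v x) \<le> B * norm x"
    using matrix_vector_mul_norm_bound by blast
  show thesis
  proof (rule that)
    show "2 * (1 + B) * exp (2 * L * T) > 0" using B(1) by simp
    fix \<phi>1 \<eta>1 x1 \<phi>2 \<eta>2 x2 e t
    assume 1: "is_path \<phi>1 \<eta>1 x1" and 2: "is_path \<phi>2 \<eta>2 x2" and x: "norm (x1 - x2) \<le> e"
      and \<eta>: "\<forall>t\<in>{0..T}. norm (\<eta>1 t - \<eta>2 t) \<le> e" and t: "t \<in> {0..T}"
    have c: "continuous_on {0..T} \<phi>1" "continuous_on {0..T} \<phi>2" using 1 2 by (auto simp: is_path_def)
    have "0 \<le> e" using x norm_ge_zero order_trans by blast
    have "norm (\<phi>1 t - \<phi>2 t) \<le> 2 * ((1 + B) * e) * exp (2 * L * T)"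
    proof (rule gronwall_bound[OF _ _ L_pos _ _ t])
      show "continuous_on {0..T} (\<lambda>t. norm (\<phi>1 t - \<phi>2 t))" by (intro continuous_intros c)
      show "0 \<le> (1 + B) * e" using B(1) \<open>0 \<le> e\<close> by simp
      fix t assume t: "t \<in> {0..T}"
      have "\<phi>1 t - \<phi>2 t = (x1 - x2) + (integral {0..t} (\<lambda>s. f s (\<phi>1 s)) - integral {0..t} (\<lambda>s. f s (\<phi>2 s))) + G *v (\<eta>1 t - \<eta>2 t)"
        using 1 2 t unfolding is_path_def by (simp add: matrix_vector_mult_diff_distrib)
      also have "norm \<dots> \<le> (e + L * integral {0..t} (\<lambda>s. norm (\<phi>1 s - \<phi>2 s))) + B * e"
      proof (intro norm_triangle_le add_mono x integral_drift_diff_le c t)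
        have "norm (G *v (\<eta>1 t - \<eta>2 t)) \<le> B * norm (\<eta>1 t - \<eta>2 t)" by (rule B(2))
        also have "\<dots> \<le> B * e" using \<eta> t B(1) by (intro mult_left_mono) auto
        finally show "norm (G *v (\<eta>1 t - \<eta>2 t)) \<le> B * e" .
      qed
      finally show "norm (\<phi>1 t - \<phi>2 t) \<le> (1 + B) * e + L * integral {0..t} (\<lambda>s. norm (\<phi>1 s - \<phi>2 s))"
        by (simp add: algebra_simps)
    qed (use T_pos in auto)
    then show "norm (\<phi>1 t - \<phi>2 t) \<le> 2 * (1 + B) * exp (2 * L * T) * e" by (simp add: mult_ac)
  qed
qed

section \<open>Prior probabilities of tubes\<close>

lemma tube_eq:
  assumes "continuous_on {0..T} \<eta>"
  shows "tube M T W (X 0) \<eta> x0 \<epsilon> = dyadic_tube \<eta> \<epsilon> \<inter> {\<omega> \<in> space M. norm (X 0 \<omega> - x0) \<le> \<epsilon>}"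
proof -
  have "(SUP t\<in>{0..T}. norm (W t \<omega> - \<eta> t)) \<le> \<epsilon> \<longleftrightarrow> \<omega> \<in> dyadic_tube \<eta> \<epsilon>" if \<omega>: "\<omega> \<in> space M" for \<omega>
  proof -
    have "continuous_on {0..T} (\<lambda>t. norm (W t \<omega> - \<eta> t))"
      by (intro continuous_intros W_continuous \<omega> assms)
    then have "bdd_above ((\<lambda>t. norm (W t \<omega> - \<eta> t)) ` {0..T})"
      by (intro bounded_imp_bdd_above compact_imp_bounded compact_continuous_image) auto
    then show ?thesis
      using T_pos unfolding mem_dyadic_tube_iff[OF \<omega> assms] by (subst cSUP_le_iff) auto
  qed
  then show ?thesis by (auto simp: tube_def)
qed

lemma X0_ball_sets: "{\<omega> \<in> space M. norm (X 0 \<omega> - x0) \<le> \<epsilon>} \<in> sets M"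
proof -
  have [measurable]: "X 0 \<in> borel_measurable M" using T_pos by (intro X_measurable) auto
  show ?thesis by measurable
qed

lemma tube_sets: "continuous_on {0..T} \<eta> \<Longrightarrow> tube M T W (X 0) \<eta> x0 \<epsilon> \<in> sets M"
  unfolding tube_eq by (intro sets.Int dyadic_tube_sets X0_ball_sets)

lemma tube_mono: "\<epsilon> \<le> \<epsilon>' \<Longrightarrow> tube M T W (X 0) \<eta> x0 \<epsilon> \<subseteq> tube M T W (X 0) \<eta> x0 \<epsilon>'"
  by (auto simp: tube_def)

text \<open>The tube event of \<open>W\<close> depends on dyadic times only, hence belongs to the
  product \<sigma>-algebra in which independence of \<open>X 0\<close> is expressed.\<close>

lemma prob_tube:
  assumes "continuous_on {0..T} \<eta>"
  shows "prob (tube M T W (X 0) \<eta> x0 \<epsilon>) =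
    prob (dyadic_tube \<eta> \<epsilon>) * prob {\<omega> \<in> space M. norm (X 0 \<omega> - x0) \<le> \<epsilon>}"
proof -
  let ?F = "\<lambda>\<omega>. \<lambda>t\<in>{0..T}. W t \<omega>" and ?P = "\<Pi>\<^sub>M t\<in>{0..T}. (borel :: (real ^ 'n) measure)"
  let ?A = "{x \<in> space ?P. \<forall>K j. j \<le> 2 ^ K \<longrightarrow> norm (x (T * real j / real (2 ^ K)) - \<eta> (T * real j / real (2 ^ K))) \<le> \<epsilon>}"
  have m: "(\<lambda>x. x (T * real j / real (2 ^ K))) \<in> borel_measurable ?P" if "j \<le> 2 ^ K" for j K
    using grid_mem[of "2 ^ K" j] that by (intro measurable_component_singleton) auto
  have A_sets: "?A \<in> sets ?P"
  proof -
    have "?A = (\<Inter>K. \<Inter>j\<in>{..2 ^ K}. {x \<in> space ?P. norm (x (T * real j / real (2 ^ K)) - \<eta> (T * real j / real (2 ^ K))) \<le> \<epsilon>})"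
      by auto
    also have "\<dots> \<in> sets ?P"
    proof (intro sets.countable_INT image_subsetI sets.finite_INT)
      fix K j assume "j \<in> {..(2 :: nat) ^ K}"
      then have [measurable]: "(\<lambda>x. x (T * real j / real (2 ^ K))) \<in> borel_measurable ?P" by (intro m) simp
      show "{x \<in> space ?P. norm (x (T * real j / real (2 ^ K)) - \<eta> (T * real j / real (2 ^ K))) \<le> \<epsilon>} \<in> sets ?P"
        by measurable
    qed auto
    finally show ?thesis .
  qed
  have dyadic_eq: "dyadic_tube \<eta> \<epsilon> = ?F -` ?A \<inter> space M"
  proof -
    have "?F \<omega> (T * real j / real (2 ^ K)) = W (T * real j / real (2 ^ K)) \<omega>" if "j \<le> 2 ^ K" for j K \<omega>
      using grid_mem[of "2 ^ K" j] that by simp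
    then show ?thesis unfolding dyadic_tube_def grid_tube_def by (auto simp: space_PiM)
  qed
  have D: "dyadic_tube \<eta> \<epsilon> \<in> sets (vimage_algebra (space M) ?F ?P)"
    unfolding dyadic_eq by (rule in_vimage_algebra[OF A_sets])
  have ball_eq: "{\<omega> \<in> space M. norm (X 0 \<omega> - x0) \<le> \<epsilon>} = X 0 -` cball x0 \<epsilon> \<inter> space M"
    by (auto simp: dist_norm norm_minus_commute)
  have B: "{\<omega> \<in> space M. norm (X 0 \<omega> - x0) \<le> \<epsilon>} \<in> sets (vimage_algebra (space M) (X 0) borel)"
    unfolding ball_eq by (rule in_vimage_algebra) simp
  have "prob ({\<omega> \<in> space M. norm (X 0 \<omega> - x0) \<le> \<epsilon>} \<inter> dyadic_tube \<eta> \<epsilon>) =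
      prob {\<omega> \<in> space M. norm (X 0 \<omega> - x0) \<le> \<epsilon>} * prob (dyadic_tube \<eta> \<epsilon>)"
    by (rule indep_setD[OF indep[unfolded indep_of_process_def] B D])
  then show ?thesis unfolding tube_eq[OF assms] by (simp add: Int_commute mult.commute)
qed

text \<open>Centered small-ball probability of the noise times the volume of the ball of initial
  states: the denominators of \<open>small_ball_ratio\<close> and
  \<open>ball_prob_density_limit\<close>.\<close>

definition reference :: "real \<Rightarrow> real" where
  "reference \<epsilon> = prob (dyadic_tube (\<lambda>_. 0) \<epsilon>) * measure lborel (cball (0 :: real ^ 'n) \<epsilon>)"

lemma reference_pos: "\<epsilon> > 0 \<Longrightarrow> reference \<epsilon> > 0"
  unfolding reference_def using prob_dyadic_tube_pos content_cball_pos[of \<epsilon> "0 :: real ^ 'n"] by simp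

lemma eventually_reference_pos: "\<forall>\<^sub>F \<epsilon> in at_right 0. reference \<epsilon> > 0"
  using eventually_at_right_less[of "0 :: real"] by eventually_elim (rule reference_pos)

lemma prob_tube_limit:
  assumes \<eta>: "\<eta> \<in> cameron_martin T" "\<eta> 0 = 0"
  shows "((\<lambda>\<epsilon>. prob (tube M T W (X 0) \<eta> x0 \<epsilon>) / reference \<epsilon>) \<longlongrightarrow> exp (- path_energy T \<eta> / 2) * \<nu> x0) (at_right 0)"
proof -
  have "(\<lambda>\<epsilon>. prob (tube M T W (X 0) \<eta> x0 \<epsilon>) / reference \<epsilon>) =
    (\<lambda>\<epsilon>. (prob (dyadic_tube \<eta> \<epsilon>) / prob (dyadic_tube (\<lambda>_. 0) \<epsilon>)) *
       (prob {\<omega> \<in> space M. norm (X 0 \<omega> - x0) \<le> \<epsilon>} / measure lborel (cball (0 :: real ^ 'n) \<epsilon>)))"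
    by (simp add: prob_tube[OF cameron_martinD(4)[OF \<eta>(1)]] reference_def)
  then show ?thesis
    using tendsto_mult[OF small_ball_ratio[OF \<eta>]
        ball_prob_density_limit[OF prob_space_axioms X0_distributed \<nu>_nonneg \<nu>_cont, of x0]] by simp
qed

section \<open>Likelihood weights and posterior masses\<close>

definition weight :: "'w \<Rightarrow> real" where
  "weight \<omega> = (\<Prod>t\<in>Tm. q t (X t \<omega>))"

text \<open>Numerator of Bayes' rule; the denominator is its value at
  \<open>space M\<close>.\<close>

definition weighted_mass :: "'w set \<Rightarrow> real" where
  "weighted_mass A = (LINT \<omega>|M. indicator A \<omega> * weight \<omega>)"

lemma weight_measurable[measurable]: "weight \<in> borel_measurable M"
proof -
  have "(\<lambda>\<omega>. q t (X t \<omega>)) \<in> borel_measurable M" if "t \<in> Tm" for t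
    using X_measurable borel_measurable_continuous_onI[OF q_cont[OF that]] that Tm_subset
    by (auto intro: measurable_compose)
  then show ?thesis unfolding weight_def by (intro borel_measurable_prod)
qed

lemma weight_nonneg: "0 \<le> weight \<omega>"
  unfolding weight_def by (intro prod_nonneg q_nonneg) auto

lemma weight_bounded: obtains C where "C > 0" "\<And>\<omega>. weight \<omega> \<le> C"
proof -
  have "\<forall>t\<in>Tm. \<exists>b>0. \<forall>x. q t x \<le> b"
    using q_bounded unfolding bounded_pos by (metis abs_le_D1 rangeI real_norm_def)
  then obtain b where b: "\<And>t. t \<in> Tm \<Longrightarrow> b t > 0" "\<And>t x. t \<in> Tm \<Longrightarrow> q t x \<le> b t" by metis
  show thesis
  proof (rule that)
    show "(\<Prod>t\<in>Tm. b t) > 0" using b by (intro prod_pos) auto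
    show "weight \<omega> \<le> (\<Prod>t\<in>Tm. b t)" for \<omega>
      unfolding weight_def using b q_nonneg by (intro prod_mono) auto
  qed
qed

lemma weight_integrable:
  assumes "A \<in> sets M"
  shows "integrable M (\<lambda>\<omega>. indicator A \<omega> * weight \<omega>)"
proof -
  obtain C where C: "C > 0" "\<And>\<omega>. weight \<omega> \<le> C" using weight_bounded by blast
  show ?thesis
  proof (rule integrable_const_bound)
    show "AE \<omega> in M. norm (indicator A \<omega> * weight \<omega>) \<le> C"
      using C weight_nonneg by (auto simp: indicator_def less_imp_le)
    show "(\<lambda>\<omega>. indicator A \<omega> * weight \<omega>) \<in> borel_measurable M" using assms by measurable
  qed
qed

lemma weighted_mass_nonneg: "0 \<le> weighted_mass A"
  unfolding weighted_mass_def by (intro integral_nonneg_AE) (auto simp: weight_nonneg)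

lemma weighted_mass_mono:
  assumes "A \<in> sets M" "B \<in> sets M" "A \<subseteq> B"
  shows "weighted_mass A \<le> weighted_mass B"
  unfolding weighted_mass_def
  using assms weight_nonneg by (intro integral_mono weight_integrable) (auto simp: indicator_def)

lemma weighted_mass_bounds:
  assumes A: "A \<in> sets M" and w: "AE \<omega> in M. \<omega> \<in> A \<longrightarrow> a \<le> weight \<omega> \<and> weight \<omega> \<le> b"
  shows "a * prob A \<le> weighted_mass A" "weighted_mass A \<le> b * prob A"
proof -
  have i: "integrable M (\<lambda>\<omega>. indicator A \<omega> * c)" "(LINT \<omega>|M. indicator A \<omega> * c) = c * prob A" for c :: real
    using A by (auto simp: integrable_indicator_iff emeasure_eq_measure)
  have "(LINT \<omega>|M. indicator A \<omega> * a) \<le> weighted_mass A"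
    unfolding weighted_mass_def using w
    by (intro integral_mono_AE i weight_integrable A) (auto simp: indicator_def elim: eventually_mono)
  then show "a * prob A \<le> weighted_mass A" by (simp only: i(2))
  have "weighted_mass A \<le> (LINT \<omega>|M. indicator A \<omega> * b)"
    unfolding weighted_mass_def using w
    by (intro integral_mono_AE i weight_integrable A) (auto simp: indicator_def elim: eventually_mono)
  then show "weighted_mass A \<le> b * prob A" by (simp only: i(2))
qed

definition scaled_mass :: "(real \<Rightarrow> real ^ 'n) \<Rightarrow> real ^ 'n \<Rightarrow> real \<Rightarrow> real" where
  "scaled_mass \<eta> x0 \<epsilon> = weighted_mass (tube M T W (X 0) \<eta> x0 \<epsilon>) / reference \<epsilon>"

lemma scaled_mass_limit_0:
  assumes "continuous_on {0..T} \<eta>"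
    and lim: "((\<lambda>\<epsilon>. prob (tube M T W (X 0) \<eta> x0 \<epsilon>) / reference \<epsilon>) \<longlongrightarrow> 0) (at_right 0)"
  shows "(scaled_mass \<eta> x0 \<longlongrightarrow> 0) (at_right 0)"
proof -
  obtain C where C: "C > 0" "\<And>\<omega>. weight \<omega> \<le> C" using weight_bounded by blast
  show ?thesis
  proof (rule Lim_null_comparison)
    show "\<forall>\<^sub>F \<epsilon> in at_right 0. norm (scaled_mass \<eta> x0 \<epsilon>) \<le> C * (prob (tube M T W (X 0) \<eta> x0 \<epsilon>) / reference \<epsilon>)"
      using eventually_reference_pos
    proof eventually_elim
      case (elim \<epsilon>)
      have "weighted_mass (tube M T W (X 0) \<eta> x0 \<epsilon>) \<le> C * prob (tube M T W (X 0) \<eta> x0 \<epsilon>)"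
        by (rule weighted_mass_bounds(2)[OF tube_sets[OF assms(1)], where a = 0]) (auto simp: C weight_nonneg)
      then show ?case
        using elim weighted_mass_nonneg by (simp add: scaled_mass_def divide_right_mono)
    qed
    show "((\<lambda>\<epsilon>. C * (prob (tube M T W (X 0) \<eta> x0 \<epsilon>) / reference \<epsilon>)) \<longlongrightarrow> 0) (at_right 0)"
      using tendsto_mult_left[OF lim, of C] by simp
  qed
qed

lemma scaled_mass_limit:
  assumes \<eta>: "\<eta> \<in> cameron_martin T" "\<eta> 0 = 0" and \<phi>: "is_path \<phi> \<eta> x0"
  shows "(scaled_mass \<eta> x0 \<longlongrightarrow> exp (- path_energy T \<eta> / 2) * \<nu> x0 * (\<Prod>t\<in>Tm. q t (\<phi> t))) (at_right 0)"
proof -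
  let ?l = "exp (- path_energy T \<eta> / 2) * \<nu> x0" and ?w = "\<Prod>t\<in>Tm. q t (\<phi> t)"
  let ?p = "\<lambda>\<epsilon>. prob (tube M T W (X 0) \<eta> x0 \<epsilon>) / reference \<epsilon>"
  have c: "continuous_on {0..T} \<eta>" by (rule cameron_martinD(4)[OF \<eta>(1)])
  have l: "(?p \<longlongrightarrow> ?l) (at_right 0)" by (rule prob_tube_limit[OF \<eta>])
  have "?l \<ge> 0" using \<nu>_nonneg by simp
  obtain C where C: "C > 0"
    "\<And>\<phi>1 \<eta>1 x1 \<phi>2 \<eta>2 x2 e t. is_path \<phi>1 \<eta>1 x1 \<Longrightarrow> is_path \<phi>2 \<eta>2 x2 \<Longrightarrow> norm (x1 - x2) \<le> e \<Longrightarrow>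
      \<forall>t\<in>{0..T}. norm (\<eta>1 t - \<eta>2 t) \<le> e \<Longrightarrow> t \<in> {0..T} \<Longrightarrow> norm (\<phi>1 t - \<phi>2 t) \<le> C * e"
    using path_close by blast
  have "((\<lambda>\<epsilon>. scaled_mass \<eta> x0 \<epsilon> - ?w * ?p \<epsilon>) \<longlongrightarrow> 0) (at_right 0)"
  proof (rule tendstoI)
    fix e :: real assume "e > 0"
    \<comment> \<open>The normalised prior probability is eventually below \<open>?l + 1\<close>;
      dividing by \<open>?l + 2\<close> makes the final estimate strict, also for
      \<open>?l = 0\<close>.\<close>
    define d where "d = e / (?l + 2)"
    have "d > 0" using \<open>e > 0\<close> \<open>?l \<ge> 0\<close> by (simp add: d_def)
    obtain r where r: "r > 0" "\<And>z. \<forall>t\<in>Tm. norm (z t - \<phi> t) \<le> r \<Longrightarrow> \<bar>(\<Prod>t\<in>Tm. q t (z t)) - ?w\<bar> < d"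
      using prod_continuity_modulus[where q = q and x = \<phi>, OF finite_Tm q_cont \<open>d > 0\<close>] by blast
    have "\<forall>\<^sub>F \<epsilon> in at_right 0. \<epsilon> \<in> {0<..<r / C}" using r(1) C(1) by (intro eventually_at_right_real) simp
    moreover have "\<forall>\<^sub>F \<epsilon> in at_right 0. ?p \<epsilon> < ?l + 1" using l by (intro order_tendstoD(2)) auto
    ultimately show "\<forall>\<^sub>F \<epsilon> in at_right 0. dist (scaled_mass \<eta> x0 \<epsilon> - ?w * ?p \<epsilon>) 0 < e"
      using eventually_reference_pos
    proof eventually_elim
      case (elim \<epsilon>)
      let ?A = "tube M T W (X 0) \<eta> x0 \<epsilon>"
      have w: "AE \<omega> in M. \<omega> \<in> ?A \<longrightarrow> ?w - d \<le> weight \<omega> \<and> weight \<omega> \<le> ?w + d"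
        using AE_is_path
      proof eventually_elim
        case path: (elim \<omega>)
        show ?case
        proof
          assume \<omega>: "\<omega> \<in> ?A"
          then have m: "\<omega> \<in> space M" "\<omega> \<in> dyadic_tube \<eta> \<epsilon>" "norm (X 0 \<omega> - x0) \<le> \<epsilon>"
            unfolding tube_eq[OF c] by auto
          then have W: "\<forall>t\<in>{0..T}. norm (W t \<omega> - \<eta> t) \<le> \<epsilon>" by (simp add: mem_dyadic_tube_iff c)
          have "C * \<epsilon> \<le> r" using elim(1) C(1) by (simp add: pos_less_divide_eq mult.commute less_imp_le)
          have "\<forall>t\<in>Tm. norm (X t \<omega> - \<phi> t) \<le> r"
          proof
            fix t assume "t \<in> Tm"
            then have "norm (X t \<omega> - \<phi> t) \<le> C * \<epsilon>" using Tm_subset by (intro C(2)[OF path \<phi> m(3) W]) auto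
            then show "norm (X t \<omega> - \<phi> t) \<le> r" using \<open>C * \<epsilon> \<le> r\<close> by linarith
          qed
          then have "\<bar>weight \<omega> - ?w\<bar> < d" unfolding weight_def by (rule r(2))
          then show "?w - d \<le> weight \<omega> \<and> weight \<omega> \<le> ?w + d" by linarith
        qed
      qed
      note b = weighted_mass_bounds[OF tube_sets[OF c] w]
      have "(?w - d) * ?p \<epsilon> \<le> scaled_mass \<eta> x0 \<epsilon>" "scaled_mass \<eta> x0 \<epsilon> \<le> (?w + d) * ?p \<epsilon>"
        using divide_right_mono[OF b(1) less_imp_le[OF elim(3)]] divide_right_mono[OF b(2) less_imp_le[OF elim(3)]]
        by (simp_all add: scaled_mass_def)
      then have "\<bar>scaled_mass \<eta> x0 \<epsilon> - ?w * ?p \<epsilon>\<bar> \<le> d * ?p \<epsilon>"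
        unfolding left_diff_distrib distrib_right by linarith
      also have "\<dots> \<le> d * (?l + 1)" using elim(2) \<open>d > 0\<close> by (intro mult_left_mono) auto
      also have "\<dots> < d * (?l + 2)" using \<open>d > 0\<close> by (intro mult_strict_left_mono) auto
      also have "\<dots> = e" using \<open>?l \<ge> 0\<close> by (simp add: d_def)
      finally show ?case by (simp add: dist_real_def)
    qed
  qed
  from tendsto_add[OF this tendsto_mult_left[OF l, of ?w]]
  show ?thesis by (simp add: mult_ac)
qed

text \<open>A path driven by \<open>\<eta>\<close> arises as the uniform limit of sample paths of \<open>X\<close> picked from
  shrinking tubes around \<open>(\<eta>, x0)\<close>, all of which have positive probability.\<close>

lemma is_path_exists:
  assumes c: "continuous_on {0..T} \<eta>" and pos: "\<And>\<epsilon>. \<epsilon> > 0 \<Longrightarrow> prob (tube M T W (X 0) \<eta> x0 \<epsilon>) > 0"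
  shows "\<exists>\<phi>. is_path \<phi> \<eta> x0"
proof -
  obtain C where C: "C > 0"
    "\<And>\<phi>1 \<eta>1 x1 \<phi>2 \<eta>2 x2 e t. is_path \<phi>1 \<eta>1 x1 \<Longrightarrow> is_path \<phi>2 \<eta>2 x2 \<Longrightarrow> norm (x1 - x2) \<le> e \<Longrightarrow>
      \<forall>t\<in>{0..T}. norm (\<eta>1 t - \<eta>2 t) \<le> e \<Longrightarrow> t \<in> {0..T} \<Longrightarrow> norm (\<phi>1 t - \<phi>2 t) \<le> C * e"
    using path_close by blast
  obtain B where B: "B > 0" "\<And>x. norm (G *v x) \<le> B * norm x"
    using matrix_vector_mul_norm_bound by blast
  let ?e = "\<lambda>n. 1 / real (Suc n)"
  \<comment> \<open>A tube of positive probability must meet the almost sure event that the sample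
    path solves the state equation.\<close>
  have "\<exists>\<omega>. \<omega> \<in> tube M T W (X 0) \<eta> x0 (?e n) \<and> is_path (\<lambda>t. X t \<omega>) (\<lambda>t. W t \<omega>) (X 0 \<omega>)" for n
  proof (rule ccontr)
    assume neg: "\<not> ?thesis"
    have "AE \<omega> in M. \<omega> \<notin> tube M T W (X 0) \<eta> x0 (?e n)"
      using AE_is_path by eventually_elim (use neg in blast)
    then have "prob (tube M T W (X 0) \<eta> x0 (?e n)) = 0"
      using tube_sets[OF c] by (simp add: prob_eq_0)
    then show False using pos[of "?e n"] by simp
  qed
  then obtain \<omega> where \<omega>: "\<And>n. \<omega> n \<in> tube M T W (X 0) \<eta> x0 (?e n)"
    "\<And>n. is_path (\<lambda>t. X t (\<omega> n)) (\<lambda>t. W t (\<omega> n)) (X 0 (\<omega> n))" by metis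
  have W: "norm (W t (\<omega> n) - \<eta> t) \<le> ?e n" if "t \<in> {0..T}" for t n
    using \<omega>(1)[of n] that unfolding tube_eq[OF c] by (auto simp: mem_dyadic_tube_iff[OF _ c])
  have X0: "norm (X 0 (\<omega> n) - x0) \<le> ?e n" for n
    using \<omega>(1)[of n] unfolding tube_eq[OF c] by auto
  have e_mono: "?e n \<le> ?e N" if "N \<le> n" for n N using that by (intro divide_left_mono) auto
  \<comment> \<open>Two samples from tubes of radius at most \<open>?e N\<close> around the same
    centre differ by at most \<open>2 * ?e N\<close> in noise and initial state.\<close>
  have cauchy: "norm (X t (\<omega> m) - X t (\<omega> n)) \<le> C * (2 * ?e N)" if "N \<le> m" "N \<le> n" "t \<in> {0..T}" for t m n N
  proof (rule C(2)[OF \<omega>(2) \<omega>(2) _ _ that(3)])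
    have tri: "norm (a - b) \<le> 2 * ?e N" if "norm (a - z) \<le> ?e m" "norm (b - z) \<le> ?e n" for a b z :: "real ^ 'n"
      using norm_triangle_ineq4[of "a - z" "b - z"] that e_mono[OF \<open>N \<le> m\<close>] e_mono[OF \<open>N \<le> n\<close>] by simp
    show "norm (X 0 (\<omega> m) - X 0 (\<omega> n)) \<le> 2 * ?e N" by (rule tri[OF X0 X0])
    show "\<forall>t\<in>{0..T}. norm (W t (\<omega> m) - W t (\<omega> n)) \<le> 2 * ?e N"
    proof
      fix t assume t: "t \<in> {0..T}"
      show "norm (W t (\<omega> m) - W t (\<omega> n)) \<le> 2 * ?e N" by (rule tri[OF W[OF t] W[OF t]])
    qed
  qed
  have e_lim: "(\<lambda>n. ?e n) \<longlonglongrightarrow> 0" by (rule LIMSEQ_Suc[OF lim_1_over_n])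
  then have Ce_lim: "(\<lambda>n. C * (2 * ?e n)) \<longlonglongrightarrow> 0"
    using tendsto_mult_left[OF tendsto_mult_left[OF e_lim, of 2], of C] by simp
  have "uniformly_convergent_on {0..T} (\<lambda>n t. X t (\<omega> n))"
  proof (rule Cauchy_uniformly_convergent, rule uniformly_Cauchy_onI)
    fix r :: real assume "r > 0"
    then have "\<forall>\<^sub>F N in sequentially. C * (2 * ?e N) < r" by (rule order_tendstoD(2)[OF Ce_lim])
    then obtain N where N: "C * (2 * ?e N) < r" by (auto simp: eventually_sequentially)
    show "\<exists>N. \<forall>t\<in>{0..T}. \<forall>m\<ge>N. \<forall>n\<ge>N. dist (X t (\<omega> m)) (X t (\<omega> n)) < r"
      using cauchy[of N] N unfolding dist_norm by (intro exI[of _ N]) (meson le_less_trans)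
  qed
  then obtain \<phi> where lim: "uniform_limit {0..T} (\<lambda>n t. X t (\<omega> n)) \<phi> sequentially"
    unfolding uniformly_convergent_on_def by blast
  have cX: "continuous_on {0..T} (\<lambda>t. X t (\<omega> n))" for n using \<omega>(2) by (simp add: is_path_def)
  have c\<phi>: "continuous_on {0..T} \<phi>"
    by (rule uniform_limit_theorem[OF _ lim]) (simp_all add: cX)
  have close: "norm (X t (\<omega> n) - \<phi> t) \<le> C * (2 * ?e n)" if t: "t \<in> {0..T}" for t n
  proof (rule LIMSEQ_le_const2)
    have "(\<lambda>m. X t (\<omega> m)) \<longlonglongrightarrow> \<phi> t" by (rule tendsto_uniform_limitI[OF lim t])
    then show "(\<lambda>m. norm (X t (\<omega> n) - X t (\<omega> m))) \<longlonglongrightarrow> norm (X t (\<omega> n) - \<phi> t)" by (intro tendsto_intros)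
    show "\<exists>N. \<forall>m\<ge>N. norm (X t (\<omega> n) - X t (\<omega> m)) \<le> C * (2 * ?e n)"
      using cauchy[of n n] t by (intro exI[of _ n]) auto
  qed
  have "\<phi> t = x0 + integral {0..t} (\<lambda>s. f s (\<phi> s)) + G *v \<eta> t" if t: "t \<in> {0..T}" for t
  proof (rule LIMSEQ_unique)
    show "(\<lambda>n. X t (\<omega> n)) \<longlonglongrightarrow> \<phi> t" by (rule tendsto_uniform_limitI[OF lim t])
    have "(\<lambda>n. X 0 (\<omega> n)) \<longlonglongrightarrow> x0"
      by (rule LIM_zero_cancel, rule Lim_null_comparison[OF _ e_lim]) (rule always_eventually, rule allI, rule X0)
    moreover have "(\<lambda>n. W t (\<omega> n)) \<longlonglongrightarrow> \<eta> t"
      by (rule LIM_zero_cancel, rule Lim_null_comparison[OF _ e_lim]) (rule always_eventually, rule allI, rule W[OF t])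
    then have "(\<lambda>n. G *v W t (\<omega> n)) \<longlonglongrightarrow> G *v \<eta> t"
      by (rule bounded_linear.tendsto[OF matrix_vector_mul_bounded_linear])
    moreover have "(\<lambda>n. integral {0..t} (\<lambda>s. f s (X s (\<omega> n)))) \<longlonglongrightarrow> integral {0..t} (\<lambda>s. f s (\<phi> s))"
    proof (rule LIM_zero_cancel, rule Lim_null_comparison)
      show "(\<lambda>n. L * (T * (C * (2 * ?e n)))) \<longlonglongrightarrow> 0"
        using tendsto_mult_left[OF tendsto_mult_left[OF Ce_lim, of T], of L] by simp
      show "\<forall>\<^sub>F n in sequentially. norm (integral {0..t} (\<lambda>s. f s (X s (\<omega> n))) - integral {0..t} (\<lambda>s. f s (\<phi> s)))
          \<le> L * (T * (C * (2 * ?e n)))"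
      proof (rule always_eventually, rule allI)
        fix n
        have "integral {0..t} (\<lambda>s. norm (X s (\<omega> n) - \<phi> s)) \<le> integral {0..t} (\<lambda>s. C * (2 * ?e n))"
          using t close
          by (intro integral_le integrable_continuous_real continuous_intros
              continuous_on_subset[OF cX] continuous_on_subset[OF c\<phi>]) auto
        also have "\<dots> = t * (C * (2 * ?e n))" using t by simp
        also have "\<dots> \<le> T * (C * (2 * ?e n))" using t C(1) by (intro mult_right_mono) auto
        finally have "L * integral {0..t} (\<lambda>s. norm (X s (\<omega> n) - \<phi> s)) \<le> L * (T * (C * (2 * ?e n)))"
          using L_pos by (intro mult_left_mono) auto
        with integral_drift_diff_le[OF cX c\<phi> t]
        show "norm (integral {0..t} (\<lambda>s. f s (X s (\<omega> n))) - integral {0..t} (\<lambda>s. f s (\<phi> s))) \<le> L * (T * (C * (2 * ?e n)))"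
          by (rule order_trans)
      qed
    qed
    ultimately have "(\<lambda>n. X 0 (\<omega> n) + integral {0..t} (\<lambda>s. f s (X s (\<omega> n))) + G *v W t (\<omega> n)) \<longlonglongrightarrow>
        x0 + integral {0..t} (\<lambda>s. f s (\<phi> s)) + G *v \<eta> t"
      by (intro tendsto_add)
    moreover have "X t (\<omega> n) = X 0 (\<omega> n) + integral {0..t} (\<lambda>s. f s (X s (\<omega> n))) + G *v W t (\<omega> n)" for n
      using \<omega>(2)[of n] t unfolding is_path_def by blast
    ultimately show "(\<lambda>n. X t (\<omega> n)) \<longlonglongrightarrow> x0 + integral {0..t} (\<lambda>s. f s (\<phi> s)) + G *v \<eta> t" by simp
  qed
  then show ?thesis using c\<phi> unfolding is_path_def by blast
qed

end

section \<open>State paths and MAP estimates\<close>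

lemma cameron_martin_const: "T > 0 \<Longrightarrow> (\<lambda>_. c :: 'a::euclidean_space) \<in> cameron_martin T"
proof -
  assume "T > 0"
  have "path_deriv T (\<lambda>_. c) t = 0" if "t \<in> {0..T}" for t
    by (rule path_deriv_eqI[OF \<open>T > 0\<close> that]) (rule has_vector_derivative_const)
  then have eq: "(\<lambda>t. indicator {0..T} t *\<^sub>R path_deriv T (\<lambda>_. c) t) = (\<lambda>_. 0)"
    "(\<lambda>t. indicator {0..T} t *\<^sub>R (norm (path_deriv T (\<lambda>_. c) t))\<^sup>2) = (\<lambda>_. 0)"
    by (auto simp: fun_eq_iff indicator_def)
  have "absolutely_continuous_path 0 T (\<lambda>_. c)"
    unfolding absolutely_continuous_path_iff by (auto intro!: exI[of _ 1])
  then show ?thesis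
    by (simp add: cameron_martin_def square_integrable_on_def set_borel_measurable_def set_integrable_def eq del: real_scaleR_def)
qed

lemma cameron_martin_polynomial:
  fixes p :: "real \<Rightarrow> real ^ 'n"
  assumes "polynomial_function p" "T > 0"
  shows "p \<in> cameron_martin T"
proof -
  obtain p' where p': "polynomial_function p'" "\<And>x. (p has_vector_derivative (p' x)) (at x)"
    using has_vector_derivative_polynomial_function[OF assms(1)] by blast
  show ?thesis
  proof (rule cameron_martin_affine(1)[OF cameron_martin_const \<open>T > 0\<close>, where A = "mat 0" and g = p' and c = "p 0"])
    show "T > 0" by fact
    show "continuous_on {0..T} p'" by (rule continuous_on_polymonial_function[OF p'(1)])
    fix t assume t: "t \<in> {0..T}"
    have "(p' has_integral (p t - p 0)) {0..t}"
      using t p'(2) by (intro fundamental_theorem_of_calculus) (auto intro: has_vector_derivative_at_within)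
    then have "integral {0..t} p' = p t - p 0" by (rule integral_unique)
    then show "p t = mat 0 *v 0 + integral {0..t} p' + p 0" by simp
  qed
qed

text \<open>Lagrange interpolation. It will supply a path through states of positive likelihood at
  the measurement times.\<close>

lemma cameron_martin_interpolation:
  fixes z :: "real \<Rightarrow> real ^ 'n"
  assumes "finite S" "T > 0"
  shows "\<exists>p\<in>cameron_martin T. \<forall>s\<in>S. p s = z s"
proof
  define l where "l s t = (\<Prod>r\<in>S - {s}. (t - r) * (1 / (s - r)))" for s t :: real
  define p where "p t = (\<Sum>s\<in>S. l s t *\<^sub>R z s)" for t
  have "real_polynomial_function (l s)" for s
    unfolding l_def using assms(1)
    by (intro real_polynomial_function_prod real_polynomial_function.intros real_polynomial_function_diff)
       (auto intro: real_polynomial_function.intros bounded_linear_ident)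
  then have "polynomial_function (l s)" for s by (simp add: real_polynomial_function_eq)
  then have "polynomial_function p"
    unfolding p_def using assms(1) by (intro polynomial_function_sum polynomial_function_mult) auto
  then show "p \<in> cameron_martin T" using \<open>T > 0\<close> by (rule cameron_martin_polynomial)
  show "\<forall>s\<in>S. p s = z s"
  proof
    fix s assume s: "s \<in> S"
    have "l r s = 0" if "r \<in> S" "r \<noteq> s" for r
      unfolding l_def using assms(1) s that by (intro prod_zero) auto
    moreover have "l s s = 1" unfolding l_def by (intro prod.neutral) auto
    ultimately have "p s = (\<Sum>r\<in>S. if r = s then z s else 0)"
      unfolding p_def by (intro sum.cong) auto
    then show "p s = z s" using assms(1) s by simp
  qed
qed

context sde_posterior
begin

lemma is_path_0: "is_path \<phi> \<eta> x0 \<Longrightarrow> \<eta> 0 = 0 \<Longrightarrow> \<phi> 0 = x0"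
  using T_pos unfolding is_path_def by (auto dest: bspec[of _ _ 0])

lemma is_path_cameron_martin:
  assumes \<eta>: "\<eta> \<in> cameron_martin T" and \<phi>: "is_path \<phi> \<eta> x0"
  shows "\<phi> \<in> cameron_martin T"
    and "AE t in lebesgue_on {0..T}. path_deriv T \<phi> t = G *v path_deriv T \<eta> t + f t (\<phi> t)"
proof -
  have c: "continuous_on {0..T} (\<lambda>s. f s (\<phi> s))"
    using \<phi> by (intro drift_continuous) (simp add: is_path_def)
  have eq: "\<phi> t = G *v \<eta> t + integral {0..t} (\<lambda>s. f s (\<phi> s)) + x0" if "t \<in> {0..T}" for t
    using \<phi> that unfolding is_path_def by (simp add: add_ac)
  show "\<phi> \<in> cameron_martin T"
    "AE t in lebesgue_on {0..T}. path_deriv T \<phi> t = G *v path_deriv T \<eta> t + f t (\<phi> t)"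
    using cameron_martin_affine[OF \<eta> T_pos c eq] by blast+
qed

text \<open>The derivative of an absolutely continuous path integrates back to the path, so the
  almost everywhere equation can be integrated; the converse differentiates the integral
  equation.\<close>

lemma associated_state_path_iff:
  assumes \<eta>: "\<eta> \<in> cameron_martin T" "\<eta> 0 = 0"
  shows "associated_state_path T f G \<eta> x0 \<phi> \<longleftrightarrow> is_path \<phi> \<eta> x0"
proof
  assume "is_path \<phi> \<eta> x0"
  then show "associated_state_path T f G \<eta> x0 \<phi>"
    using is_path_cameron_martin[OF \<eta>(1)] is_path_0 \<eta>(2)
    by (auto simp: associated_state_path_def add.commute)
next
  assume "associated_state_path T f G \<eta> x0 \<phi>"
  then have \<phi>: "\<phi> \<in> cameron_martin T" "\<phi> 0 = x0"
    "AE t in lebesgue_on {0..T}. path_deriv T \<phi> t = f t (\<phi> t) + G *v path_deriv T \<eta> t"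
    by (auto simp: associated_state_path_def)
  have c: "continuous_on {0..T} \<phi>" by (rule cameron_martinD(4)[OF \<phi>(1)])
  have "AE t in lebesgue. t \<in> {0..T} \<longrightarrow> path_deriv T \<phi> t = f t (\<phi> t) + G *v path_deriv T \<eta> t"
    using \<phi>(3) by (subst (asm) AE_restrict_space_iff) auto
  then obtain N where N: "N \<in> null_sets lebesgue"
    "\<And>t. t \<notin> N \<Longrightarrow> t \<in> {0..T} \<Longrightarrow> path_deriv T \<phi> t = f t (\<phi> t) + G *v path_deriv T \<eta> t"
    unfolding completion.AE_iff_null_sets by auto
  have "\<phi> t = x0 + integral {0..t} (\<lambda>s. f s (\<phi> s)) + G *v \<eta> t" if t: "t \<in> {0..T}" for t
  proof -
    have "(path_deriv T \<eta> has_integral (\<eta> t - \<eta> 0)) {0..t}"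
      by (rule has_integral_path_deriv) (use cameron_martinD[OF \<eta>(1)] T_pos t in auto)
    from has_integral_linear[OF this matrix_vector_mul_bounded_linear[of G]]
    have "((\<lambda>s. G *v path_deriv T \<eta> s) has_integral G *v \<eta> t) {0..t}"
      using \<eta>(2) by (simp add: comp_def)
    moreover have "((\<lambda>s. f s (\<phi> s)) has_integral integral {0..t} (\<lambda>s. f s (\<phi> s))) {0..t}"
      using t by (intro integrable_integral drift_integrable c) auto
    ultimately have "((\<lambda>s. f s (\<phi> s) + G *v path_deriv T \<eta> s) has_integral
        (integral {0..t} (\<lambda>s. f s (\<phi> s)) + G *v \<eta> t)) {0..t}"
      by (rule has_integral_add[rotated])
    then have "(path_deriv T \<phi> has_integral (integral {0..t} (\<lambda>s. f s (\<phi> s)) + G *v \<eta> t)) {0..t}"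
      by (rule has_integral_spike[rotated 2, of _ _ _ N])
         (use N t in \<open>auto simp: negligible_iff_null_sets\<close>)
    moreover have "(path_deriv T \<phi> has_integral (\<phi> t - \<phi> 0)) {0..t}"
      by (rule has_integral_path_deriv) (use cameron_martinD[OF \<phi>(1)] T_pos t in auto)
    ultimately have "\<phi> t - \<phi> 0 = integral {0..t} (\<lambda>s. f s (\<phi> s)) + G *v \<eta> t"
      by (rule has_integral_unique[rotated])
    then show ?thesis using \<phi>(2) by (simp add: algebra_simps)
  qed
  then show "is_path \<phi> \<eta> x0" using c by (simp add: is_path_def)
qed

text \<open>The integral equation solved for the noise, which is possible because \<open>G\<close>
  is invertible.\<close>

definition driving_noise where
  "driving_noise \<phi> t = matrix_inv G *v (\<phi> t - \<phi> 0 - integral {0..t} (\<lambda>s. f s (\<phi> s)))"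

lemma driving_noise:
  assumes \<phi>: "\<phi> \<in> cameron_martin T"
  shows "driving_noise \<phi> \<in> cameron_martin T" "driving_noise \<phi> 0 = 0" "is_path \<phi> (driving_noise \<phi>) (\<phi> 0)"
proof -
  have c: "continuous_on {0..T} \<phi>" by (rule cameron_martinD(4)[OF \<phi>])
  show "driving_noise \<phi> 0 = 0" by (simp add: driving_noise_def)
  show "driving_noise \<phi> \<in> cameron_martin T"
  proof (rule cameron_martin_affine(1)[OF \<phi> T_pos])
    show "continuous_on {0..T} (\<lambda>s. - (matrix_inv G *v f s (\<phi> s)))"
      by (intro continuous_on_minus continuous_on_compose2[OF linear_continuous_on[OF matrix_vector_mul_bounded_linear]]
          drift_continuous c) auto
    fix t assume t: "t \<in> {0..T}"
    have "integral {0..t} (\<lambda>s. matrix_inv G *v f s (\<phi> s)) = matrix_inv G *v integral {0..t} (\<lambda>s. f s (\<phi> s))"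
      using integral_linear[OF drift_integrable[OF c] matrix_vector_mul_bounded_linear[of "matrix_inv G"], of t] t
      by (simp add: comp_def)
    then show "driving_noise \<phi> t = matrix_inv G *v \<phi> t + integral {0..t} (\<lambda>s. - (matrix_inv G *v f s (\<phi> s))) + - (matrix_inv G *v \<phi> 0)"
      by (simp add: driving_noise_def matrix_vector_mult_diff_distrib)
  qed
  have "G *v driving_noise \<phi> t = \<phi> t - \<phi> 0 - integral {0..t} (\<lambda>s. f s (\<phi> s))" for t
    by (simp add: driving_noise_def matrix_vector_mul_assoc matrix_inv_cancel[OF G])
  then show "is_path \<phi> (driving_noise \<phi>) (\<phi> 0)" using c by (simp add: is_path_def)
qed

text \<open>Exponential of the energy merit. As a real number that may be \<open>0\<close>, it
  covers vanishing densities without infinite values and can be compared with limits of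
  probabilities.\<close>

definition path_likelihood where
  "path_likelihood \<phi> = exp (- (1 / 2) * (LINT t:{0..T}|lebesgue.
      (weighted_norm (matrix_inv (G ** transpose G)) (path_deriv T \<phi> t - f t (\<phi> t)))\<^sup>2)) *
    \<nu> (\<phi> 0) * (\<Prod>t\<in>Tm. q t (\<phi> t))"

lemma path_likelihood_nonneg: "0 \<le> path_likelihood \<phi>"
  unfolding path_likelihood_def by (intro mult_nonneg_nonneg prod_nonneg) (auto simp: \<nu>_nonneg q_nonneg)

lemma energy_merit_eq_ln_likelihood:
  assumes "\<And>t. t \<in> Tm \<Longrightarrow> \<psi> t (y t) = q t"
  shows "energy_merit T f G \<nu> Tm \<psi> y \<phi> = ereal_ln (path_likelihood \<phi>)"
proof -
  have "(\<Sum>t\<in>Tm. ereal_ln (\<psi> t (y t) (\<phi> t))) = ereal_ln (\<Prod>t\<in>Tm. q t (\<phi> t))"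
    by (subst ereal_ln_prod) (auto simp: finite_Tm q_nonneg assms)
  then show ?thesis
    unfolding energy_merit_def path_likelihood_def Let_def
    by (simp add: ereal_ln_mult ereal_ln_exp \<nu>_nonneg q_nonneg prod_nonneg)
qed

text \<open>Almost everywhere the residual of the state equation is \<open>G\<close> applied to the
  derivative of the noise, and its weighted norm is the plain norm of that derivative.\<close>

lemma path_likelihood_eq:
  assumes \<eta>: "\<eta> \<in> cameron_martin T" "\<eta> 0 = 0" and \<phi>: "is_path \<phi> \<eta> x0"
  shows "path_likelihood \<phi> = exp (- path_energy T \<eta> / 2) * \<nu> x0 * (\<Prod>t\<in>Tm. q t (\<phi> t))"
proof -
  let ?h = "\<lambda>t. (weighted_norm (matrix_inv (G ** transpose G)) (path_deriv T \<phi> t - f t (\<phi> t)))\<^sup>2"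
  have "AE t in lebesgue. t \<in> {0..T} \<longrightarrow> path_deriv T \<phi> t = G *v path_deriv T \<eta> t + f t (\<phi> t)"
    using is_path_cameron_martin(2)[OF \<eta>(1) \<phi>] by (subst (asm) AE_restrict_space_iff) auto
  then have AE: "AE t in lebesgue. indicator {0..T} t *\<^sub>R (norm (path_deriv T \<eta> t))\<^sup>2 = indicator {0..T} t *\<^sub>R ?h t"
    by eventually_elim (auto simp: indicator_def weighted_norm_matrix_image[OF G])
  have m: "(\<lambda>t. indicator {0..T} t *\<^sub>R (norm (path_deriv T \<eta> t))\<^sup>2) \<in> borel_measurable lebesgue"
    using cameron_martinD(3)[OF \<eta>(1)] unfolding set_integrable_def by (rule borel_measurable_integrable)
  have "path_energy T \<eta> = (LINT t:{0..T}|lebesgue. ?h t)"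
    unfolding path_energy_def set_lebesgue_integral_def
    by (rule integral_cong_AE[OF m borel_measurable_AE[OF m AE] AE])
  then show ?thesis
    using is_path_0[OF \<phi> \<eta>(2)] by (simp add: path_likelihood_def)
qed

lemma scaled_mass_tendsto_likelihood:
  assumes "\<eta> \<in> cameron_martin T" "\<eta> 0 = 0" "is_path \<phi> \<eta> x0"
  shows "(scaled_mass \<eta> x0 \<longlongrightarrow> path_likelihood \<phi>) (at_right 0)"
  unfolding path_likelihood_eq[OF assms] by (rule scaled_mass_limit[OF assms])

text \<open>Positive expectations yield, separately for each measurement time, a state of positive
  likelihood; an interpolating path visits them all. At time \<open>0\<close> the same state must
  also satisfy \<open>\<nu> x > 0\<close>, which is possible because \<open>X 0\<close> almost
  surely avoids the zeros of \<open>\<nu>\<close>.\<close>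

lemma likely_path_exists: "\<exists>\<phi>\<in>cameron_martin T. path_likelihood \<phi> > 0"
proof -
  have "\<exists>x. q t x > 0" if t: "t \<in> Tm" for t
  proof (rule ccontr)
    assume "\<not> ?thesis"
    then have "q t x = 0" for x using q_nonneg[OF t, of x] by (meson antisym_conv2 not_le)
    then show False using q_pos[OF t] by simp
  qed
  then obtain z where z: "\<And>t. t \<in> Tm \<Longrightarrow> q t (z t) > 0" by metis
  have "\<exists>x. \<nu> x > 0 \<and> (0 \<in> Tm \<longrightarrow> q 0 x > 0)"
  proof (rule ccontr)
    assume neg: "\<not> ?thesis"
    have [measurable]: "\<nu> \<in> borel_measurable borel" using \<nu>_cont by (rule borel_measurable_continuous_onI)
    have X0[measurable]: "X 0 \<in> borel_measurable M" using T_pos by (intro X_measurable) auto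
    have "emeasure M (X 0 -` {x. \<nu> x = 0} \<inter> space M) = (\<integral>\<^sup>+x. ennreal (\<nu> x) * indicator {x. \<nu> x = 0} x \<partial>lborel)"
      by (rule distributed_emeasure[OF X0_distributed]) measurable
    also have "\<dots> = 0" by (intro nn_integral_zero' AE_I2) (auto simp: indicator_def)
    finally have null: "emeasure M (X 0 -` {x. \<nu> x = 0} \<inter> space M) = 0" .
    have AE: "AE \<omega> in M. \<nu> (X 0 \<omega>) \<noteq> 0"
    proof (rule AE_I[of _ _ "X 0 -` {x. \<nu> x = 0} \<inter> space M"])
      show "{\<omega> \<in> space M. \<not> \<nu> (X 0 \<omega>) \<noteq> 0} \<subseteq> X 0 -` {x. \<nu> x = 0} \<inter> space M" by auto
      show "X 0 -` {x. \<nu> x = 0} \<inter> space M \<in> sets M" by (rule measurable_sets[OF X0]) measurable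
    qed (rule null)
    show False
    proof (cases "0 \<in> Tm")
      case True
      have "AE \<omega> in M. q 0 (X 0 \<omega>) = 0"
        using AE
      proof eventually_elim
        case (elim \<omega>)
        then show ?case using neg \<nu>_nonneg[of "X 0 \<omega>"] q_nonneg[OF True, of "X 0 \<omega>"] True
          by (metis order_le_less)
      qed
      then have "(LINT \<omega>|M. q 0 (X 0 \<omega>)) = 0" by (rule integral_eq_zero_AE)
      then show False using q_pos[OF True] by simp
    next
      case False
      then have "\<nu> x = 0" for x using neg \<nu>_nonneg[of x] by (metis order_le_less)
      then have "AE \<omega> in M. False" using AE by simp
      then show False by simp
    qed
  qed
  then obtain x where x: "\<nu> x > 0" "0 \<in> Tm \<longrightarrow> q 0 x > 0" by blast
  obtain \<phi> where \<phi>: "\<phi> \<in> cameron_martin T" "\<forall>t\<in>insert 0 Tm. \<phi> t = (if t = 0 then x else z t)"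
    using cameron_martin_interpolation[of "insert 0 Tm" T "\<lambda>t. if t = 0 then x else z t"] finite_Tm T_pos by auto
  have "(\<Prod>t\<in>Tm. q t (\<phi> t)) > 0"
    using \<phi>(2) x(2) z by (intro prod_pos) auto
  moreover have "\<nu> (\<phi> 0) > 0" using \<phi>(2) x(1) by simp
  ultimately show ?thesis using \<phi>(1) unfolding path_likelihood_def by (intro bexI[of _ \<phi>]) auto
qed

end

section \<open>Limit values of noise pairs and MAP estimates\<close>

locale sde_posterior_tubes = sde_posterior +
  assumes tubes_outside: "\<And>\<gamma> z0 \<eta> x0. admissible_noise T \<gamma> \<Longrightarrow> \<gamma> \<notin> cameron_martin T \<Longrightarrow>
    \<eta> \<in> cameron_martin T \<Longrightarrow> \<eta> 0 = 0 \<Longrightarrow> \<nu> x0 > 0 \<Longrightarrow>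
    ((\<lambda>\<epsilon>. measure M (tube M T W (X 0) \<gamma> z0 \<epsilon>) / measure M (tube M T W (X 0) \<eta> x0 \<epsilon>)) \<longlongrightarrow> 0) (at_right 0)"
begin

lemma prob_tube_pos:
  assumes \<eta>: "\<eta> \<in> cameron_martin T" "\<eta> 0 = 0" and "\<nu> x0 > 0" "\<epsilon> > 0"
  shows "prob (tube M T W (X 0) \<eta> x0 \<epsilon>) > 0"
proof -
  have "\<forall>\<^sub>F e in at_right 0. prob (tube M T W (X 0) \<eta> x0 e) / reference e > 0"
    by (rule order_tendstoD(1)[OF prob_tube_limit[OF \<eta>]]) (use assms(3) in simp)
  moreover have "\<forall>\<^sub>F e in at_right 0. e \<in> {0<..<\<epsilon>}" using \<open>\<epsilon> > 0\<close> by (rule eventually_at_right_real)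
  ultimately have "\<forall>\<^sub>F e in at_right 0. prob (tube M T W (X 0) \<eta> x0 e) / reference e > 0 \<and> e \<in> {0<..<\<epsilon>}"
    by (rule eventually_conj)
  then obtain e where e: "prob (tube M T W (X 0) \<eta> x0 e) / reference e > 0" "e \<in> {0<..<\<epsilon>}"
    using eventually_happens'[OF trivial_limit_at_right_real] by blast
  then have "prob (tube M T W (X 0) \<eta> x0 e) > 0" using measure_nonneg by (metis divide_eq_0_iff order_le_less)
  also have "\<dots> \<le> prob (tube M T W (X 0) \<eta> x0 \<epsilon>)"
    using e(2) by (intro finite_measure_mono tube_mono tube_sets cameron_martinD(4)[OF \<eta>(1)]) auto
  finally show ?thesis .
qed

text \<open>Pairs outside the Cameron--Martin space, or starting where \<open>\<nu>\<close> vanishes, have no path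
  attached to them and get the value \<open>0\<close>.\<close>

definition noise_value where
  "noise_value \<eta> x0 = Lim (at_right 0) (scaled_mass \<eta> x0)"

lemma noise_value_eqI: "(scaled_mass \<eta> x0 \<longlongrightarrow> l) (at_right 0) \<Longrightarrow> noise_value \<eta> x0 = l"
  unfolding noise_value_def by (rule tendsto_Lim[OF trivial_limit_at_right_real])

lemma noise_value_path:
  assumes "\<eta> \<in> cameron_martin T" "\<eta> 0 = 0" "is_path \<phi> \<eta> x0"
  shows "noise_value \<eta> x0 = path_likelihood \<phi>"
  by (rule noise_value_eqI[OF scaled_mass_tendsto_likelihood[OF assms]])

text \<open>A noise outside the Cameron--Martin space is compared with the driving noise of a likely
  path: the ratio, which tends to \<open>0\<close>, is multiplied by a quotient with finite limit.
  If \<open>\<nu> x0 = 0\<close>, the prior limit vanishes by itself. Otherwise all tubes have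
  positive probability and a path exists.\<close>

lemma scaled_mass_cases:
  assumes \<eta>: "admissible_noise T \<eta>"
  shows "(scaled_mass \<eta> x0 \<longlongrightarrow> 0) (at_right 0) \<or> \<eta> \<in> cameron_martin T \<and> (\<exists>\<phi>. is_path \<phi> \<eta> x0)"
proof -
  have c: "continuous_on {0..T} \<eta>" and "\<eta> 0 = 0" using \<eta> by (auto simp: admissible_noise_def)
  consider "\<eta> \<notin> cameron_martin T" | "\<eta> \<in> cameron_martin T" "\<nu> x0 = 0" | "\<eta> \<in> cameron_martin T" "\<nu> x0 > 0"
    using \<nu>_nonneg[of x0] by fastforce
  then show ?thesis
  proof cases
    case 1
    obtain \<phi> where \<phi>: "\<phi> \<in> cameron_martin T" "path_likelihood \<phi> > 0" using likely_path_exists by blast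
    note n = driving_noise[OF \<phi>(1)]
    have "\<nu> (\<phi> 0) > 0"
      using \<phi>(2) \<nu>_nonneg[of "\<phi> 0"] by (cases "\<nu> (\<phi> 0) = 0") (auto simp: path_likelihood_def)
    let ?P = "\<lambda>\<epsilon>. prob (tube M T W (X 0) (driving_noise \<phi>) (\<phi> 0) \<epsilon>)"
    have lim: "((\<lambda>\<epsilon>. (prob (tube M T W (X 0) \<eta> x0 \<epsilon>) / ?P \<epsilon>) * (?P \<epsilon> / reference \<epsilon>)) \<longlongrightarrow>
       0 * (exp (- path_energy T (driving_noise \<phi>) / 2) * \<nu> (\<phi> 0))) (at_right 0)"
      by (intro tendsto_mult prob_tube_limit[OF n(1,2)] tubes_outside[OF \<eta> 1 n(1,2) \<open>\<nu> (\<phi> 0) > 0\<close>])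
    have ev: "\<forall>\<^sub>F \<epsilon> in at_right 0. (prob (tube M T W (X 0) \<eta> x0 \<epsilon>) / ?P \<epsilon>) * (?P \<epsilon> / reference \<epsilon>) =
        prob (tube M T W (X 0) \<eta> x0 \<epsilon>) / reference \<epsilon>"
      using eventually_at_right_less[of "0 :: real"]
    proof eventually_elim
      case (elim \<epsilon>)
      then show ?case using prob_tube_pos[OF n(1,2) \<open>\<nu> (\<phi> 0) > 0\<close> elim] by simp
    qed
    have "((\<lambda>\<epsilon>. prob (tube M T W (X 0) \<eta> x0 \<epsilon>) / reference \<epsilon>) \<longlongrightarrow> 0) (at_right 0)"
      using Lim_transform_eventually[OF lim ev] by simp
    then show ?thesis using scaled_mass_limit_0[OF c] by blast
  next
    case 2
    have "((\<lambda>\<epsilon>. prob (tube M T W (X 0) \<eta> x0 \<epsilon>) / reference \<epsilon>) \<longlongrightarrow> 0) (at_right 0)"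
      using prob_tube_limit[OF 2(1) \<open>\<eta> 0 = 0\<close>, of x0] 2(2) by simp
    then show ?thesis using scaled_mass_limit_0[OF c] by blast
  next
    case 3
    have "\<exists>\<phi>. is_path \<phi> \<eta> x0" by (rule is_path_exists[OF c prob_tube_pos[OF 3(1) \<open>\<eta> 0 = 0\<close> 3(2)]])
    then show ?thesis using 3(1) by blast
  qed
qed

lemma noise_value_limit:
  assumes "admissible_noise T \<eta>"
  shows "(scaled_mass \<eta> x0 \<longlongrightarrow> noise_value \<eta> x0) (at_right 0)"
    and "noise_value \<eta> x0 \<noteq> 0 \<Longrightarrow> \<eta> \<in> cameron_martin T \<and> (\<exists>\<phi>. is_path \<phi> \<eta> x0)"
    and "noise_value \<eta> x0 \<ge> 0"
proof -
  have "\<eta> 0 = 0" using assms by (simp add: admissible_noise_def)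
  show "(scaled_mass \<eta> x0 \<longlongrightarrow> noise_value \<eta> x0) (at_right 0)"
    using scaled_mass_cases[OF assms, of x0]
  proof
    assume "(scaled_mass \<eta> x0 \<longlongrightarrow> 0) (at_right 0)"
    then show ?thesis by (simp add: noise_value_eqI)
  next
    assume "\<eta> \<in> cameron_martin T \<and> (\<exists>\<phi>. is_path \<phi> \<eta> x0)"
    then show ?thesis using scaled_mass_tendsto_likelihood[where \<eta> = \<eta>, OF _ \<open>\<eta> 0 = 0\<close>] noise_value_path[where \<eta> = \<eta>, OF _ \<open>\<eta> 0 = 0\<close>] by metis
  qed
  show "\<eta> \<in> cameron_martin T \<and> (\<exists>\<phi>. is_path \<phi> \<eta> x0)" if "noise_value \<eta> x0 \<noteq> 0"
    using scaled_mass_cases[OF assms, of x0] noise_value_eqI[of \<eta> x0 0] that by blast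
  show "noise_value \<eta> x0 \<ge> 0"
    using scaled_mass_cases[OF assms, of x0]
  proof
    assume "(scaled_mass \<eta> x0 \<longlongrightarrow> 0) (at_right 0)"
    then show ?thesis by (simp add: noise_value_eqI)
  next
    assume "\<eta> \<in> cameron_martin T \<and> (\<exists>\<phi>. is_path \<phi> \<eta> x0)"
    then show ?thesis using noise_value_path[where \<eta> = \<eta>, OF _ \<open>\<eta> 0 = 0\<close>] path_likelihood_nonneg by metis
  qed
qed

lemma admissible_driving_noise:
  "\<phi> \<in> cameron_martin T \<Longrightarrow> admissible_noise T (driving_noise \<phi>)"
  using driving_noise[of \<phi>] cameron_martinD(4) by (auto simp: admissible_noise_def)

lemma noise_value_driving_noise:
  "\<phi> \<in> cameron_martin T \<Longrightarrow> noise_value (driving_noise \<phi>) (\<phi> 0) = path_likelihood \<phi>"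
  using driving_noise[of \<phi>] by (intro noise_value_path) auto

text \<open>Each expected likelihood is positive separately by hypothesis; the expected product is
  positive because some tube around a likely path has positive mass.\<close>

lemma total_mass_pos: "weighted_mass (space M) > 0"
proof -
  obtain \<phi> where \<phi>: "\<phi> \<in> cameron_martin T" "path_likelihood \<phi> > 0" using likely_path_exists by blast
  note n = driving_noise[OF \<phi>(1)]
  have "\<forall>\<^sub>F \<epsilon> in at_right 0. scaled_mass (driving_noise \<phi>) (\<phi> 0) \<epsilon> > 0"
    using scaled_mass_tendsto_likelihood[OF n] \<phi>(2) by (rule order_tendstoD(1))
  then obtain \<epsilon> where "scaled_mass (driving_noise \<phi>) (\<phi> 0) \<epsilon> > 0"
    using eventually_happens'[OF trivial_limit_at_right_real] by blast
  then have "weighted_mass (tube M T W (X 0) (driving_noise \<phi>) (\<phi> 0) \<epsilon>) > 0"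
    unfolding scaled_mass_def using weighted_mass_nonneg by (metis divide_eq_0_iff order_le_less)
  also have "\<dots> \<le> weighted_mass (space M)"
    using tube_sets[OF cameron_martinD(4)[OF n(1)]]
    by (intro weighted_mass_mono) (auto dest: sets.sets_into_space)
  finally show ?thesis .
qed

lemma posterior_ratio:
  assumes "\<epsilon> > 0"
  shows "(weighted_mass (tube M T W (X 0) \<eta> x0 \<epsilon>) / weighted_mass (space M)) /
      (weighted_mass (tube M T W (X 0) \<eta>' x0' \<epsilon>) / weighted_mass (space M)) =
    scaled_mass \<eta> x0 \<epsilon> / scaled_mass \<eta>' x0' \<epsilon>"
  using total_mass_pos reference_pos[OF assms] by (simp add: scaled_mass_def)

text \<open>For a pair of positive value the limes superior is a quotient of values. Positivity
  itself is forced: with value \<open>0\<close> and positive tube probabilities, the ratio for a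
  likely path would eventually stay above \<open>1\<close>.\<close>

lemma MAP_estimate_iff:
  assumes \<eta>: "admissible_noise T \<eta>"
  shows "MAP_estimate M T (\<lambda>A. weighted_mass A / weighted_mass (space M)) W (X 0) \<eta> x0 \<longleftrightarrow>
    noise_value \<eta> x0 > 0 \<and> (\<forall>\<eta>' x0'. admissible_noise T \<eta>' \<longrightarrow> noise_value \<eta>' x0' \<le> noise_value \<eta> x0)"
proof -
  let ?P = "\<lambda>A. weighted_mass A / weighted_mass (space M)"
  let ?r = "\<lambda>\<eta>' x0' \<epsilon>. ereal (?P (tube M T W (X 0) \<eta>' x0' \<epsilon>) / ?P (tube M T W (X 0) \<eta> x0 \<epsilon>))"
  have r_eq: "\<forall>\<^sub>F \<epsilon> in at_right 0. ?r \<eta>' x0' \<epsilon> = ereal (scaled_mass \<eta>' x0' \<epsilon> / scaled_mass \<eta> x0 \<epsilon>)" for \<eta>' x0'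
    using eventually_at_right_less[of "0 :: real"] by eventually_elim (simp only: posterior_ratio)
  have Limsup: "Limsup (at_right 0) (?r \<eta>' x0') = ereal (noise_value \<eta>' x0' / noise_value \<eta> x0)"
    if "admissible_noise T \<eta>'" "noise_value \<eta> x0 > 0" for \<eta>' x0'
  proof (rule lim_imp_Limsup[OF trivial_limit_at_right_real])
    have "((\<lambda>\<epsilon>. scaled_mass \<eta>' x0' \<epsilon> / scaled_mass \<eta> x0 \<epsilon>) \<longlongrightarrow> noise_value \<eta>' x0' / noise_value \<eta> x0) (at_right 0)"
      using that by (intro tendsto_divide noise_value_limit \<eta>) auto
    then show "(?r \<eta>' x0' \<longlongrightarrow> ereal (noise_value \<eta>' x0' / noise_value \<eta> x0)) (at_right 0)"
      using tendsto_cong[OF r_eq] by simp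
  qed
  show ?thesis
  proof
    assume MAP: "MAP_estimate M T ?P W (X 0) \<eta> x0"
    have pos: "noise_value \<eta> x0 > 0"
    proof (rule ccontr)
      assume "\<not> ?thesis"
      then have "noise_value \<eta> x0 = 0" using noise_value_limit(3)[OF \<eta>, of x0] by linarith
      then have lim0: "(scaled_mass \<eta> x0 \<longlongrightarrow> 0) (at_right 0)" using noise_value_limit(1)[OF \<eta>, of x0] by simp
      obtain \<phi> where \<phi>: "\<phi> \<in> cameron_martin T" "path_likelihood \<phi> > 0" using likely_path_exists by blast
      let ?n = "driving_noise \<phi>" and ?v = "path_likelihood \<phi>"
      \<comment> \<open>The thresholds \<open>?v / 2\<close> and \<open>?v / 4\<close> keep the
        ratio at least \<open>2\<close> even though the quotient has no finite limit.\<close>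
      have "\<forall>\<^sub>F \<epsilon> in at_right 0. scaled_mass ?n (\<phi> 0) \<epsilon> > ?v / 2"
        using scaled_mass_tendsto_likelihood[OF driving_noise[OF \<phi>(1)]] \<phi>(2) by (intro order_tendstoD(1)) auto
      moreover have "\<forall>\<^sub>F \<epsilon> in at_right 0. scaled_mass \<eta> x0 \<epsilon> < ?v / 4"
        using lim0 \<phi>(2) by (intro order_tendstoD(2)) auto
      ultimately have "\<forall>\<^sub>F \<epsilon> in at_right 0. 2 \<le> ?r ?n (\<phi> 0) \<epsilon>"
        using eventually_at_right_less[of "0 :: real"] r_eq[of ?n "\<phi> 0"]
      proof eventually_elim
        case (elim \<epsilon>)
        have "?P (tube M T W (X 0) \<eta> x0 \<epsilon>) > 0" using MAP elim(3) by (simp add: MAP_estimate_def)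
        then have "weighted_mass (tube M T W (X 0) \<eta> x0 \<epsilon>) > 0"
          using total_mass_pos by (simp add: zero_less_divide_iff)
        then have "scaled_mass \<eta> x0 \<epsilon> > 0" using reference_pos[OF elim(3)] by (simp add: scaled_mass_def)
        then have "2 \<le> scaled_mass ?n (\<phi> 0) \<epsilon> / scaled_mass \<eta> x0 \<epsilon>"
          using elim(1,2) by (simp add: pos_le_divide_eq)
        then have "ereal 2 \<le> ereal (scaled_mass ?n (\<phi> 0) \<epsilon> / scaled_mass \<eta> x0 \<epsilon>)" by (simp only: ereal_less_eq)
        then show ?case unfolding elim(4) by simp
      qed
      then have "2 \<le> Liminf (at_right 0) (?r ?n (\<phi> 0))" by (rule Liminf_bounded)
      also have "\<dots> \<le> Limsup (at_right 0) (?r ?n (\<phi> 0))" by (rule Liminf_le_Limsup[OF trivial_limit_at_right_real])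
      also have "\<dots> \<le> 1" using MAP admissible_driving_noise[OF \<phi>(1)] by (simp add: MAP_estimate_def)
      finally show False by simp
    qed
    moreover have "noise_value \<eta>' x0' \<le> noise_value \<eta> x0" if "admissible_noise T \<eta>'" for \<eta>' x0'
    proof -
      have "Limsup (at_right 0) (?r \<eta>' x0') \<le> 1" using MAP that by (simp add: MAP_estimate_def)
      then have "noise_value \<eta>' x0' / noise_value \<eta> x0 \<le> 1" unfolding Limsup[OF that pos] by simp
      then show ?thesis using pos by (simp add: pos_divide_le_eq)
    qed
    ultimately show "noise_value \<eta> x0 > 0 \<and> (\<forall>\<eta>' x0'. admissible_noise T \<eta>' \<longrightarrow> noise_value \<eta>' x0' \<le> noise_value \<eta> x0)"
      by blast
  next
    assume R: "noise_value \<eta> x0 > 0 \<and> (\<forall>\<eta>' x0'. admissible_noise T \<eta>' \<longrightarrow> noise_value \<eta>' x0' \<le> noise_value \<eta> x0)"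
    then have pos: "noise_value \<eta> x0 > 0" by blast
    have c: "continuous_on {0..T} \<eta>" using \<eta> by (simp add: admissible_noise_def)
    have ratio: "Limsup (at_right 0) (?r \<eta>' x0') \<le> 1" if \<eta>': "admissible_noise T \<eta>'" for \<eta>' x0'
    proof -
      have "noise_value \<eta>' x0' / noise_value \<eta> x0 \<le> 1" using R \<eta>' pos by (simp add: pos_divide_le_eq)
      then show ?thesis unfolding Limsup[OF \<eta>' pos] by simp
    qed
    show "MAP_estimate M T ?P W (X 0) \<eta> x0"
      unfolding MAP_estimate_def
    proof (intro conjI allI impI \<eta> ratio)
      fix \<epsilon> :: real assume "\<epsilon> > 0"
      have "\<forall>\<^sub>F e in at_right 0. scaled_mass \<eta> x0 e > 0"
        using noise_value_limit(1)[OF \<eta>] pos by (rule order_tendstoD(1))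
      moreover have "\<forall>\<^sub>F e in at_right 0. e \<in> {0<..<\<epsilon>}" using \<open>\<epsilon> > 0\<close> by (rule eventually_at_right_real)
      ultimately have "\<forall>\<^sub>F e in at_right 0. scaled_mass \<eta> x0 e > 0 \<and> e \<in> {0<..<\<epsilon>}" by (rule eventually_conj)
      then obtain e where e: "scaled_mass \<eta> x0 e > 0" "e \<in> {0<..<\<epsilon>}"
        using eventually_happens'[OF trivial_limit_at_right_real] by blast
      have "weighted_mass (tube M T W (X 0) \<eta> x0 e) > 0"
        using e(1) weighted_mass_nonneg unfolding scaled_mass_def by (metis divide_eq_0_iff order_le_less)
      also have "\<dots> \<le> weighted_mass (tube M T W (X 0) \<eta> x0 \<epsilon>)"
        using e(2) by (intro weighted_mass_mono tube_sets c tube_mono) auto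
      finally show "?P (tube M T W (X 0) \<eta> x0 \<epsilon>) > 0" using total_mass_pos by simp
    qed
  qed
qed

text \<open>Values and path likelihoods correspond in both directions: a nonzero value comes from a
  state path, and every Cameron--Martin path arises from its driving noise. A maximiser has positive
  likelihood because some path does.\<close>

lemma MAP_iff_maximal_path:
  assumes \<eta>: "admissible_noise T \<eta>"
  shows "MAP_estimate M T (\<lambda>A. weighted_mass A / weighted_mass (space M)) W (X 0) \<eta> x0 \<longleftrightarrow>
    \<eta> \<in> cameron_martin T \<and> (\<exists>\<phi>. associated_state_path T f G \<eta> x0 \<phi> \<and>
      (\<forall>\<xi>\<in>cameron_martin T. path_likelihood \<xi> \<le> path_likelihood \<phi>))"
  unfolding MAP_estimate_iff[OF \<eta>]
proof
  have "\<eta> 0 = 0" using \<eta> by (simp add: admissible_noise_def)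
  assume R: "noise_value \<eta> x0 > 0 \<and> (\<forall>\<eta>' x0'. admissible_noise T \<eta>' \<longrightarrow> noise_value \<eta>' x0' \<le> noise_value \<eta> x0)"
  then obtain \<phi> where \<phi>: "\<eta> \<in> cameron_martin T" "is_path \<phi> \<eta> x0" using noise_value_limit(2)[OF \<eta>, of x0] by auto
  have "path_likelihood \<xi> \<le> path_likelihood \<phi>" if "\<xi> \<in> cameron_martin T" for \<xi>
    using R admissible_driving_noise[OF that] noise_value_driving_noise[OF that] noise_value_path[OF \<phi>(1) \<open>\<eta> 0 = 0\<close> \<phi>(2)]
    by metis
  then show "\<eta> \<in> cameron_martin T \<and> (\<exists>\<phi>. associated_state_path T f G \<eta> x0 \<phi> \<and>
      (\<forall>\<xi>\<in>cameron_martin T. path_likelihood \<xi> \<le> path_likelihood \<phi>))"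
    using \<phi> associated_state_path_iff[OF \<phi>(1) \<open>\<eta> 0 = 0\<close>] by blast
next
  have "\<eta> 0 = 0" using \<eta> by (simp add: admissible_noise_def)
  assume "\<eta> \<in> cameron_martin T \<and> (\<exists>\<phi>. associated_state_path T f G \<eta> x0 \<phi> \<and>
      (\<forall>\<xi>\<in>cameron_martin T. path_likelihood \<xi> \<le> path_likelihood \<phi>))"
  then obtain \<phi> where \<phi>: "\<eta> \<in> cameron_martin T" "is_path \<phi> \<eta> x0"
    and max: "\<And>\<xi>. \<xi> \<in> cameron_martin T \<Longrightarrow> path_likelihood \<xi> \<le> path_likelihood \<phi>"
    using associated_state_path_iff[where \<eta> = \<eta>, OF _ \<open>\<eta> 0 = 0\<close>] by blast
  have val: "noise_value \<eta> x0 = path_likelihood \<phi>" by (rule noise_value_path[OF \<phi>(1) \<open>\<eta> 0 = 0\<close> \<phi>(2)])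
  have "path_likelihood \<phi> > 0" using likely_path_exists max by (meson less_le_trans)
  moreover have "noise_value \<eta>' x0' \<le> path_likelihood \<phi>" if \<eta>': "admissible_noise T \<eta>'" for \<eta>' x0'
  proof (cases "noise_value \<eta>' x0' = 0")
    case True then show ?thesis by (simp add: path_likelihood_nonneg)
  next
    case False
    then obtain \<phi>' where \<phi>': "\<eta>' \<in> cameron_martin T" "is_path \<phi>' \<eta>' x0'"
      using noise_value_limit(2)[OF \<eta>'] by blast
    have "\<eta>' 0 = 0" using \<eta>' by (simp add: admissible_noise_def)
    have "noise_value \<eta>' x0' = path_likelihood \<phi>'" by (rule noise_value_path[OF \<phi>'(1) \<open>\<eta>' 0 = 0\<close> \<phi>'(2)])
    then show ?thesis using max[OF is_path_cameron_martin(1)[OF \<phi>']] by simp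
  qed
  ultimately show "noise_value \<eta> x0 > 0 \<and> (\<forall>\<eta>' x0'. admissible_noise T \<eta>' \<longrightarrow> noise_value \<eta>' x0' \<le> noise_value \<eta> x0)"
    unfolding val by blast
qed

lemma maximal_path_iff:
  "\<phi> \<in> cameron_martin T \<and> (\<forall>\<xi>\<in>cameron_martin T. path_likelihood \<xi> \<le> path_likelihood \<phi>) \<longleftrightarrow>
    (\<exists>\<eta> x0. MAP_estimate M T (\<lambda>A. weighted_mass A / weighted_mass (space M)) W (X 0) \<eta> x0 \<and>
      associated_state_path T f G \<eta> x0 \<phi>)"
proof
  assume \<phi>: "\<phi> \<in> cameron_martin T \<and> (\<forall>\<xi>\<in>cameron_martin T. path_likelihood \<xi> \<le> path_likelihood \<phi>)"
  then have CM: "\<phi> \<in> cameron_martin T" by blast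
  note n = driving_noise[OF CM]
  have a: "associated_state_path T f G (driving_noise \<phi>) (\<phi> 0) \<phi>"
    using n(3) unfolding associated_state_path_iff[OF n(1,2)] .
  then have "MAP_estimate M T (\<lambda>A. weighted_mass A / weighted_mass (space M)) W (X 0) (driving_noise \<phi>) (\<phi> 0)"
    unfolding MAP_iff_maximal_path[OF admissible_driving_noise[OF CM]] using n(1) \<phi> by blast
  with a show "\<exists>\<eta> x0. MAP_estimate M T (\<lambda>A. weighted_mass A / weighted_mass (space M)) W (X 0) \<eta> x0 \<and>
      associated_state_path T f G \<eta> x0 \<phi>" by blast
next
  assume "\<exists>\<eta> x0. MAP_estimate M T (\<lambda>A. weighted_mass A / weighted_mass (space M)) W (X 0) \<eta> x0 \<and>
      associated_state_path T f G \<eta> x0 \<phi>"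
  then obtain \<eta> x0 where MAP: "MAP_estimate M T (\<lambda>A. weighted_mass A / weighted_mass (space M)) W (X 0) \<eta> x0"
    and a: "associated_state_path T f G \<eta> x0 \<phi>" by blast
  have \<eta>: "admissible_noise T \<eta>" using MAP by (simp add: MAP_estimate_def)
  then have "\<eta> 0 = 0" by (simp add: admissible_noise_def)
  obtain \<phi>' where CM: "\<eta> \<in> cameron_martin T" and a': "associated_state_path T f G \<eta> x0 \<phi>'"
    and max: "\<forall>\<xi>\<in>cameron_martin T. path_likelihood \<xi> \<le> path_likelihood \<phi>'"
    using MAP unfolding MAP_iff_maximal_path[OF \<eta>] by blast
  note iff = associated_state_path_iff[OF CM \<open>\<eta> 0 = 0\<close>]
  \<comment> \<open>Both likelihoods equal \<open>noise_value \<eta> x0\<close>, so uniqueness of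
    limits takes the place of uniqueness of state paths.\<close>
  have "path_likelihood \<phi> = path_likelihood \<phi>'"
    using noise_value_path[OF CM \<open>\<eta> 0 = 0\<close>] a a' unfolding iff by metis
  then show "\<phi> \<in> cameron_martin T \<and> (\<forall>\<xi>\<in>cameron_martin T. path_likelihood \<xi> \<le> path_likelihood \<phi>)"
    using max a by (simp add: associated_state_path_def)
qed

end

text \<open>Mean value inequality with the uniform bound on the first derivative;
  \<open>\<bar>B\<bar> + 1\<close> is positive whatever \<open>B\<close> is.\<close>

lemma C2b_uniformly_lipschitz:
  assumes "C2b_uniformly f"
  obtains L where "L > 0" "\<And>t x y. norm (f t x - f t y) \<le> L * norm (x - y)"
proof -
  obtain Df B where D: "\<forall>t x. (f t has_derivative blinfun_apply (Df t x)) (at x)" "\<forall>t x. norm (Df t x) \<le> B"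
    using assms unfolding C2b_uniformly_def by blast
  show thesis
  proof (rule that)
    show "\<bar>B\<bar> + 1 > 0" by simp
    show "norm (f t x - f t y) \<le> (\<bar>B\<bar> + 1) * norm (x - y)" for t x y
    proof (rule differentiable_bound[of UNIV "f t" "\<lambda>x. blinfun_apply (Df t x)"])
      fix z
      show "onorm (blinfun_apply (Df t z)) \<le> \<bar>B\<bar> + 1"
        using D(2)[rule_format, of t z] by (simp add: norm_blinfun.rep_eq[symmetric])
    qed (use D(1) in auto)
  qed
qed

text \<open>The first conjunct characterises noise pairs, the second identifies the maximisers as a
  set of curves; the latter also uses that every maximiser is driven by some noise.\<close>

theorem lemma9:
  fixes M :: "'w measure" and T :: real
    and f :: "real \<Rightarrow> real ^ 'n \<Rightarrow> real ^ 'n" and G :: "real ^ 'n ^ 'n"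
    and W X :: "real \<Rightarrow> 'w \<Rightarrow> real ^ 'n" and \<nu> :: "real ^ 'n \<Rightarrow> real"
    and Tm :: "real set" and m :: "real \<Rightarrow> nat"
    and Y :: "real \<Rightarrow> 'w \<Rightarrow> nat \<Rightarrow> real" and y :: "real \<Rightarrow> nat \<Rightarrow> real"
    and \<psi> :: "real \<Rightarrow> (nat \<Rightarrow> real) \<Rightarrow> real ^ 'n \<Rightarrow> real"
  assumes "prob_space M" and "T > 0"
    and "continuous_on UNIV (\<lambda>(t, x). f t x)" and "C2b_uniformly f"
    and "rank G = CARD('n)"
    and "wiener_process M T W"
    and "solves_sde M T f G W X"
    and "indep_of_process M T (X 0) W"
    and "\<forall>x. 0 \<le> \<nu> x" and "continuous_on UNIV \<nu>" and "bounded (range \<nu>)"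
    and "distributed M lborel (X 0) (\<lambda>x. ennreal (\<nu> x))"
    and "finite Tm" and "Tm \<subseteq> {0..T}"
    and "\<forall>t\<in>Tm. Y t \<in> measurable M (lborel_power (m t))"
    and "\<forall>t\<in>Tm. cond_indep_set M (vimage_algebra (space M) (X t) borel)
           (sets (vimage_algebra (space M) (Y t) (lborel_power (m t))))
           (other_events M T Tm m X Y t)"
    and "\<forall>t\<in>Tm. conditional_density M (lborel_power (m t)) (Y t) (X t) (\<psi> t)"
    and "\<forall>t\<in>Tm. \<forall>u\<in>space (lborel_power (m t)).
           continuous_on UNIV (\<psi> t u) \<and> bounded (range (\<psi> t u))"
    and "\<forall>t\<in>Tm. y t \<in> space (lborel_power (m t))"
    and "\<forall>t\<in>Tm. (LINT \<omega>|M. \<psi> t (y t) (X t \<omega>)) > 0"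
    and tubes_outside_cameron_martin:
      "\<forall>\<gamma> z0 \<eta> x0. admissible_noise T \<gamma> \<longrightarrow> \<gamma> \<notin> cameron_martin T \<longrightarrow>
         \<eta> \<in> cameron_martin T \<longrightarrow> \<eta> 0 = 0 \<longrightarrow> \<nu> x0 > 0 \<longrightarrow>
         ((\<lambda>\<epsilon>. measure M (tube M T W (X 0) \<gamma> z0 \<epsilon>) / measure M (tube M T W (X 0) \<eta> x0 \<epsilon>))
            \<longlongrightarrow> 0) (at_right 0)"
  shows "(\<forall>\<eta> x0. admissible_noise T \<eta> \<longrightarrow>
            (MAP_estimate M T (posterior M Tm \<psi> y X) W (X 0) \<eta> x0 \<longleftrightarrow>
               \<eta> \<in> cameron_martin T \<and>
               (\<exists>\<phi>. associated_state_path T f G \<eta> x0 \<phi> \<and>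
                    maximizes_over (energy_merit T f G \<nu> Tm \<psi> y) (cameron_martin T) \<phi>)))
       \<and> (\<forall>\<phi>. maximizes_over (energy_merit T f G \<nu> Tm \<psi> y) (cameron_martin T) \<phi> \<longleftrightarrow>
            (\<exists>\<eta> x0. MAP_estimate M T (posterior M Tm \<psi> y X) W (X 0) \<eta> x0 \<and>
                    associated_state_path T f G \<eta> x0 \<phi>))"
proof -
  obtain L where L: "L > 0" "\<And>t x y. norm (f t x - f t y) \<le> L * norm (x - y)"
    using C2b_uniformly_lipschitz[OF \<open>C2b_uniformly f\<close>] by blast
  define q where "q t = \<psi> t (y t)" for t
  have "invertible G"
    using \<open>rank G = CARD('n)\<close>
    by (simp add: full_rank_injective matrix_left_invertible_injective[symmetric] invertible_left_inverse)
  then interpret sde_posterior_tubes M T W X f G \<nu> Tm q L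
  proof (intro sde_posterior_tubes.intro sde_posterior.intro wiener.intro wiener_axioms.intro
      sde_posterior_axioms.intro sde_posterior_tubes_axioms.intro)
    show "\<And>t x. t \<in> Tm \<Longrightarrow> 0 \<le> q t x"
      using assms(17,19) by (auto simp: q_def conditional_density_def)
    show "\<And>t. t \<in> Tm \<Longrightarrow> continuous_on UNIV (q t)" "\<And>t. t \<in> Tm \<Longrightarrow> bounded (range (q t))"
      using assms(18,19) by (auto simp: q_def)
    show "\<And>t. t \<in> Tm \<Longrightarrow> 0 < (LINT \<omega>|M. q t (X t \<omega>))"
      using assms(20) by (simp add: q_def)
    show "\<And>\<gamma> z0 \<eta> x0. admissible_noise T \<gamma> \<Longrightarrow> \<gamma> \<notin> cameron_martin T \<Longrightarrow> \<eta> \<in> cameron_martin T \<Longrightarrow>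
      \<eta> 0 = 0 \<Longrightarrow> 0 < \<nu> x0 \<Longrightarrow>
      ((\<lambda>\<epsilon>. measure M (tube M T W (X 0) \<gamma> z0 \<epsilon>) / measure M (tube M T W (X 0) \<eta> x0 \<epsilon>)) \<longlongrightarrow> 0) (at_right 0)"
      using tubes_outside_cameron_martin by blast
  qed (use assms L in auto)
  have "(LINT \<omega>|M. indicator (space M) \<omega> * weight \<omega>) = (LINT \<omega>|M. weight \<omega>)"
    by (rule Bochner_Integration.integral_cong) auto
  then have post: "posterior M Tm \<psi> y X = (\<lambda>A. weighted_mass A / weighted_mass (space M))"
    by (simp add: fun_eq_iff posterior_def weighted_mass_def weight_def q_def)
  have "energy_merit T f G \<nu> Tm \<psi> y \<phi> = ereal_ln (path_likelihood \<phi>)" for \<phi>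
    by (rule energy_merit_eq_ln_likelihood) (simp add: q_def)
  then have max: "maximizes_over (energy_merit T f G \<nu> Tm \<psi> y) (cameron_martin T) \<phi> \<longleftrightarrow>
      \<phi> \<in> cameron_martin T \<and> (\<forall>\<xi>\<in>cameron_martin T. path_likelihood \<xi> \<le> path_likelihood \<phi>)" for \<phi>
    by (simp add: maximizes_over_def ereal_ln_le_iff path_likelihood_nonneg)
  have "associated_state_path T f G \<eta> x0 \<phi> \<Longrightarrow> \<phi> \<in> cameron_martin T" for \<eta> x0 \<phi>
    by (simp add: associated_state_path_def)
  then show ?thesis
    unfolding post max using MAP_iff_maximal_path maximal_path_iff by blast
qed

end
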